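(* Let $k$ be a commutative ring, $S$ a Frobenius $k$-algebra with Frobenius system $(e=e^1\otimes e^2,\bar\nu)$, $A$ a $k$-algebra and $j:S\to A$ a $k$-algebra map. Assume that there exists $a\in A$ such that $j(e^1)\,a\,j(e^2)=1_A$. Then the following assertions are equivalent: (1) $A$ is right FBN; (2) $S^{\mathrm{op}}\otimes_k A$ is right FBN and $A$ is right noetherian; (3) $B=C_S(A)=\{b\in A\mid j(s)b=bj(s)\text{ for all }s\in S\}$ is right FBN and $A$ is right noetherian.
   Context: Algebras are associative with unit. A Frobenius system for a $k$-algebra $S$ consists of an element $e=e^1\otimes e^2\in S\otimes_kS$ (summation understood) and a $k$-linear map $\bar\nu:S\to k$ with $se^1\otimes e^2=e^1\otimes e^2s$ for all $s\in S$ and $\bar\nu(e^1)e^2=e^1\bar\nu(e^2)=1_S$; $S$ is a Frobenius $k$-algebra if such a system exists. A ring $T$ is right bounded if every essential right ideal contains a non-zero two-sided ideal; right fully bounded if $T/P$ is right bounded for every two-sided prime ideal $P$ of $T$; right FBN if it is right fully bounded and right noetherian. *)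

theory Defs
  imports "HOL-Algebra.Algebra"
begin

section \<open>Algebras over a commutative ring\<close>

text \<open>
  The library locale \<^locale>\<open>algebra\<close> requires the algebra itself to be commutative; here only
  the base ring is.
\<close>

locale assoc_algebra = module + ring M +
  assumes smult_mult_left:
      "\<lbrakk>c \<in> carrier R; x \<in> carrier M; y \<in> carrier M\<rbrakk> \<Longrightarrow>
       (c \<odot>\<^bsub>M\<^esub> x) \<otimes>\<^bsub>M\<^esub> y = c \<odot>\<^bsub>M\<^esub> (x \<otimes>\<^bsub>M\<^esub> y)"
    and smult_mult_right:
      "\<lbrakk>c \<in> carrier R; x \<in> carrier M; y \<in> carrier M\<rbrakk> \<Longrightarrow>
       x \<otimes>\<^bsub>M\<^esub> (c \<odot>\<^bsub>M\<^esub> y) = c \<odot>\<^bsub>M\<^esub> (x \<otimes>\<^bsub>M\<^esub> y)"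

definition linear_forms ::
  "('k, 'c) ring_scheme \<Rightarrow> ('k, 's, 'm) module_scheme \<Rightarrow> ('s \<Rightarrow> 'k) set" where
  "linear_forms K S =
     {f \<in> hom (add_monoid S) (add_monoid K).
        \<forall>c\<in>carrier K. \<forall>s\<in>carrier S. f (c \<odot>\<^bsub>S\<^esub> s) = c \<otimes>\<^bsub>K\<^esub> f s}"

definition algebra_hom ::
  "('k, 'c) ring_scheme \<Rightarrow> ('k, 's, 'm) module_scheme \<Rightarrow> ('k, 'a, 'n) module_scheme
    \<Rightarrow> ('s \<Rightarrow> 'a) set" where
  "algebra_hom K S A =
     {h \<in> ring_hom S A. \<forall>c\<in>carrier K. \<forall>s\<in>carrier S. h (c \<odot>\<^bsub>S\<^esub> s) = c \<odot>\<^bsub>A\<^esub> h s}"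

definition op_algebra :: "('k, 's, 'm) module_scheme \<Rightarrow> ('k, 's, 'm) module_scheme" where
  "op_algebra S = S\<lparr>monoid.mult := (\<lambda>x y. y \<otimes>\<^bsub>S\<^esub> x)\<rparr>"

definition centralizer ::
  "('k, 's, 'm) module_scheme \<Rightarrow> ('k, 'a, 'n) module_scheme \<Rightarrow> ('s \<Rightarrow> 'a)
    \<Rightarrow> ('k, 'a, 'n) module_scheme" where
  "centralizer S A j =
     A\<lparr>carrier := {b \<in> carrier A. \<forall>s\<in>carrier S. j s \<otimes>\<^bsub>A\<^esub> b = b \<otimes>\<^bsub>A\<^esub> j s}\<rparr>"


section \<open>Tensor products\<close>

text \<open>
  \<open>S \<otimes>\<^sub>k A\<close> is the free abelian group on \<open>carrier S \<times> carrier A\<close> modulo the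
  subgroup generated by the usual relations. As that subgroup is a two-sided ideal for the product
  on the free abelian group extending \<open>(x, y) (x', y') = (x x', y y')\<close>, the quotient and its
  multiplication are obtained from \<^const>\<open>FactRing\<close>.
\<close>

definition pair_ring ::
  "('k, 's, 'm) module_scheme \<Rightarrow> ('k, 'a, 'n) module_scheme \<Rightarrow> ('s \<times> 'a \<Rightarrow>\<^sub>0 int) ring" where
  "pair_ring S A =
     \<lparr>carrier = carrier (free_Abelian_group (carrier S \<times> carrier A)),
      monoid.mult = (\<lambda>c d. frag_extend (\<lambda>p. frag_extend (\<lambda>q.
                 frag_of (fst p \<otimes>\<^bsub>S\<^esub> fst q, snd p \<otimes>\<^bsub>A\<^esub> snd q)) d) c),
      monoid.one = frag_of (\<one>\<^bsub>S\<^esub>, \<one>\<^bsub>A\<^esub>),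
      ring.zero = 0,
      ring.add = (+)\<rparr>"

definition tensor_relations ::
  "('k, 'c) ring_scheme \<Rightarrow> ('k, 's, 'm) module_scheme \<Rightarrow> ('k, 'a, 'n) module_scheme
    \<Rightarrow> ('s \<times> 'a \<Rightarrow>\<^sub>0 int) set" where
  "tensor_relations K S A = generate (free_Abelian_group (carrier S \<times> carrier A))
     ({frag_of (x \<oplus>\<^bsub>S\<^esub> x', y) - frag_of (x, y) - frag_of (x', y) | x x' y.
         x \<in> carrier S \<and> x' \<in> carrier S \<and> y \<in> carrier A} \<union>
      {frag_of (x, y \<oplus>\<^bsub>A\<^esub> y') - frag_of (x, y) - frag_of (x, y') | x y y'.
         x \<in> carrier S \<and> y \<in> carrier A \<and> y' \<in> carrier A} \<union>
      {frag_of (c \<odot>\<^bsub>S\<^esub> x, y) - frag_of (x, c \<odot>\<^bsub>A\<^esub> y) | c x y.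
         c \<in> carrier K \<and> x \<in> carrier S \<and> y \<in> carrier A})"

definition tensor_algebra ::
  "('k, 'c) ring_scheme \<Rightarrow> ('k, 's, 'm) module_scheme \<Rightarrow> ('k, 'a, 'n) module_scheme
    \<Rightarrow> ('s \<times> 'a \<Rightarrow>\<^sub>0 int) set ring" where
  "tensor_algebra K S A = pair_ring S A Quot tensor_relations K S A"

definition pure_tensor ::
  "('k, 'c) ring_scheme \<Rightarrow> ('k, 's, 'm) module_scheme \<Rightarrow> ('k, 'a, 'n) module_scheme
    \<Rightarrow> 's \<Rightarrow> 'a \<Rightarrow> ('s \<times> 'a \<Rightarrow>\<^sub>0 int) set" where
  "pure_tensor K S A x y = tensor_relations K S A +>\<^bsub>pair_ring S A\<^esub> frag_of (x, y)"

text \<open>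
  \<open>tensor_eval G f t\<close> is the sum \<open>f(t\<^sup>1, t\<^sup>2)\<close> (summation understood) in the abelian group
  underlying \<open>G\<close>. It is only meaningful for \<open>k\<close>-balanced biadditive \<open>f\<close>: the value is then the
  same for all representatives of the coset \<open>t\<close>, so that the image below is a singleton.
\<close>

definition tensor_eval ::
  "('b, 'm) ring_scheme \<Rightarrow> ('s \<Rightarrow> 'a \<Rightarrow> 'b) \<Rightarrow> ('s \<times> 'a \<Rightarrow>\<^sub>0 int) set \<Rightarrow> 'b" where
  "tensor_eval G f t = the_elem ((\<lambda>c.
     finsum G (\<lambda>p. add_pow G (Poly_Mapping.lookup c p) (f (fst p) (snd p)))
       (Poly_Mapping.keys c)) ` t)"


section \<open>Frobenius systems\<close>

definition frobenius_system ::
  "('k, 'c) ring_scheme \<Rightarrow> ('k, 's, 'm) module_scheme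
    \<Rightarrow> ('s \<times> 's \<Rightarrow>\<^sub>0 int) set \<Rightarrow> ('s \<Rightarrow> 'k) \<Rightarrow> bool" where
  "frobenius_system K S e \<nu> \<longleftrightarrow>
     e \<in> carrier (tensor_algebra K S S) \<and>
     \<nu> \<in> linear_forms K S \<and>
     (\<forall>s\<in>carrier S.
        tensor_eval (tensor_algebra K S S) (\<lambda>x y. pure_tensor K S S (s \<otimes>\<^bsub>S\<^esub> x) y) e =
        tensor_eval (tensor_algebra K S S) (\<lambda>x y. pure_tensor K S S x (y \<otimes>\<^bsub>S\<^esub> s)) e) \<and>
     tensor_eval S (\<lambda>x y. \<nu> x \<odot>\<^bsub>S\<^esub> y) e = \<one>\<^bsub>S\<^esub> \<and>
     tensor_eval S (\<lambda>x y. \<nu> y \<odot>\<^bsub>S\<^esub> x) e = \<one>\<^bsub>S\<^esub>"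


section \<open>Right fully bounded noetherian rings\<close>

locale right_ideal = additive_subgroup I R + ring R for I and R (structure) +
  assumes right_closed: "\<lbrakk>a \<in> I; x \<in> carrier R\<rbrakk> \<Longrightarrow> a \<otimes> x \<in> I"

definition essential_right_ideal :: "'a set \<Rightarrow> ('a, 'm) ring_scheme \<Rightarrow> bool" where
  "essential_right_ideal E R \<longleftrightarrow>
     right_ideal E R \<and> (\<forall>J. right_ideal J R \<and> J \<noteq> {\<zero>\<^bsub>R\<^esub>} \<longrightarrow> E \<inter> J \<noteq> {\<zero>\<^bsub>R\<^esub>})"

definition right_bounded :: "('a, 'm) ring_scheme \<Rightarrow> bool" where
  "right_bounded R \<longleftrightarrow>
     (\<forall>E. essential_right_ideal E R \<longrightarrow> (\<exists>I. ideal I R \<and> I \<noteq> {\<zero>\<^bsub>R\<^esub>} \<and> I \<subseteq> E))"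

text \<open>The library locale \<^locale>\<open>primeideal\<close> is the notion for commutative rings.\<close>

definition two_sided_prime :: "'a set \<Rightarrow> ('a, 'm) ring_scheme \<Rightarrow> bool" where
  "two_sided_prime P R \<longleftrightarrow>
     ideal P R \<and> P \<noteq> carrier R \<and>
     (\<forall>I J. ideal I R \<and> ideal J R \<and> I \<cdot>\<^bsub>R\<^esub> J \<subseteq> P \<longrightarrow> I \<subseteq> P \<or> J \<subseteq> P)"

definition right_fully_bounded :: "('a, 'm) ring_scheme \<Rightarrow> bool" where
  "right_fully_bounded R \<longleftrightarrow> (\<forall>P. two_sided_prime P R \<longrightarrow> right_bounded (R Quot P))"

definition right_noetherian :: "('a, 'm) ring_scheme \<Rightarrow> bool" where
  "right_noetherian R \<longleftrightarrow>
     (\<forall>I :: nat \<Rightarrow> 'a set. (\<forall>n. right_ideal (I n) R) \<and> (\<forall>n. I n \<subseteq> I (Suc n)) \<longrightarrow>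
        (\<exists>N. \<forall>n\<ge>N. I n = I N))"

definition right_FBN :: "('a, 'm) ring_scheme \<Rightarrow> bool" where
  "right_FBN R \<longleftrightarrow> right_fully_bounded R \<and> right_noetherian R"

end

theory Submission
  imports Defs
begin

text \<open>
  Put \<open>T = S\<^sup>o\<^sup>p \<otimes>\<^sub>k A\<close>. The ring \<open>A\<close> is a right \<open>T\<close>-module with endomorphism ring \<open>B\<close>, and the element of
  trace one splits \<open>T \<rightarrow> A\<close>. Hence (1) implies (2), (2) implies (3) and (3) implies (1) because of two
  facts.

  \<^item> If a ring \<open>R\<close> is a finitely generated right module over a right FBN ring along a ring map, then
    \<open>R\<close> is right FBN. This applies to \<open>A \<rightarrow> T\<close>, since \<open>S\<close> has the finite dual basis
    \<open>\<nu>(- e\<^sup>1), e\<^sup>2\<close>, and to \<open>B \<rightarrow> A\<close>: if finitely many \<open>e\<^sup>1 \<otimes> x j(e\<^sup>2)\<close> generate all of them over the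
    right noetherian ring \<open>A\<close>, then the same \<open>x\<close> generate \<open>A\<close> over \<open>B\<close>.

  \<^item> Corners \<open>\<epsilon> T \<epsilon>\<close> of right FBN rings are right FBN, and \<open>B\<close> is a corner of \<open>T\<close>.

  The first fact is proved without Krull dimension. For a prime \<open>Q\<close> of the small ring call a
  module \<open>Q\<close>-small if its annihilator is not contained in \<open>Q\<close>; by primeness this property passes
  to extensions. Boundedness modulo \<open>Q\<close> shows that, when \<open>Q\<close> is minimal over the kernel of the ring
  map, a descending chain of submodules of \<open>R\<close> has only finitely many factors that are not
  \<open>Q\<close>-small. A left cancellable element \<open>c\<close> of an essential right ideal without two-sided ideals
  would give a chain \<open>c\<^sup>n R\<close> violating this.
\<close>

section \<open>Right ideals and boundedness modulo a prime ideal\<close>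

text \<open>Minimality of \<open>Q\<close> is essential: for the identity map of the integers and
  \<open>Q\<close> = pZ, every factor of the chain p^n Z has annihilator pZ, so none is
  \<open>Q\<close>-small. At a minimal \<open>Q\<close> the finiteness comes from a filtration of
  \<open>R\<close> with cyclic factors killed by primes of the small ring. A factor killed by a
  prime not inside \<open>Q\<close> is \<open>Q\<close>-small as a whole; a factor killed by
  \<open>Q\<close> is a quotient of the small ring modulo \<open>Q\<close>, where the noetherian
  condition and boundedness apply. Quotient modules never appear. A factor is a pair of submodules
  of \<open>R\<close>, and being killed by b means that b carries the larger one into the smaller
  one. For finite generation of \<open>A\<close> over \<open>B\<close>, an element t of
  \<open>T\<close> is read as the map s -> \<nu>(s t^1) t^2 from \<open>S\<close> to
  \<open>A\<close>. Under this reading e^1 \<otimes> x j(e^2) y becomes s -> x j(s) y. Inserting e^1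
  for s and multiplying by a j(e^2) on the right gives x times the trace of y a, an element of x
  \<open>B\<close>. Submodules of \<open>A\<close> over \<open>B\<close> are thus pulled back to
  submodules of \<open>T\<close> over \<open>A\<close>.\<close>

lemma acc_imp_maximal:
  assumes acc: "\<And>I :: nat \<Rightarrow> 'a set. (\<And>n. I n \<in> F) \<Longrightarrow> (\<And>n. I n \<subseteq> I (Suc n)) \<Longrightarrow> \<exists>N. \<forall>n\<ge>N. I n = I N"
    and ne: "U \<in> F"
  obtains M where "M \<in> F" "\<And>Y. Y \<in> F \<Longrightarrow> M \<subseteq> Y \<Longrightarrow> Y = M"
proof (rule ccontr)
  assume "\<not> thesis"
  then have "\<forall>M\<in>F. \<exists>Y. Y \<in> F \<and> M \<subset> Y"
    using that by blast
  then obtain g where g: "\<And>M. M \<in> F \<Longrightarrow> g M \<in> F \<and> M \<subset> g M"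
    by metis
  define I where "I = rec_nat U (\<lambda>_. g)"
  have IF: "I n \<in> F" for n
    by (induction n) (use ne g in \<open>simp_all add: I_def\<close>)
  have "I n \<subset> I (Suc n)" for n
    using g[OF IF[of n]] by (simp add: I_def)
  with acc[of I] IF show False
    by (metis le_SucI nle_le psubset_imp_subset psubset_eq)
qed

context ring
begin

lemma right_ideal_iff:
  "right_ideal I R \<longleftrightarrow> I \<subseteq> carrier R \<and> \<zero> \<in> I \<and> (\<forall>x\<in>I. \<forall>y\<in>I. x \<oplus> y \<in> I) \<and>
     (\<forall>x\<in>I. \<forall>r\<in>carrier R. x \<otimes> r \<in> I)" (is "?L \<longleftrightarrow> ?R")
proof
  assume ?L
  then interpret right_ideal I R .
  show ?R
    using a_subset right_closed by (auto simp: zero_closed)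
next
  assume R: ?R
  have "additive_subgroup I R"
  proof (intro additive_subgroup.intro add.subgroupI)
    show "\<ominus> x \<in> I" if "x \<in> I" for x
      using R that by (metis l_minus one_closed r_minus r_one subsetD a_inv_closed)
  qed (use R in auto)
  then show ?L
    using R by (simp add: right_ideal_def ring_axioms right_ideal_axioms_def)
qed

lemma ideal_iff:
  "ideal I R \<longleftrightarrow> right_ideal I R \<and> (\<forall>x\<in>I. \<forall>r\<in>carrier R. r \<otimes> x \<in> I)"
  by (auto simp: ideal_def right_ideal_def ideal_axioms_def right_ideal_axioms_def)

lemma right_idealD:
  assumes "right_ideal I R"
  shows "I \<subseteq> carrier R" "\<zero> \<in> I" "\<And>x y. x \<in> I \<Longrightarrow> y \<in> I \<Longrightarrow> x \<oplus> y \<in> I"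
    "\<And>x r. x \<in> I \<Longrightarrow> r \<in> carrier R \<Longrightarrow> x \<otimes> r \<in> I"
    "\<And>x. x \<in> I \<Longrightarrow> \<ominus> x \<in> I" "\<And>x y. x \<in> I \<Longrightarrow> y \<in> I \<Longrightarrow> x \<ominus> y \<in> I"
proof -
  interpret right_ideal I R by fact
  show "I \<subseteq> carrier R" "\<zero> \<in> I" "\<And>x y. x \<in> I \<Longrightarrow> y \<in> I \<Longrightarrow> x \<oplus> y \<in> I"
    "\<And>x r. x \<in> I \<Longrightarrow> r \<in> carrier R \<Longrightarrow> x \<otimes> r \<in> I"
    "\<And>x. x \<in> I \<Longrightarrow> \<ominus> x \<in> I" "\<And>x y. x \<in> I \<Longrightarrow> y \<in> I \<Longrightarrow> x \<ominus> y \<in> I"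
    using right_closed a_subset by (auto simp: a_minus_def)
qed

lemma right_ideal_principal:
  assumes "x \<in> carrier R"
  shows "right_ideal ((\<otimes>) x ` carrier R) R"
proof -
  have "\<exists>t\<in>carrier R. x \<otimes> r \<oplus> x \<otimes> s = x \<otimes> t" if "r \<in> carrier R" "s \<in> carrier R" for r s
    using assms that by (metis add.m_closed r_distr)
  moreover have "\<exists>t\<in>carrier R. x \<otimes> r \<otimes> s = x \<otimes> t" if "r \<in> carrier R" "s \<in> carrier R" for r s
    using assms that by (metis m_assoc m_closed)
  moreover have "\<exists>t\<in>carrier R. \<zero> = x \<otimes> t"
    using assms by (metis r_null zero_closed)
  ultimately show ?thesis
    using assms by (auto simp: right_ideal_iff image_iff)
qed

lemma right_ideal_sum:
  assumes "right_ideal I R" "right_ideal J R"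
  shows "right_ideal (set_add R I J) R"
proof -
  note I = right_idealD[OF assms(1)]
  note J = right_idealD[OF assms(2)]
  have mem: "z \<in> set_add R I J \<longleftrightarrow> (\<exists>x\<in>I. \<exists>y\<in>J. z = x \<oplus> y)" for z
    by (auto simp: set_add_def')
  show ?thesis
    unfolding right_ideal_iff
  proof (intro conjI ballI)
    show "set_add R I J \<subseteq> carrier R"
      using I(1) J(1) by (auto simp: mem subset_iff)
    show "\<zero> \<in> set_add R I J"
      unfolding mem using I(2) J(2) by (intro bexI[of _ \<zero>]) simp_all
    show "x \<oplus> y \<in> set_add R I J" if asm: "x \<in> set_add R I J" "y \<in> set_add R I J" for x y
    proof -
      obtain a b c d where *: "a \<in> I" "b \<in> J" "x = a \<oplus> b" "c \<in> I" "d \<in> J" "y = c \<oplus> d"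
        using asm by (auto simp: mem)
      then have "a \<in> carrier R" "b \<in> carrier R" "c \<in> carrier R" "d \<in> carrier R"
        using I(1) J(1) by auto
      then have "x \<oplus> y = (a \<oplus> c) \<oplus> (b \<oplus> d)"
        using * by (simp add: add.m_ac)
      moreover have "a \<oplus> c \<in> I" "b \<oplus> d \<in> J"
        using * I(3) J(3) by auto
      ultimately show ?thesis
        unfolding mem by blast
    qed
    show "x \<otimes> r \<in> set_add R I J" if asm: "x \<in> set_add R I J" "r \<in> carrier R" for x r
    proof -
      obtain a b where *: "a \<in> I" "b \<in> J" "x = a \<oplus> b"
        using asm by (auto simp: mem)
      then have "x \<otimes> r = a \<otimes> r \<oplus> b \<otimes> r"
        using I(1) J(1) that by (simp add: l_distr subset_iff)
      moreover have "a \<otimes> r \<in> I" "b \<otimes> r \<in> J"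
        using * that I(4) J(4) by auto
      ultimately show ?thesis
        unfolding mem by blast
    qed
  qed
qed

lemma sum_upper:
  assumes "right_ideal I R" "right_ideal J R"
  shows "I \<subseteq> set_add R I J" "J \<subseteq> set_add R I J"
proof -
  show "I \<subseteq> set_add R I J"
  proof
    fix x assume "x \<in> I"
    then have "x = x \<oplus> \<zero>" using right_idealD(1)[OF assms(1)] by auto
    with \<open>x \<in> I\<close> right_idealD(2)[OF assms(2)] show "x \<in> set_add R I J"
      unfolding set_add_def' by blast
  qed
  show "J \<subseteq> set_add R I J"
  proof
    fix x assume "x \<in> J"
    then have "x = \<zero> \<oplus> x" using right_idealD(1)[OF assms(2)] by auto
    with \<open>x \<in> J\<close> right_idealD(2)[OF assms(1)] show "x \<in> set_add R I J"
      unfolding set_add_def' by blast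
  qed
qed

lemma two_sided_prime_iff:
  "two_sided_prime P R \<longleftrightarrow> ideal P R \<and> \<one> \<notin> P \<and>
     (\<forall>a\<in>carrier R. \<forall>b\<in>carrier R. (\<forall>c\<in>carrier R. a \<otimes> c \<otimes> b \<in> P) \<longrightarrow> a \<in> P \<or> b \<in> P)"
  (is "?L \<longleftrightarrow> ?R")
proof
  assume L: ?L
  then interpret ideal P R
    by (simp add: two_sided_prime_def)
  have "a \<in> P \<or> b \<in> P"
    if ab: "a \<in> carrier R" "b \<in> carrier R" and P: "\<And>c. c \<in> carrier R \<Longrightarrow> a \<otimes> c \<otimes> b \<in> P" for a b
  proof -
    \<comment> \<open>In place of the ideals generated by \<open>a\<close> and \<open>b\<close>,
      take the largest suitable ones: all elements that multiply \<open>b\<close> into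
      \<open>P\<close>, then all elements that \<open>I\<close> multiplies into \<open>P\<close>.
      Membership is tested directly, without sums of products.\<close>
    define I where "I = {x \<in> carrier R. \<forall>c\<in>carrier R. x \<otimes> c \<otimes> b \<in> P}"
    define J where "J = {y \<in> carrier R. \<forall>x\<in>I. \<forall>c\<in>carrier R. x \<otimes> c \<otimes> y \<in> P}"
    have "x \<otimes> r \<otimes> c \<otimes> b \<in> P \<and> r \<otimes> x \<otimes> c \<otimes> b \<in> P"
      if x: "x \<in> I" and r: "r \<in> carrier R" and c: "c \<in> carrier R" for x r c
    proof -
      have "x \<in> carrier R" "x \<otimes> (r \<otimes> c) \<otimes> b \<in> P" "r \<otimes> (x \<otimes> c \<otimes> b) \<in> P"
        using x r c by (auto simp: I_def I_l_closed)
      then show ?thesis using r c ab by (simp add: m_assoc)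
    qed
    then have I: "ideal I R"
      using ab by (auto simp: ideal_iff right_ideal_iff I_def l_distr)
    have IR: "I \<subseteq> carrier R"
      by (auto simp: I_def)
    have "x \<otimes> c \<otimes> (y \<otimes> r) \<in> P \<and> x \<otimes> c \<otimes> (r \<otimes> y) \<in> P"
      if "x \<in> I" "c \<in> carrier R" "y \<in> J" "r \<in> carrier R" for x c y r
    proof -
      have x: "x \<in> carrier R" "y \<in> carrier R"
        using that IR by (auto simp: J_def)
      have "x \<otimes> c \<otimes> y \<in> P" "x \<otimes> (c \<otimes> r) \<otimes> y \<in> P"
        using that by (auto simp: J_def)
      then show ?thesis
        using x that I_r_closed[of "x \<otimes> c \<otimes> y" r] by (simp add: m_assoc)
    qed
    then have J: "ideal J R"
      using IR by (auto simp: ideal_iff right_ideal_iff J_def r_distr subset_iff)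
    have "I \<cdot> J \<subseteq> P"
    proof
      fix z assume "z \<in> I \<cdot> J"
      then show "z \<in> P"
      proof induction
        case (prod i j)
        then have "i \<otimes> \<one> \<otimes> j \<in> P" by (auto simp: J_def)
        then show ?case using prod IR by auto
      qed auto
    qed
    with L I J have "I \<subseteq> P \<or> J \<subseteq> P"
      by (simp add: two_sided_prime_def)
    moreover have "a \<in> I" "b \<in> J"
      using ab P by (auto simp: I_def J_def)
    ultimately show ?thesis by auto
  qed
  moreover have "\<one> \<notin> P"
    using L one_imp_carrier by (auto simp: two_sided_prime_def)
  ultimately show ?R
    using is_ideal by blast
next
  assume R: ?R
  have "I \<subseteq> P \<or> J \<subseteq> P" if "ideal I R" "ideal J R" "I \<cdot> J \<subseteq> P" for I J
  proof (rule ccontr)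
    assume "\<not> ?thesis"
    then obtain a b where ab: "a \<in> I" "a \<notin> P" "b \<in> J" "b \<notin> P" by auto
    interpret I: ideal I R by fact
    interpret J: ideal J R by fact
    have "a \<otimes> c \<otimes> b \<in> P" if "c \<in> carrier R" for c
      using \<open>I \<cdot> J \<subseteq> P\<close> ideal_prod.prod[of "a \<otimes> c" I b J R] ab that I.I_r_closed by blast
    then show False using R ab I.Icarr J.Icarr by blast
  qed
  with R show ?L
    by (auto simp: two_sided_prime_def)
qed

text \<open>This is the largest two-sided ideal inside \<open>E\<close>. Hence \<open>E\<close>
  contains a non-zero ideal iff this one is non-zero, which turns boundedness into the existence of
  a single element.\<close>

lemma ideal_core:
  assumes "right_ideal E R"
  shows "ideal {x \<in> carrier R. \<forall>r\<in>carrier R. r \<otimes> x \<in> E} R"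
proof -
  note E = right_idealD[OF assms]
  have "r \<otimes> (x \<otimes> s) \<in> E"
    if "x \<in> carrier R" "\<forall>r\<in>carrier R. r \<otimes> x \<in> E" "r \<in> carrier R" "s \<in> carrier R" for r s x
    using that E(4)[of "r \<otimes> x" s] by (simp add: m_assoc)
  moreover have "r \<otimes> (s \<otimes> x) \<in> E"
    if "x \<in> carrier R" "\<forall>r\<in>carrier R. r \<otimes> x \<in> E" "r \<in> carrier R" "s \<in> carrier R" for r s x
    using that by (simp flip: m_assoc)
  ultimately show ?thesis
    using E by (auto simp: ideal_iff right_ideal_iff r_distr)
qed

text \<open>Right boundedness of the quotient by \<open>P\<close>, read in \<open>R\<close> to avoid
  cosets: right ideals of the quotient are right ideals containing \<open>P\<close>, essentiality is
  tested on principal right ideals, and a non-zero ideal inside \<open>E\<close> is replaced by one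
  element of its core outside \<open>P\<close>.\<close>

definition bounded_mod :: "'a set \<Rightarrow> bool" where
  "bounded_mod P \<longleftrightarrow> (\<forall>E. right_ideal E R \<and> P \<subseteq> E \<and>
     (\<forall>x\<in>carrier R - P. \<exists>r\<in>carrier R. x \<otimes> r \<in> E - P) \<longrightarrow>
     (\<exists>x\<in>carrier R - P. \<forall>r\<in>carrier R. r \<otimes> x \<in> E))"

lemma essential_right_ideal_iff:
  "essential_right_ideal E R \<longleftrightarrow>
     right_ideal E R \<and> (\<forall>x\<in>carrier R - {\<zero>}. \<exists>r\<in>carrier R. x \<otimes> r \<in> E - {\<zero>})"
  (is "?L \<longleftrightarrow> ?R")
proof
  assume L: ?L
  then have E: "right_ideal E R" by (simp add: essential_right_ideal_def)
  have "\<exists>r\<in>carrier R. x \<otimes> r \<in> E - {\<zero>}" if "x \<in> carrier R" "x \<noteq> \<zero>" for x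
  proof -
    have "x \<in> (\<otimes>) x ` carrier R"
      using that by (metis image_eqI one_closed r_one)
    with that have "(\<otimes>) x ` carrier R \<noteq> {\<zero>}" by blast
    with L right_ideal_principal that have "E \<inter> (\<otimes>) x ` carrier R \<noteq> {\<zero>}"
      by (simp add: essential_right_ideal_def)
    moreover have "\<zero> \<in> E \<inter> (\<otimes>) x ` carrier R"
      using right_idealD(2)[OF E] right_idealD(2)[OF right_ideal_principal] that by simp
    ultimately show ?thesis by blast
  qed
  with E show ?R by blast
next
  assume R: ?R
  have "E \<inter> J \<noteq> {\<zero>}" if J: "right_ideal J R" "J \<noteq> {\<zero>}" for J
  proof -
    obtain x where "x \<in> J" "x \<noteq> \<zero>"
      using right_idealD(2)[OF J(1)] J(2) by blast
    moreover obtain r where "r \<in> carrier R" "x \<otimes> r \<in> E - {\<zero>}"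
      using R right_idealD(1)[OF J(1)] calculation by blast
    ultimately show ?thesis using right_idealD(4)[OF J(1)] by blast
  qed
  with R show ?L by (auto simp: essential_right_ideal_def)
qed

lemma right_bounded_iff: "right_bounded R \<longleftrightarrow> bounded_mod {\<zero>}"
proof -
  have "(\<exists>I. ideal I R \<and> I \<noteq> {\<zero>} \<and> I \<subseteq> E) \<longleftrightarrow> (\<exists>x\<in>carrier R - {\<zero>}. \<forall>r\<in>carrier R. r \<otimes> x \<in> E)"
    (is "?L \<longleftrightarrow> ?R") if E: "right_ideal E R" for E
  proof
    assume ?L
    then obtain I where I: "ideal I R" "I \<noteq> {\<zero>}" "I \<subseteq> E" by blast
    then obtain x where "x \<in> I" "x \<noteq> \<zero>"
      using additive_subgroup.zero_closed[OF ideal.axioms(1)[OF I(1)]] by blast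
    with I show ?R
      by (meson DiffI ideal.I_l_closed ideal.Icarr singletonD subsetD)
  next
    assume ?R
    then obtain x where x: "x \<in> carrier R" "x \<noteq> \<zero>" "\<forall>r\<in>carrier R. r \<otimes> x \<in> E" by auto
    let ?I = "{x \<in> carrier R. \<forall>r\<in>carrier R. r \<otimes> x \<in> E}"
    have "?I \<subseteq> E" by (metis (no_types, lifting) l_one mem_Collect_eq one_closed subsetI)
    moreover have "x \<in> ?I" using x by blast
    ultimately show ?L using ideal_core[OF E] x(2) by blast
  qed
  then show ?thesis
    unfolding right_bounded_def bounded_mod_def essential_right_ideal_iff
    using right_idealD(2) by auto
qed

end

lemma (in ring) noetherian_maximal:
  assumes "right_noetherian R" "\<And>U. U \<in> F \<Longrightarrow> right_ideal U R" "U \<in> F"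
  obtains M where "M \<in> F" "\<And>Y. Y \<in> F \<Longrightarrow> M \<subseteq> Y \<Longrightarrow> Y = M"
proof (rule acc_imp_maximal[of F U])
  show "\<exists>N. \<forall>n\<ge>N. I n = I N" if "\<And>n. I n \<in> F" "\<And>n. I n \<subseteq> I (Suc n)" for I :: "nat \<Rightarrow> 'a set"
    using assms(1) that assms(2) unfolding right_noetherian_def by blast
qed (use assms that in blast)+

section \<open>Boundedness under surjective ring maps\<close>

locale surjective_ring_hom = ring_hom_ring R S h for R (structure) and S and h +
  assumes surj: "h ` carrier R = carrier S"
begin

lemma bounded_mod_iff:
  assumes P: "P = a_kernel R S h"
  shows "right_bounded S \<longleftrightarrow> ring.bounded_mod R P"
proof -
  have P: "x \<in> P \<longleftrightarrow> x \<in> carrier R \<and> h x = \<zero>\<^bsub>S\<^esub>" for x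
    unfolding assms a_kernel_def' by simp
  have *: "S.bounded_mod {\<zero>\<^bsub>S\<^esub>} \<longleftrightarrow> R.bounded_mod P"
  proof
    assume S: "S.bounded_mod {\<zero>\<^bsub>S\<^esub>}"
    show "R.bounded_mod P"
      unfolding R.bounded_mod_def
    proof (intro allI impI, elim conjE)
      fix E
      assume E: "right_ideal E R" "P \<subseteq> E"
        and ess: "\<forall>x\<in>carrier R - P. \<exists>r\<in>carrier R. x \<otimes> r \<in> E - P"
      note ED = R.right_idealD[OF E(1)]
      \<comment> \<open>As \<open>E\<close> contains the kernel, membership in \<open>E\<close> can
        be tested on images.\<close>
      have inE: "x \<in> E" if asm: "x \<in> carrier R" "h x \<in> h ` E" for x
      proof -
        obtain y where y: "y \<in> E" "h x = h y" using asm by blast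
        then have "x \<ominus> y \<in> P"
          using that ED(1) by (auto simp: P R.minus_eq S.r_neg)
        then have "(x \<ominus> y) \<oplus> y \<in> E" using y E(2) ED(3) by blast
        moreover have "(x \<ominus> y) \<oplus> y = x"
          using that y ED(1) by (auto simp: R.minus_eq R.a_assoc R.l_neg)
        ultimately show ?thesis by simp
      qed
      have "right_ideal (h ` E) S"
        unfolding S.right_ideal_iff
      proof (intro conjI ballI)
        show "h ` E \<subseteq> carrier S" using ED(1) by auto
        show "\<zero>\<^bsub>S\<^esub> \<in> h ` E" using ED(2) by force
        show "x \<oplus>\<^bsub>S\<^esub> y \<in> h ` E" if "x \<in> h ` E" "y \<in> h ` E" for x y
          using that ED(1,3) by (auto simp: image_iff subset_iff simp flip: hom_add)
        show "x \<otimes>\<^bsub>S\<^esub> y \<in> h ` E" if asm: "x \<in> h ` E" "y \<in> carrier S" for x y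
        proof -
          obtain r where "r \<in> carrier R" "y = h r" using asm surj by blast
          with that show ?thesis
            using ED(1,4) by (auto simp: subset_iff simp flip: hom_mult)
        qed
      qed
      moreover have "\<exists>r\<in>carrier S. x \<otimes>\<^bsub>S\<^esub> r \<in> h ` E - {\<zero>\<^bsub>S\<^esub>}" if asm: "x \<in> carrier S - {\<zero>\<^bsub>S\<^esub>}" for x
      proof -
        obtain y where y: "y \<in> carrier R" "x = h y" using asm surj by blast
        then obtain r where "r \<in> carrier R" "y \<otimes> r \<in> E - P" using ess asm P by auto
        with y show ?thesis by (intro bexI[of _ "h r"]) (auto simp: P simp flip: hom_mult)
      qed
      moreover have "{\<zero>\<^bsub>S\<^esub>} \<subseteq> h ` E" using ED(2) by force
      ultimately have "\<exists>x\<in>carrier S - {\<zero>\<^bsub>S\<^esub>}. \<forall>r\<in>carrier S. r \<otimes>\<^bsub>S\<^esub> x \<in> h ` E"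
        using S[unfolded S.bounded_mod_def, rule_format, of "h ` E"] by simp
      then obtain x where x: "x \<in> carrier S" "x \<noteq> \<zero>\<^bsub>S\<^esub>" "\<And>r. r \<in> carrier S \<Longrightarrow> r \<otimes>\<^bsub>S\<^esub> x \<in> h ` E"
        by blast
      then obtain y where y: "y \<in> carrier R" "x = h y" using surj by blast
      have "r \<otimes> y \<in> E" if "r \<in> carrier R" for r
        using inE[of "r \<otimes> y"] x(3)[of "h r"] y that by simp
      then show "\<exists>x\<in>carrier R - P. \<forall>r\<in>carrier R. r \<otimes> x \<in> E"
        using x y P by blast
    qed
  next
    assume R: "R.bounded_mod P"
    show "S.bounded_mod {\<zero>\<^bsub>S\<^esub>}"
      unfolding S.bounded_mod_def
    proof (intro allI impI, elim conjE)
      fix E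
      assume E: "right_ideal E S"
        and ess: "\<forall>x\<in>carrier S - {\<zero>\<^bsub>S\<^esub>}. \<exists>r\<in>carrier S. x \<otimes>\<^bsub>S\<^esub> r \<in> E - {\<zero>\<^bsub>S\<^esub>}"
      note ED = S.right_idealD[OF E(1)]
      define D where "D = {x \<in> carrier R. h x \<in> E}"
      have "right_ideal D R"
        using ED by (auto simp: D_def R.right_ideal_iff)
      moreover have "P \<subseteq> D" using ED(2) by (auto simp: D_def P)
      moreover have "\<exists>r\<in>carrier R. x \<otimes> r \<in> D - P" if "x \<in> carrier R - P" for x
      proof -
        have "h x \<in> carrier S - {\<zero>\<^bsub>S\<^esub>}" using that by (auto simp: P)
        with ess obtain s where s: "s \<in> carrier S" "h x \<otimes>\<^bsub>S\<^esub> s \<in> E - {\<zero>\<^bsub>S\<^esub>}" by blast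
        then obtain r where "r \<in> carrier R" "s = h r" using surj by blast
        with s that show ?thesis by (intro bexI[of _ r]) (auto simp: D_def P)
      qed
      ultimately have "\<exists>x\<in>carrier R - P. \<forall>r\<in>carrier R. r \<otimes> x \<in> D"
        using R[unfolded R.bounded_mod_def, rule_format, of D] by simp
      then obtain x where x: "x \<in> carrier R" "x \<notin> P" "\<And>r. r \<in> carrier R \<Longrightarrow> r \<otimes> x \<in> D"
        by blast
      have "s \<otimes>\<^bsub>S\<^esub> h x \<in> E" if asm: "s \<in> carrier S" for s
      proof -
        obtain r where "r \<in> carrier R" "s = h r" using asm surj by blast
        with x show ?thesis by (auto simp: D_def)
      qed
      with x show "\<exists>x\<in>carrier S - {\<zero>\<^bsub>S\<^esub>}. \<forall>r\<in>carrier S. r \<otimes>\<^bsub>S\<^esub> x \<in> E"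
        using P by (intro bexI[of _ "h x"]) auto
    qed
  qed
  then show ?thesis by (simp add: S.right_bounded_iff)
qed

end

lemma (in ideal) surjective_ring_hom_rcos: "surjective_ring_hom R (R Quot I) ((+>) I)"
proof (intro surjective_ring_hom.intro surjective_ring_hom_axioms.intro rcos_ring_hom_ring)
  show "(+>) I ` carrier R = carrier (R Quot I)"
    unfolding FactRing_def A_RCOSETS_def' by auto
qed

lemma (in ideal) a_kernel_rcos: "a_kernel R (R Quot I) ((+>) I) = I"
proof -
  have "x \<in> I \<longleftrightarrow> I +> x = I" if "x \<in> carrier R" for x
    using that by (metis a_coset_join1 a_coset_join2 a_subgroup is_additive_subgroup a_rcos_const)
  then have "{x \<in> carrier R. I +> x = I} = I" using a_subset by blast
  then show ?thesis
    unfolding a_kernel_def' FactRing_def by simp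
qed

lemma (in ring) right_fully_bounded_iff:
  "right_fully_bounded R \<longleftrightarrow> (\<forall>P. two_sided_prime P R \<longrightarrow> bounded_mod P)"
proof -
  have "right_bounded (R Quot P) \<longleftrightarrow> bounded_mod P" if "two_sided_prime P R" for P
  proof -
    interpret ideal P R using that by (simp add: two_sided_prime_def)
    show ?thesis
      by (rule surjective_ring_hom.bounded_mod_iff[OF surjective_ring_hom_rcos]) (simp add: a_kernel_rcos)
  qed
  then show ?thesis by (auto simp: right_fully_bounded_def)
qed

section \<open>Left cancellable elements and descending chains in noetherian rings\<close>

context ring
begin

lemma two_sided_primeD:
  assumes "two_sided_prime P R"
  shows "ideal P R" "right_ideal P R" "\<one> \<notin> P"
    "\<And>x r. x \<in> P \<Longrightarrow> r \<in> carrier R \<Longrightarrow> r \<otimes> x \<in> P"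
    "\<And>a b. a \<in> carrier R - P \<Longrightarrow> b \<in> carrier R - P \<Longrightarrow> \<exists>c\<in>carrier R. a \<otimes> c \<otimes> b \<in> carrier R - P"
proof -
  note * = assms[unfolded two_sided_prime_iff]
  show "ideal P R" "\<one> \<notin> P" using * by blast+
  then show "right_ideal P R" "\<And>x r. x \<in> P \<Longrightarrow> r \<in> carrier R \<Longrightarrow> r \<otimes> x \<in> P"
    unfolding ideal_iff by blast+
  show "\<exists>c\<in>carrier R. a \<otimes> c \<otimes> b \<in> carrier R - P" if "a \<in> carrier R - P" "b \<in> carrier R - P" for a b
  proof -
    have "\<exists>c\<in>carrier R. a \<otimes> c \<otimes> b \<notin> P" using * that by blast
    then obtain c where "c \<in> carrier R" "a \<otimes> c \<otimes> b \<notin> P" by blast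
    then show ?thesis using that by (intro bexI[of _ c]) simp_all
  qed
qed

lemma add_diff_cancel:
  assumes "a \<in> carrier R" "b \<in> carrier R"
  shows "(a \<oplus> b) \<ominus> b = a" "(a \<oplus> b) \<ominus> a = b" "(a \<ominus> b) \<oplus> b = a"
proof -
  have *: "(x \<oplus> y) \<ominus> y = x" if "x \<in> carrier R" "y \<in> carrier R" for x y
    using that by (simp add: minus_eq a_assoc r_neg)
  show "(a \<oplus> b) \<ominus> b = a"
    using * assms by blast
  show "(a \<oplus> b) \<ominus> a = b"
    using *[of b a] assms by (simp add: a_comm)
  show "(a \<ominus> b) \<oplus> b = a"
    using assms by (simp add: minus_eq a_assoc l_neg)
qed

lemma right_ideal_Int:
  assumes "right_ideal I R" "right_ideal J R"
  shows "right_ideal (I \<inter> J) R"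
  using right_idealD[OF assms(1)] right_idealD[OF assms(2)]
  unfolding right_ideal_iff by (intro conjI ballI) auto

lemma right_ideal_ann:
  assumes "x \<in> carrier R"
  shows "right_ideal {y \<in> carrier R. x \<otimes> y = \<zero>} R"
proof -
  have "x \<otimes> (y \<otimes> r) = \<zero>" if "y \<in> carrier R" "r \<in> carrier R" "x \<otimes> y = \<zero>" for y r
    using that assms m_assoc[of x y r] by simp
  then show ?thesis
    using assms by (simp add: right_ideal_iff r_distr)
qed

lemma sum_principal_iff:
  "z \<in> set_add R I ((\<otimes>) x ` carrier R) \<longleftrightarrow> (\<exists>y\<in>I. \<exists>r\<in>carrier R. z = y \<oplus> x \<otimes> r)"
  by (auto simp: set_add_def')

text \<open>
  Utumi's argument: in a nil right ideal, a non-zero \<open>x\<close> with maximal right annihilator satisfies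
  \<open>x R x = 0\<close>.
\<close>

lemma prime_not_nil:
  assumes noeth: "right_noetherian R" and prime: "two_sided_prime {\<zero>} R"
    and I: "right_ideal I R" "I \<noteq> {\<zero>}"
  shows "\<exists>x\<in>I. \<forall>n::nat. x [^] n \<noteq> \<zero>"
proof (rule ccontr)
  assume "\<not> ?thesis"
  then have nil: "\<exists>n::nat. x [^] n = \<zero>" if "x \<in> I" for x
    using that by blast
  note I' = right_idealD[OF I(1)]
  define ann where "ann x = {y \<in> carrier R. x \<otimes> y = \<zero>}" for x
  obtain x0 where "x0 \<in> I - {\<zero>}"
    using I I'(2) by blast
  then have x0: "ann x0 \<in> ann ` (I - {\<zero>})" by blast
  have annI: "right_ideal U R" if "U \<in> ann ` (I - {\<zero>})" for U
    using that I'(1) right_ideal_ann unfolding ann_def by blast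
  obtain M where "M \<in> ann ` (I - {\<zero>})" and max: "\<And>Y. Y \<in> ann ` (I - {\<zero>}) \<Longrightarrow> M \<subseteq> Y \<Longrightarrow> Y = M"
    using noetherian_maximal[OF noeth annI x0] by blast
  then obtain x where x: "x \<in> I" "x \<noteq> \<zero>" "M = ann x"
    by blast
  then have xR: "x \<in> carrier R"
    using I'(1) by blast
  have "x \<otimes> r \<otimes> x = \<zero>" if r: "r \<in> carrier R" for r
  proof -
    define y where "y n = (x \<otimes> r) [^] n \<otimes> x" for n :: nat
    have xr: "x \<otimes> r \<in> carrier R" "x \<otimes> r \<in> I"
      using xR r I'(4) x(1) by auto
    obtain n :: nat where "(x \<otimes> r) [^] n = \<zero>"
      using nil[OF xr(2)] by blast
    then have "y n = \<zero>"
      using xR by (simp add: y_def)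
    moreover have "y 0 \<noteq> \<zero>"
      using x xR by (simp add: y_def)
    \<comment> \<open>Take the last non-zero \<open>y m\<close>. Its annihilator contains that of
      \<open>x\<close>, hence equals it by maximality; since \<open>y m\<close> times
      \<open>r \<otimes> x\<close> is \<open>y (Suc m)\<close>, which is zero,
      \<open>r \<otimes> x\<close> is annihilated by \<open>x\<close> itself.\<close>
    ultimately obtain m where m: "y m \<noteq> \<zero>" "y (Suc m) = \<zero>"
      using ex_least_nat_less[of "\<lambda>k. y k = \<zero>" n] by blast
    have yI: "y k \<in> I" for k
    proof (cases k)
      case 0
      then show ?thesis using x(1) xR by (simp add: y_def)
    next
      case (Suc i)
      have "(x \<otimes> r) [^] Suc i \<in> I"
      proof (induction i)
        case 0
        then show ?case using xr by simp
      next
        case (Suc i)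
        then show ?case using I'(4) xr(1) by (metis nat_pow_Suc)
      qed
      then show ?thesis using I'(4) xR Suc by (simp add: y_def)
    qed
    have "ann x \<subseteq> ann (y m)"
      using xR xr by (auto simp: ann_def y_def m_assoc)
    then have "ann (y m) = ann x"
      using max[of "ann (y m)"] yI[of m] m(1) x(3) by blast
    moreover have "y m \<otimes> (r \<otimes> x) = y (Suc m)"
      using xR r xr(1) by (simp add: y_def m_assoc)
    then have "r \<otimes> x \<in> ann (y m)"
      using m(2) xR r by (simp add: ann_def)
    ultimately have "r \<otimes> x \<in> ann x" by simp
    then show ?thesis using xR r by (simp add: ann_def m_assoc)
  qed
  then show False
    using two_sided_primeD(5)[OF prime, of x x] x xR by auto
qed

text \<open>The right annihilators of the powers of a non-nilpotent element of \<open>I\<close>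
  ascend, so some power has the same annihilator as its square. Non-nilpotency keeps that power
  non-zero.\<close>

lemma ex_ann_eq_ann_square:
  assumes noeth: "right_noetherian R" and prime: "two_sided_prime {\<zero>} R"
    and I: "right_ideal I R" "I \<noteq> {\<zero>}"
  shows "\<exists>a\<in>I. a \<noteq> \<zero> \<and> (\<forall>y\<in>carrier R. a \<otimes> (a \<otimes> y) = \<zero> \<longrightarrow> a \<otimes> y = \<zero>)"
proof -
  note I' = right_idealD[OF I(1)]
  define ann where "ann x = {y \<in> carrier R. x \<otimes> y = \<zero>}" for x
  obtain x where x: "x \<in> I" "\<And>n::nat. x [^] n \<noteq> \<zero>"
    using prime_not_nil[OF assms] by blast
  have xR: "x \<in> carrier R"
    using x(1) I'(1) by blast
  have xI: "x [^] Suc n \<in> I" for n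
  proof (induction n)
    case 0
    then show ?case using x(1) xR by simp
  next
    case (Suc n)
    then show ?case using I'(4) xR by (metis nat_pow_Suc)
  qed
  \<comment> \<open>Exponents start at 1, since the zeroth power is \<open>\<one>\<close> and need
    not lie in \<open>I\<close>.\<close>
  let ?F = "range (\<lambda>n. ann (x [^] Suc n))"
  obtain M where "M \<in> ?F" and max: "\<And>Y. Y \<in> ?F \<Longrightarrow> M \<subseteq> Y \<Longrightarrow> Y = M"
  proof (rule noetherian_maximal[OF noeth, of ?F "ann (x [^] Suc 0)"])
    show "right_ideal U R" if "U \<in> ?F" for U
    proof -
      have "right_ideal (ann (x [^] Suc n)) R" for n
        unfolding ann_def by (rule right_ideal_ann) (use xR in simp)
      with that show ?thesis by blast
    qed
  qed blast+
  then obtain n where n: "M = ann (x [^] Suc n)" by blast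
  define a where "a = x [^] Suc n"
  have aR: "a \<in> carrier R"
    using xR by (simp add: a_def)
  have "a \<otimes> a = x [^] (Suc n + Suc n)"
    unfolding a_def using xR by (rule nat_pow_mult)
  then have aa: "a \<otimes> a = x [^] Suc (Suc (n + n))"
    by simp
  have M: "M = ann a"
    by (simp only: n a_def)
  have "M \<subseteq> ann (a \<otimes> a)"
    using aR by (auto simp: M ann_def m_assoc)
  moreover have "ann (a \<otimes> a) \<in> ?F"
    unfolding aa by (rule rangeI)
  ultimately have "ann (a \<otimes> a) = ann a"
    using max M by blast
  moreover have "y \<in> ann (a \<otimes> a) \<longleftrightarrow> a \<otimes> (a \<otimes> y) = \<zero>" "y \<in> ann a \<longleftrightarrow> a \<otimes> y = \<zero>" if "y \<in> carrier R" for y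
    using that aR by (auto simp: ann_def m_assoc)
  ultimately have "\<forall>y\<in>carrier R. a \<otimes> (a \<otimes> y) = \<zero> \<longrightarrow> a \<otimes> y = \<zero>"
    by blast
  moreover have "a \<in> I" "a \<noteq> \<zero>"
    using xI[of n] x(2)[of "Suc n"] by (simp_all add: a_def)
  ultimately show ?thesis by blast
qed

text \<open>
  Half of Goldie's theorem. Among the right ideals \<open>D\<close> that meet \<open>r(c) = r(c\<^sup>2)\<close> trivially for
  some \<open>c \<in> E\<close>, a maximal one has \<open>r(c) = 0\<close>: otherwise pick \<open>a \<in> E \<inter> r(c)\<close> with
  \<open>r(a) = r(a\<^sup>2)\<close> and pass to \<open>c + a\<close> and \<open>D + a R\<close>.
\<close>

lemma essential_contains_left_cancellable:
  assumes noeth: "right_noetherian R" and prime: "two_sided_prime {\<zero>} R"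
    and E: "right_ideal E R"
    and ess: "\<And>x. x \<in> carrier R - {\<zero>} \<Longrightarrow> \<exists>r\<in>carrier R. x \<otimes> r \<in> E - {\<zero>}"
  shows "\<exists>c\<in>E. \<forall>x\<in>carrier R. c \<otimes> x = \<zero> \<longrightarrow> x = \<zero>"
proof -
  note E' = right_idealD[OF E]
  define good where "good c D \<longleftrightarrow> c \<in> E \<and> right_ideal D R \<and>
      (\<forall>y\<in>carrier R. c \<otimes> (c \<otimes> y) = \<zero> \<longrightarrow> c \<otimes> y = \<zero>) \<and>
      (\<forall>y\<in>D. c \<otimes> y = \<zero> \<longrightarrow> y = \<zero>)" for c D
  have "good \<zero> {\<zero>}"
    using E'(2) by (auto simp: good_def right_ideal_iff)
  then have ne: "{\<zero>} \<in> {D. \<exists>c. good c D}" by blast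
  have "right_ideal U R" if "U \<in> {D. \<exists>c. good c D}" for U
    using that unfolding good_def by blast
  then obtain D where "D \<in> {D. \<exists>c. good c D}" and max: "\<And>Y. Y \<in> {D. \<exists>c. good c D} \<Longrightarrow> D \<subseteq> Y \<Longrightarrow> Y = D"
    using noetherian_maximal[OF noeth _ ne] by blast
  then obtain c where c: "good c D" by blast
  then have cE: "c \<in> E" and cR: "c \<in> carrier R" and D: "right_ideal D R"
    and cc: "\<And>y. y \<in> carrier R \<Longrightarrow> c \<otimes> (c \<otimes> y) = \<zero> \<Longrightarrow> c \<otimes> y = \<zero>"
    and Dc: "\<And>y. y \<in> D \<Longrightarrow> c \<otimes> y = \<zero> \<Longrightarrow> y = \<zero>"
    using E'(1) by (auto simp: good_def)
  note D' = right_idealD[OF D]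
  have "x = \<zero>" if x: "x \<in> carrier R" "c \<otimes> x = \<zero>" for x
  proof (rule ccontr)
    assume "x \<noteq> \<zero>"
    with x ess obtain r where r: "r \<in> carrier R" "x \<otimes> r \<in> E - {\<zero>}" by blast
    define J where "J = E \<inter> {y \<in> carrier R. c \<otimes> y = \<zero>}"
    have "right_ideal J R"
      unfolding J_def using E right_ideal_ann[OF cR] by (rule right_ideal_Int)
    moreover have "c \<otimes> (x \<otimes> r) = \<zero>"
      using x r cR by (simp flip: m_assoc)
    then have "x \<otimes> r \<in> J"
      using r x by (auto simp: J_def)
    then have "J \<noteq> {\<zero>}" using r by blast
    ultimately obtain a where a: "a \<in> J" "a \<noteq> \<zero>"
      and aa: "\<And>y. y \<in> carrier R \<Longrightarrow> a \<otimes> (a \<otimes> y) = \<zero> \<Longrightarrow> a \<otimes> y = \<zero>"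
      using ex_ann_eq_ann_square[OF noeth prime] by blast
    have aR: "a \<in> carrier R" and aE: "a \<in> E" and ca: "c \<otimes> a = \<zero>"
      using a(1) by (auto simp: J_def)
    have caz: "c \<otimes> (a \<otimes> z) = \<zero>" if "z \<in> carrier R" for z
      using that cR aR ca by (simp flip: m_assoc)
    \<comment> \<open>Because \<open>c \<otimes> a = \<zero>\<close>, multiplying by
      \<open>c\<close> leaves c^2 y = 0, hence c y = 0 and then a y = 0. So the annihilator of c + a
      is the intersection of those of c and a.\<close>
    have key: "c \<otimes> y = \<zero>" "a \<otimes> y = \<zero>" if y: "y \<in> carrier R" "(c \<oplus> a) \<otimes> y = \<zero>" for y
    proof -
      have 0: "c \<otimes> y \<oplus> a \<otimes> y = \<zero>"
        using y cR aR by (simp add: l_distr)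
      have "c \<otimes> (c \<otimes> y) \<oplus> c \<otimes> (a \<otimes> y) = c \<otimes> (c \<otimes> y \<oplus> a \<otimes> y)"
        using y(1) cR aR by (simp add: r_distr)
      then have "c \<otimes> (c \<otimes> y) = \<zero>"
        using y(1) cR aR 0 by (simp add: caz)
      then show "c \<otimes> y = \<zero>" using cc y(1) by blast
      then show "a \<otimes> y = \<zero>" using 0 y(1) aR by simp
    qed
    let ?D = "set_add R D ((\<otimes>) a ` carrier R)"
    have DD: "right_ideal ?D R"
      using D right_ideal_principal[OF aR] by (rule right_ideal_sum)
    have "good (c \<oplus> a) ?D"
      unfolding good_def
    proof (intro conjI ballI impI DD)
      show "c \<oplus> a \<in> E" using cE aE E'(3) by blast
      show "(c \<oplus> a) \<otimes> y = \<zero>" if y: "y \<in> carrier R" "(c \<oplus> a) \<otimes> ((c \<oplus> a) \<otimes> y) = \<zero>" for y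
      proof -
        have "c \<otimes> ((c \<oplus> a) \<otimes> y) = \<zero>" "a \<otimes> ((c \<oplus> a) \<otimes> y) = \<zero>"
          using key[of "(c \<oplus> a) \<otimes> y"] y cR aR by auto
        then have 1: "c \<otimes> (c \<otimes> y) \<oplus> c \<otimes> (a \<otimes> y) = \<zero>" "a \<otimes> (c \<otimes> y) \<oplus> a \<otimes> (a \<otimes> y) = \<zero>"
          using y cR aR by (simp_all add: r_distr l_distr)
        then have "c \<otimes> y = \<zero>"
          using cc y cR aR by (simp add: caz)
        with 1(2) aa y cR aR show ?thesis
          by (simp add: l_distr)
      qed
      show "y = \<zero>" if y: "y \<in> ?D" "(c \<oplus> a) \<otimes> y = \<zero>" for y
      proof -
        obtain d s where ds: "d \<in> D" "s \<in> carrier R" "y = d \<oplus> a \<otimes> s"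
          using y(1) by (auto simp: sum_principal_iff)
        have dR: "d \<in> carrier R" using ds D'(1) by blast
        have yR: "y \<in> carrier R" using ds dR aR by simp
        \<comment> \<open>The second summand of the first equation is zero, so \<open>d\<close> lies
          in \<open>D\<close> and is annihilated by \<open>c\<close>, which forces d = 0. The second
          equation then reads a^2 s = 0, whence a s = 0.\<close>
        have "c \<otimes> d \<oplus> c \<otimes> (a \<otimes> s) = \<zero>" "a \<otimes> d \<oplus> a \<otimes> (a \<otimes> s) = \<zero>"
          using key[OF yR y(2)] ds dR cR aR by (simp_all add: r_distr)
        then have "d = \<zero>"
          using Dc ds dR cR by (simp add: caz)
        with \<open>a \<otimes> d \<oplus> a \<otimes> (a \<otimes> s) = \<zero>\<close> aa ds aR show "y = \<zero>"
          by simp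
      qed
    qed
    moreover have "D \<subseteq> ?D"
      using sum_upper D right_ideal_principal[OF aR] by blast
    ultimately have "?D = D" using max by blast
    moreover have "a \<in> ?D"
      unfolding sum_principal_iff using D'(2) aR by (intro bexI[of _ \<zero>] bexI[of _ \<one>]) simp_all
    ultimately have "a \<in> D" by simp
    with Dc ca a(2) show False by blast
  qed
  with cE show ?thesis by blast
qed

text \<open>Suppose every right ideal \<open>H\<close> strictly above \<open>Q\<close> inside
  \<open>K\<close> met \<open>L\<close> outside \<open>Q\<close>. Then for each r in
  \<open>K\<close> the right ideal of all x with r x in \<open>L\<close> would be essential modulo
  \<open>Q\<close>, and boundedness would give b outside \<open>Q\<close> with r R b inside
  \<open>L\<close>. The noetherian condition and primeness combine these b into one that serves all
  of \<open>K\<close>, against \<open>nonsmall\<close>.\<close>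

lemma nonsmall_complement:
  assumes noeth: "right_noetherian R" and prime: "two_sided_prime Q R" and bounded: "bounded_mod Q"
    and K: "right_ideal K R" "right_ideal L R" "Q \<subseteq> L" "L \<subseteq> K"
    and nonsmall: "\<not> (\<exists>b\<in>carrier R - Q. \<forall>x\<in>K. x \<otimes> b \<in> L)"
  shows "\<exists>H. right_ideal H R \<and> Q \<subseteq> H \<and> H \<subseteq> K \<and> H \<inter> L = Q \<and> H \<noteq> Q"
proof (rule ccontr)
  assume neg: "\<not> ?thesis"
  note Q = two_sided_primeD[OF prime]
  note Q' = right_idealD[OF Q(2)]
  note K' = right_idealD[OF K(1)] and L' = right_idealD[OF K(2)]
  have ann: "\<exists>b\<in>carrier R - Q. \<forall>s\<in>carrier R. r \<otimes> (s \<otimes> b) \<in> L" if r: "r \<in> K" for r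
  proof -
    have rR: "r \<in> carrier R" using r K'(1) by blast
    define E where "E = {x \<in> carrier R. r \<otimes> x \<in> L}"
    have "right_ideal E R"
      using rR L' by (auto simp: E_def right_ideal_iff r_distr simp flip: m_assoc)
    moreover have "Q \<subseteq> E"
      using Q(4) Q'(1) rR K(3) by (auto simp: E_def)
    moreover have "\<exists>s\<in>carrier R. x \<otimes> s \<in> E - Q" if x: "x \<in> carrier R - Q" for x
    proof (cases "r \<otimes> x \<in> Q")
      case True
      then show ?thesis
        using x K(3) by (intro bexI[of _ \<one>]) (auto simp: E_def)
    next
      case False
      let ?y = "r \<otimes> x"
      let ?H = "set_add R Q ((\<otimes>) ?y ` carrier R)"
      have y: "?y \<in> carrier R" "?y \<in> K"
        using x r rR K'(4) by auto
      have H: "right_ideal ?H R" "Q \<subseteq> ?H"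
        by (rule right_ideal_sum sum_upper Q(2) right_ideal_principal y(1))+
      have "?H \<subseteq> K"
      proof
        fix z assume "z \<in> ?H"
        then obtain q s where "q \<in> Q" "s \<in> carrier R" "z = q \<oplus> ?y \<otimes> s"
          unfolding sum_principal_iff by blast
        then show "z \<in> K" using K'(3)[of q "?y \<otimes> s"] K'(4)[OF y(2)] K(3,4) by auto
      qed
      moreover have "?y \<in> ?H"
        unfolding sum_principal_iff using Q'(2) y(1) by (intro bexI[of _ \<zero>] bexI[of _ \<one>]) simp_all
      then have "?H \<noteq> Q" using False by blast
      ultimately have "?H \<inter> L \<noteq> Q"
        using neg H by blast
      \<comment> \<open>Removing the \<open>Q\<close>-part of \<open>z\<close> leaves a multiple of
        r x in \<open>L\<close> outside \<open>Q\<close>; the corresponding multiple of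
        \<open>x\<close> is outside \<open>Q\<close> too, because \<open>Q\<close> is closed under
        left multiplication by \<open>r\<close>.\<close>
      then obtain z where z: "z \<in> ?H" "z \<in> L" "z \<notin> Q"
        using H(2) K(3) by blast
      then obtain q s where qs: "q \<in> Q" "s \<in> carrier R" "z = q \<oplus> ?y \<otimes> s"
        unfolding sum_principal_iff by blast
      have qR: "q \<in> carrier R" using qs Q'(1) by blast
      have ys: "?y \<otimes> s = z \<ominus> q"
        using qs(2,3) qR y(1) by (simp add: add_diff_cancel)
      have "?y \<otimes> s \<in> L"
        unfolding ys using z qs K(3) L'(6) by blast
      moreover have "?y \<otimes> s \<notin> Q"
        using qs z Q'(3) by blast
      ultimately have "x \<otimes> s \<in> E - Q"
        using Q(4)[of "x \<otimes> s" r] rR x qs by (auto simp: E_def m_assoc)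
      with qs show ?thesis by blast
    qed
    ultimately have "\<exists>x\<in>carrier R - Q. \<forall>r\<in>carrier R. r \<otimes> x \<in> E"
      using bounded[unfolded bounded_mod_def, rule_format, of E] by simp
    then show ?thesis by (auto simp: E_def)
  qed
  \<comment> \<open>The parts of \<open>K\<close> that one b outside \<open>Q\<close> carries into
    \<open>L\<close>. A maximal such part can be enlarged by any further r: with b for
    \<open>M\<close>, b' for r, and d with b d b' outside \<open>Q\<close>, the product b d b'
    serves \<open>M\<close> + r R.\<close>
  define F where "F = {M. right_ideal M R \<and> M \<subseteq> K \<and> (\<exists>b\<in>carrier R - Q. \<forall>x\<in>M. x \<otimes> b \<in> L)}"
  have "L \<in> F"
    using K Q(3) L'(1) by (auto simp: F_def intro!: bexI[of _ \<one>] simp: subset_iff)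
  moreover have "right_ideal U R" if "U \<in> F" for U
    using that by (simp add: F_def)
  ultimately obtain M where M: "M \<in> F" and max: "\<And>Y. Y \<in> F \<Longrightarrow> M \<subseteq> Y \<Longrightarrow> Y = M"
    using noetherian_maximal[OF noeth] by blast
  have "M \<noteq> K" using M nonsmall by (auto simp: F_def)
  then obtain r where r: "r \<in> K" "r \<notin> M" using M by (auto simp: F_def)
  have rR: "r \<in> carrier R" using r K'(1) by blast
  obtain b where b: "b \<in> carrier R - Q" "\<And>x. x \<in> M \<Longrightarrow> x \<otimes> b \<in> L" using M by (auto simp: F_def)
  obtain b' where b': "b' \<in> carrier R - Q" "\<And>s. s \<in> carrier R \<Longrightarrow> r \<otimes> (s \<otimes> b') \<in> L"
    using ann[OF r(1)] by blast
  obtain d where d: "d \<in> carrier R" "b \<otimes> d \<otimes> b' \<in> carrier R - Q"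
    using Q(5) b(1) b'(1) by blast
  let ?M = "set_add R M ((\<otimes>) r ` carrier R)"
  have MR: "right_ideal M R" "M \<subseteq> K" using M by (auto simp: F_def)
  note M' = right_idealD[OF MR(1)]
  have "x \<otimes> (b \<otimes> d \<otimes> b') \<in> L" if x: "x \<in> ?M" for x
  proof -
    obtain m s where ms: "m \<in> M" "s \<in> carrier R" "x = m \<oplus> r \<otimes> s"
      using x unfolding sum_principal_iff by blast
    have "m \<in> carrier R" using ms M'(1) by blast
    then have "x \<otimes> (b \<otimes> d \<otimes> b') = (m \<otimes> b) \<otimes> (d \<otimes> b') \<oplus> r \<otimes> ((s \<otimes> b \<otimes> d) \<otimes> b')"
      using ms b(1) b'(1) d(1) rR by (simp add: l_distr m_assoc)
    moreover have "(m \<otimes> b) \<otimes> (d \<otimes> b') \<in> L" "r \<otimes> ((s \<otimes> b \<otimes> d) \<otimes> b') \<in> L"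
      using ms b b' d(1) L'(4) by auto
    ultimately show ?thesis using L'(3) by simp
  qed
  moreover have "right_ideal ?M R" "M \<subseteq> ?M"
    by (rule right_ideal_sum sum_upper MR(1) right_ideal_principal rR)+
  moreover have "?M \<subseteq> K"
  proof
    fix z assume "z \<in> ?M"
    then obtain m s where "m \<in> M" "s \<in> carrier R" "z = m \<oplus> r \<otimes> s"
      unfolding sum_principal_iff by blast
    then show "z \<in> K" using K'(3)[of m "r \<otimes> s"] K'(4)[OF r(1)] MR(2) by auto
  qed
  ultimately have "?M = M"
    using max[of ?M] d by (auto simp: F_def)
  moreover have "r \<in> ?M"
    unfolding sum_principal_iff using M'(2) rR by (intro bexI[of _ \<zero>] bexI[of _ \<one>]) simp_all
  ultimately show False using r by simp
qed

text \<open>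
  Each factor not killed by an element outside \<open>Q\<close> splits off a non-zero right ideal of \<open>R/Q\<close>;
  the sum \<open>C\<close> of the right ideals split off so far is direct, hence grows only finitely often.
\<close>

lemma descending_eventually_small:
  assumes noeth: "right_noetherian R" and prime: "two_sided_prime Q R" and bounded: "bounded_mod Q"
    and K: "\<And>n::nat. right_ideal (K n) R" "\<And>n. Q \<subseteq> K n" "\<And>n. K (Suc n) \<subseteq> K n"
  shows "\<exists>m. \<forall>n\<ge>m. \<exists>b\<in>carrier R - Q. \<forall>x\<in>K n. x \<otimes> b \<in> K (Suc n)"
proof -
  note Q = two_sided_primeD[OF prime]
  have "\<exists>H. right_ideal H R \<and> Q \<subseteq> H \<and> H \<subseteq> K n \<and> H \<inter> K (Suc n) = Q \<and>
      (H = Q \<longrightarrow> (\<exists>b\<in>carrier R - Q. \<forall>x\<in>K n. x \<otimes> b \<in> K (Suc n)))" for n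
  proof (cases "\<exists>b\<in>carrier R - Q. \<forall>x\<in>K n. x \<otimes> b \<in> K (Suc n)")
    case True
    have "Q \<inter> K (Suc n) = Q" using K(2) by blast
    with True show ?thesis using Q(2) K(2) by (intro exI[of _ Q]) simp
  next
    case False
    then show ?thesis
      using nonsmall_complement[OF noeth prime bounded K(1) K(1) K(2) K(3) False] by blast
  qed
  then obtain H where H: "\<And>n. right_ideal (H n) R" "\<And>n. Q \<subseteq> H n" "\<And>n. H n \<subseteq> K n"
      "\<And>n. H n \<inter> K (Suc n) = Q"
      "\<And>n. H n = Q \<Longrightarrow> \<exists>b\<in>carrier R - Q. \<forall>x\<in>K n. x \<otimes> b \<in> K (Suc n)"
    by metis
  \<comment> \<open>\<open>C n\<close> is \<open>Q\<close> plus the sum of the \<open>H i\<close>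
    with i < n.\<close>
  define C where "C = rec_nat Q (\<lambda>n C. set_add R C (H n))"
  have C0: "C 0 = Q" and CS: "C (Suc n) = set_add R (C n) (H n)" for n
    by (simp_all add: C_def)
  have C: "right_ideal (C n) R" for n
    by (induction n) (use Q(2) H(1) right_ideal_sum in \<open>auto simp: C0 CS\<close>)
  have up: "C n \<subseteq> C (Suc n)" "H n \<subseteq> C (Suc n)" for n
    using sum_upper[OF C H(1)] by (auto simp: CS)
  \<comment> \<open>This is directness: \<open>H n\<close> lies in \<open>K n\<close> but meets
    \<open>K (Suc n)\<close> only in \<open>Q\<close>, so adding it to \<open>C n\<close> creates no
    overlap with the rest of the chain. Once \<open>C\<close> is stationary, \<open>H n\<close> lies
    in \<open>C n \<inter> K n\<close> and is therefore \<open>Q\<close>.\<close>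
  have CK: "C n \<inter> K n = Q" for n
  proof (induction n)
    case 0
    then show ?case using K(2) by (auto simp: C0)
  next
    case (Suc n)
    have "x \<in> Q" if x: "x \<in> C (Suc n)" "x \<in> K (Suc n)" for x
    proof -
      obtain c h where ch: "c \<in> C n" "h \<in> H n" "x = c \<oplus> h"
        using x(1) by (auto simp: CS set_add_def')
      have R: "c \<in> carrier R" "h \<in> carrier R"
        using ch right_idealD(1)[OF C] right_idealD(1)[OF H(1)] by blast+
      then have c: "c = x \<ominus> h" and h: "h = x \<ominus> c"
        using ch(3) by (simp_all add: add_diff_cancel)
      have "x \<in> K n" "h \<in> K n" using x ch K(3) H(3) by blast+
      then have "c \<in> K n" unfolding c by (rule right_idealD(6)[OF K(1)])
      then have cQ: "c \<in> Q" using ch Suc by blast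
      then have "c \<in> K (Suc n)" using K(2) by blast
      then have "h \<in> K (Suc n)" unfolding h using x(2) right_idealD(6)[OF K(1)] by blast
      then have "h \<in> Q" using ch H(4) by blast
      with cQ show ?thesis unfolding ch(3) using right_idealD(3)[OF Q(2)] by blast
    qed
    moreover have "Q \<subseteq> C (Suc n)"
      using Suc up(1) by blast
    ultimately show ?case using K(2) by blast
  qed
  obtain N where N: "\<And>n. n \<ge> N \<Longrightarrow> C n = C N"
    using noeth C up(1) unfolding right_noetherian_def by meson
  have "\<exists>b\<in>carrier R - Q. \<forall>x\<in>K n. x \<otimes> b \<in> K (Suc n)" if "n \<ge> N" for n
  proof (rule H(5))
    have "C (Suc n) = C n" using N[of n] N[of "Suc n"] that by simp
    then have "H n \<subseteq> C n \<inter> K n" using up(2)[of n] H(3) by blast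
    then show "H n = Q" using CK H(2) by blast
  qed
  then show ?thesis by blast
qed

end

section \<open>Finite ring extensions\<close>

locale ring_map = B: ring B + ring R for B and R (structure) +
  fixes \<phi>
  assumes hom: "\<phi> \<in> ring_hom B R"
begin

lemma phi [simp]:
  "b \<in> carrier B \<Longrightarrow> \<phi> b \<in> carrier R"
  "b \<in> carrier B \<Longrightarrow> c \<in> carrier B \<Longrightarrow> \<phi> (b \<otimes>\<^bsub>B\<^esub> c) = \<phi> b \<otimes> \<phi> c"
  "b \<in> carrier B \<Longrightarrow> c \<in> carrier B \<Longrightarrow> \<phi> (b \<oplus>\<^bsub>B\<^esub> c) = \<phi> b \<oplus> \<phi> c"
  "\<phi> \<one>\<^bsub>B\<^esub> = \<one>"
  using hom by (auto simp: ring_hom_def)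

lemma phi_zero [simp]: "\<phi> \<zero>\<^bsub>B\<^esub> = \<zero>"
  using ring_hom_zero[OF hom B.ring_axioms ring_axioms] .

text \<open>\<open>R\<close> as a right \<open>B\<close>-module along \<open>\<phi>\<close>.\<close>

definition submod :: "'c set \<Rightarrow> bool" where
  "submod W \<longleftrightarrow> W \<subseteq> carrier R \<and> \<zero> \<in> W \<and> (\<forall>x\<in>W. \<forall>y\<in>W. x \<oplus> y \<in> W) \<and>
     (\<forall>x\<in>W. \<forall>b\<in>carrier B. x \<otimes> \<phi> b \<in> W)"

lemma submodD:
  assumes "submod W"
  shows "\<And>x. x \<in> W \<Longrightarrow> x \<in> carrier R" "\<zero> \<in> W" "\<And>x y. x \<in> W \<Longrightarrow> y \<in> W \<Longrightarrow> x \<oplus> y \<in> W"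
    "\<And>x b. x \<in> W \<Longrightarrow> b \<in> carrier B \<Longrightarrow> x \<otimes> \<phi> b \<in> W"
    "\<And>x y. x \<in> W \<Longrightarrow> y \<in> W \<Longrightarrow> x \<ominus> y \<in> W"
proof -
  show *: "\<And>x. x \<in> W \<Longrightarrow> x \<in> carrier R" "\<zero> \<in> W" "\<And>x y. x \<in> W \<Longrightarrow> y \<in> W \<Longrightarrow> x \<oplus> y \<in> W"
    "\<And>x b. x \<in> W \<Longrightarrow> b \<in> carrier B \<Longrightarrow> x \<otimes> \<phi> b \<in> W"
    using assms unfolding submod_def by blast+
  fix x y assume xy: "x \<in> W" "y \<in> W"
  have "\<phi> (\<ominus>\<^bsub>B\<^esub> \<one>\<^bsub>B\<^esub>) \<oplus> \<one> = \<phi> (\<ominus>\<^bsub>B\<^esub> \<one>\<^bsub>B\<^esub> \<oplus>\<^bsub>B\<^esub> \<one>\<^bsub>B\<^esub>)"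
    by (simp del: B.l_neg)
  then have "\<phi> (\<ominus>\<^bsub>B\<^esub> \<one>\<^bsub>B\<^esub>) = \<ominus> \<one>"
    by (simp add: B.l_neg minus_equality)
  then have "\<ominus> y = y \<otimes> \<phi> (\<ominus>\<^bsub>B\<^esub> \<one>\<^bsub>B\<^esub>)"
    using *(1)[OF xy(2)] by (simp add: r_minus)
  then show "x \<ominus> y \<in> W"
    using * xy by (simp add: minus_eq)
qed

lemma submod_zero: "submod {\<zero>}"
  by (simp add: submod_def)

lemma right_ideal_submod: "right_ideal I R \<Longrightarrow> submod I"
  unfolding submod_def right_ideal_iff by simp

section \<open>Adjoining one generator, and chain conditions\<close>

definition extend :: "'c set \<Rightarrow> 'c \<Rightarrow> 'c set" where
  "extend V u = {v \<oplus> u \<otimes> \<phi> b | v b. v \<in> V \<and> b \<in> carrier B}"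

lemma
  assumes V: "submod V" and u: "u \<in> carrier R"
  shows submod_extend: "submod (extend V u)"
    and subset_extend: "V \<subseteq> extend V u"
    and mem_extend: "u \<in> extend V u"
proof -
  note V' = submodD[OF V]
  have mem: "z \<in> extend V u \<longleftrightarrow> (\<exists>v\<in>V. \<exists>b\<in>carrier B. z = v \<oplus> u \<otimes> \<phi> b)" for z
    unfolding extend_def by blast
  show "V \<subseteq> extend V u"
  proof
    fix v assume "v \<in> V"
    then show "v \<in> extend V u"
      unfolding mem using V'(1) u by (intro bexI[of _ v] bexI[of _ "\<zero>\<^bsub>B\<^esub>"]) simp_all
  qed
  show "u \<in> extend V u"
    unfolding mem using V'(2) u by (intro bexI[of _ \<zero>] bexI[of _ "\<one>\<^bsub>B\<^esub>"]) simp_all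
  show "submod (extend V u)"
    unfolding submod_def
  proof (intro conjI ballI)
    show "extend V u \<subseteq> carrier R"
      using V'(1) u by (auto simp: mem)
    show "\<zero> \<in> extend V u"
      using V'(2) \<open>V \<subseteq> extend V u\<close> by blast
    show "x \<oplus> y \<in> extend V u" if xy: "x \<in> extend V u" "y \<in> extend V u" for x y
    proof -
      obtain v b w c where *: "v \<in> V" "b \<in> carrier B" "x = v \<oplus> u \<otimes> \<phi> b"
        "w \<in> V" "c \<in> carrier B" "y = w \<oplus> u \<otimes> \<phi> c"
        using xy unfolding mem by blast
      then have "x \<oplus> y = (v \<oplus> w) \<oplus> u \<otimes> \<phi> (b \<oplus>\<^bsub>B\<^esub> c)"
        using V'(1) u by (simp add: r_distr a_ac)
      then show ?thesis
        unfolding mem using * V'(3) B.a_closed by blast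
    qed
    show "x \<otimes> \<phi> c \<in> extend V u" if xc: "x \<in> extend V u" "c \<in> carrier B" for x c
    proof -
      obtain v b where *: "v \<in> V" "b \<in> carrier B" "x = v \<oplus> u \<otimes> \<phi> b"
        using xc unfolding mem by blast
      then have "x \<otimes> \<phi> c = v \<otimes> \<phi> c \<oplus> u \<otimes> \<phi> (b \<otimes>\<^bsub>B\<^esub> c)"
        using V'(1) u xc by (simp add: l_distr m_assoc)
      then show ?thesis
        unfolding mem using * V'(4) xc B.m_closed by blast
    qed
  qed
qed

text \<open>The coefficients at \<open>u\<close> of the elements of \<open>W\<close> lying in
  \<open>extend V u\<close>, in the role of the leading coefficients in Hilbert's basis
  theorem.\<close>

definition transporter :: "'c \<Rightarrow> 'c set \<Rightarrow> 'c set \<Rightarrow> 'a set" where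
  "transporter u W V = {b \<in> carrier B. \<exists>w\<in>W. \<exists>v\<in>V. u \<otimes> \<phi> b = w \<oplus> v}"

lemma right_ideal_transporter:
  assumes W: "submod W" and V: "submod V" and u: "u \<in> carrier R"
  shows "right_ideal (transporter u W V) B"
proof -
  note W' = submodD[OF W] and V' = submodD[OF V]
  have mem: "b \<in> transporter u W V \<longleftrightarrow> b \<in> carrier B \<and> (\<exists>w\<in>W. \<exists>v\<in>V. u \<otimes> \<phi> b = w \<oplus> v)" for b
    by (simp add: transporter_def)
  show ?thesis
    unfolding B.right_ideal_iff
  proof (intro conjI ballI)
    show "transporter u W V \<subseteq> carrier B"
      by (auto simp: mem)
    show "\<zero>\<^bsub>B\<^esub> \<in> transporter u W V"
      unfolding mem using W'(2) V'(2) u by (intro conjI bexI[of _ \<zero>]) simp_all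
    show "b \<oplus>\<^bsub>B\<^esub> c \<in> transporter u W V" if bc: "b \<in> transporter u W V" "c \<in> transporter u W V" for b c
    proof -
      obtain w v w' v' where *: "w \<in> W" "v \<in> V" "u \<otimes> \<phi> b = w \<oplus> v" "w' \<in> W" "v' \<in> V" "u \<otimes> \<phi> c = w' \<oplus> v'"
        using bc unfolding mem by blast
      have R: "b \<in> carrier B" "c \<in> carrier B" using bc by (auto simp: mem)
      have "u \<otimes> \<phi> (b \<oplus>\<^bsub>B\<^esub> c) = u \<otimes> \<phi> b \<oplus> u \<otimes> \<phi> c"
        using R u by (simp add: r_distr)
      also have "\<dots> = (w \<oplus> w') \<oplus> (v \<oplus> v')"
        unfolding * using *(1,2,4,5) W'(1) V'(1) by (simp add: a_ac)
      finally show ?thesis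
        unfolding mem using R * W'(3) V'(3) B.a_closed by blast
    qed
    show "b \<otimes>\<^bsub>B\<^esub> c \<in> transporter u W V" if bc: "b \<in> transporter u W V" "c \<in> carrier B" for b c
    proof -
      obtain w v where *: "w \<in> W" "v \<in> V" "u \<otimes> \<phi> b = w \<oplus> v"
        using bc unfolding mem by blast
      have R: "b \<in> carrier B" using bc by (auto simp: mem)
      have "u \<otimes> \<phi> (b \<otimes>\<^bsub>B\<^esub> c) = (u \<otimes> \<phi> b) \<otimes> \<phi> c"
        using R u bc by (simp add: m_assoc)
      also have "\<dots> = w \<otimes> \<phi> c \<oplus> v \<otimes> \<phi> c"
        unfolding * using * bc W'(1) V'(1) by (simp add: l_distr)
      finally show ?thesis
        unfolding mem using R * bc W'(4) V'(4) B.m_closed by blast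
    qed
  qed
qed

text \<open>Phrased through the submodules containing \<open>F\<close>, so that linear combinations
  never have to be written down.\<close>

definition finitely_generated :: bool where
  "finitely_generated \<longleftrightarrow>
     (\<exists>F\<subseteq>carrier R. finite F \<and> (\<forall>W. submod W \<and> F \<subseteq> W \<longrightarrow> W = carrier R))"

lemma finitely_generated_induct:
  assumes "finitely_generated" and "P {\<zero>}"
    and extend: "\<And>V u. submod V \<Longrightarrow> u \<in> carrier R \<Longrightarrow> P V \<Longrightarrow> P (extend V u)"
  shows "P (carrier R)"
proof -
  obtain F where F: "F \<subseteq> carrier R" "finite F" "\<And>W. submod W \<Longrightarrow> F \<subseteq> W \<Longrightarrow> W = carrier R"
    using assms(1) unfolding finitely_generated_def by blast
  have "\<exists>W. submod W \<and> F \<subseteq> W \<and> P W"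
    using F(2,1)
  proof (induction F rule: finite_induct)
    case empty
    then show ?case using submod_zero assms(2) by blast
  next
    case (insert u F)
    then obtain W where W: "submod W" "F \<subseteq> W" "P W" by blast
    have u: "u \<in> carrier R" using insert.prems by simp
    have "insert u F \<subseteq> extend W u"
      using subset_extend[OF W(1) u] mem_extend[OF W(1) u] W(2) by blast
    then show ?case
      using submod_extend[OF W(1) u] extend[OF W(1) u W(3)] by blast
  qed
  then show ?thesis using F(3) by blast
qed

text \<open>The chains live in all of \<open>R\<close> and are only compared inside
  \<open>V\<close>. This lets \<open>V\<close> grow by one generator at a time without a notion of
  submodule relative to \<open>V\<close>.\<close>

definition acc_on :: "'c set \<Rightarrow> bool" where
  "acc_on V \<longleftrightarrow> (\<forall>N :: nat \<Rightarrow> 'c set. (\<forall>n. submod (N n)) \<and> (\<forall>n. N n \<subseteq> N (Suc n)) \<longrightarrow>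
     (\<exists>m. \<forall>n\<ge>m. N n \<inter> V = N m \<inter> V))"

text \<open>Two nested submodules with the same intersection with \<open>V\<close> and the same
  coefficient ideal at \<open>u\<close> have the same intersection with \<open>extend V u\<close>:
  subtracting an element of the smaller one with the same coefficient leaves an element of
  \<open>V\<close>.\<close>

lemma acc_on_extend:
  assumes noeth: "right_noetherian B" and V: "submod V" and u: "u \<in> carrier R" and acc: "acc_on V"
  shows "acc_on (extend V u)"
  unfolding acc_on_def
proof (intro allI impI, elim conjE)
  fix N :: "nat \<Rightarrow> 'c set"
  assume N: "\<forall>n. submod (N n)" and up: "\<forall>n. N n \<subseteq> N (Suc n)"
  note V' = submodD[OF V]
  have N': "submod (N n)" for n using N by blast
  have mono: "N i \<subseteq> N k" if "i \<le> k" for i k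
    using lift_Suc_mono_le[of N i k] up that by blast
  obtain m1 where m1: "\<And>n. n \<ge> m1 \<Longrightarrow> N n \<inter> V = N m1 \<inter> V"
    using acc N up unfolding acc_on_def by blast
  let ?I = "\<lambda>n. transporter u (N n) V"
  have "\<forall>n. right_ideal (?I n) B" "\<forall>n. ?I n \<subseteq> ?I (Suc n)"
    using right_ideal_transporter[OF N' V u] up unfolding transporter_def by blast+
  then obtain m2 where m2: "\<And>n. n \<ge> m2 \<Longrightarrow> ?I n = ?I m2"
    using noeth[unfolded right_noetherian_def, rule_format, of ?I] by blast
  define m where "m = max m1 m2"
  have "N n \<inter> extend V u \<subseteq> N m \<inter> extend V u" if n: "n \<ge> m" for n
  proof
    fix x assume x: "x \<in> N n \<inter> extend V u"
    then obtain v b where vb: "v \<in> V" "b \<in> carrier B" "x = v \<oplus> u \<otimes> \<phi> b"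
      unfolding extend_def by blast
    have R: "x \<in> carrier R" "v \<in> carrier R" "u \<otimes> \<phi> b \<in> carrier R"
      using x submodD(1)[OF N'] vb V'(1) u by auto
    have "u \<otimes> \<phi> b = x \<oplus> (\<zero> \<ominus> v)"
      using R vb by (simp add: minus_eq a_ac r_neg1 r_neg2)
    then have "b \<in> ?I n"
      unfolding transporter_def using x vb V'(2,5) by blast
    then have "b \<in> ?I m"
      using m2[of n] m2[of m] n unfolding m_def by simp
    then obtain w v' where w: "w \<in> N m" "v' \<in> V" "u \<otimes> \<phi> b = w \<oplus> v'"
      unfolding transporter_def by blast
    have wR: "w \<in> carrier R" "v' \<in> carrier R" using w submodD(1)[OF N'] V'(1) by blast+
    have "x = w \<oplus> (v \<oplus> v')"
      unfolding vb(3) w(3) using wR R by (simp add: a_ac)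
    then have "x \<ominus> w = v \<oplus> v'"
      using wR R by (simp add: add_diff_cancel)
    moreover have "x \<ominus> w \<in> N n"
      using x w(1) mono[OF n] submodD(5)[OF N'] by blast
    ultimately have "x \<ominus> w \<in> N n \<inter> V"
      using vb w V'(3) by simp
    then have "x \<ominus> w \<in> N m"
      using m1[of n] m1[of m] n unfolding m_def by auto
    then have "(x \<ominus> w) \<oplus> w \<in> N m"
      using w(1) submodD(3)[OF N'] by blast
    then show "x \<in> N m \<inter> extend V u"
      using x R wR by (simp add: add_diff_cancel)
  qed
  then show "\<exists>m. \<forall>n\<ge>m. N n \<inter> extend V u = N m \<inter> extend V u"
    using mono by blast
qed

lemma acc_submod:
  assumes "right_noetherian B" "finitely_generated"
    and "\<And>n::nat. submod (N n)" "\<And>n. N n \<subseteq> N (Suc n)"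
  shows "\<exists>m. \<forall>n\<ge>m. N n = N m"
proof -
  have "acc_on (carrier R)"
    using assms(2)
  proof (rule finitely_generated_induct)
    show "acc_on {\<zero>}"
      unfolding acc_on_def using submodD(2) by (intro allI impI exI[of _ 0]) blast
  qed (rule acc_on_extend[OF assms(1)])
  then obtain m where "\<And>n. n \<ge> m \<Longrightarrow> N n \<inter> carrier R = N m \<inter> carrier R"
    using assms(3,4) unfolding acc_on_def by blast
  moreover have "N n \<inter> carrier R = N n" for n
    using submodD(1)[OF assms(3)] by blast
  ultimately show ?thesis by auto
qed

lemma submod_maximal:
  assumes "right_noetherian B" "finitely_generated"
    and "\<And>W. W \<in> F \<Longrightarrow> submod W" "V \<in> F"
  obtains M where "M \<in> F" "\<And>W. W \<in> F \<Longrightarrow> M \<subseteq> W \<Longrightarrow> W = M"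
proof (rule acc_imp_maximal[of F V])
  show "\<exists>m. \<forall>n\<ge>m. N n = N m" if N: "\<And>n. N n \<in> F" "\<And>n. N n \<subseteq> N (Suc n)" for N :: "nat \<Rightarrow> _"
    by (rule acc_submod[OF assms(1,2)]) (use assms(3) N in blast)+
qed (use assms that in blast)+

lemma right_noetherian_extension:
  assumes "right_noetherian B" "finitely_generated"
  shows "right_noetherian R"
  unfolding right_noetherian_def
  using acc_submod[OF assms] right_ideal_submod by blast

text \<open>From some index on, all factors of the chain cut down to \<open>V\<close> are
  \<open>Q\<close>-small. The element b may depend on the factor, but must serve all of it.\<close>

definition fin_on :: "'a set \<Rightarrow> 'c set \<Rightarrow> bool" where
  "fin_on Q V \<longleftrightarrow> (\<forall>W :: nat \<Rightarrow> 'c set. (\<forall>n. submod (W n)) \<and> (\<forall>n. W (Suc n) \<subseteq> W n) \<longrightarrow>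
     (\<exists>m. \<forall>n\<ge>m. \<exists>b\<in>carrier B - Q. \<forall>x\<in>W n \<inter> V. x \<otimes> \<phi> b \<in> W (Suc n) \<inter> V))"

text \<open>On \<open>extend V u\<close> each factor of the chain is an extension of a factor of
  coefficient ideals in \<open>B\<close> by a factor inside \<open>V\<close>. The coefficient ideals
  contain \<open>P\<close>. If \<open>P = Q\<close>, they are governed by
  \<open>descending_eventually_small\<close>; otherwise any p in \<open>P\<close> outside
  \<open>Q\<close> carries each of them into \<open>P\<close> and hence into the next. Primeness of
  \<open>Q\<close> supplies a product b c b' outside \<open>Q\<close> that handles both
  layers.\<close>

lemma fin_on_extend:
  assumes noeth: "right_noetherian B" and Q: "two_sided_prime Q B" and bounded: "B.bounded_mod Q"
    and V: "submod V" and u: "u \<in> carrier R" and fin: "fin_on Q V"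
    and P: "P \<subseteq> carrier B" "\<And>b. b \<in> P \<Longrightarrow> u \<otimes> \<phi> b \<in> V" "P = Q \<or> \<not> P \<subseteq> Q"
      "\<And>b c. b \<in> P \<Longrightarrow> c \<in> carrier B \<Longrightarrow> c \<otimes>\<^bsub>B\<^esub> b \<in> P"
  shows "fin_on Q (extend V u)"
  unfolding fin_on_def
proof (intro allI impI, elim conjE)
  fix W :: "nat \<Rightarrow> 'c set"
  assume W: "\<forall>n. submod (W n)" and down: "\<forall>n. W (Suc n) \<subseteq> W n"
  note V' = submodD[OF V] and Q' = B.two_sided_primeD[OF Q]
  have W': "submod (W n)" for n using W by blast
  note W'' = submodD[OF W']
  define K where "K n = transporter u (W n) V" for n
  have K: "right_ideal (K n) B" for n
    unfolding K_def by (rule right_ideal_transporter[OF W' V u])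
  have KS: "K (Suc n) \<subseteq> K n" for n
    using down unfolding K_def transporter_def by blast
  have PK: "P \<subseteq> K n" for n
  proof
    fix b assume b: "b \<in> P"
    then have "u \<otimes> \<phi> b = \<zero> \<oplus> u \<otimes> \<phi> b"
      using u P(1) by auto
    then show "b \<in> K n"
      unfolding K_def transporter_def using b P(1,2) W''(2) by blast
  qed
  have "\<exists>m. \<forall>n\<ge>m. \<exists>b\<in>carrier B - Q. \<forall>x\<in>K n. x \<otimes>\<^bsub>B\<^esub> b \<in> K (Suc n)"
  proof (cases "P = Q")
    case True
    then show ?thesis
      using PK K KS by (intro B.descending_eventually_small[OF noeth Q bounded]) auto
  next
    case False
    then obtain p where p: "p \<in> P" "p \<notin> Q" using P(3) by blast
    have "x \<otimes>\<^bsub>B\<^esub> p \<in> P" if "x \<in> carrier B" for x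
      using P(4) p that by blast
    then have "\<forall>x\<in>K n. x \<otimes>\<^bsub>B\<^esub> p \<in> K (Suc n)" for n
      using PK B.right_idealD(1)[OF K] by blast
    then show ?thesis using p P(1) by blast
  qed
  then obtain m1 where m1: "\<And>n. n \<ge> m1 \<Longrightarrow> \<exists>b\<in>carrier B - Q. \<forall>x\<in>K n. x \<otimes>\<^bsub>B\<^esub> b \<in> K (Suc n)"
    by blast
  obtain m2 where m2: "\<And>n. n \<ge> m2 \<Longrightarrow> \<exists>b\<in>carrier B - Q. \<forall>x\<in>W n \<inter> V. x \<otimes> \<phi> b \<in> W (Suc n) \<inter> V"
    using fin W down unfolding fin_on_def by blast
  have "\<exists>b\<in>carrier B - Q. \<forall>x\<in>W n \<inter> extend V u. x \<otimes> \<phi> b \<in> W (Suc n) \<inter> extend V u"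
    if n: "n \<ge> max m1 m2" for n
  proof -
    obtain b where b: "b \<in> carrier B - Q" "\<And>x. x \<in> K n \<Longrightarrow> x \<otimes>\<^bsub>B\<^esub> b \<in> K (Suc n)"
      using m1[of n] n by auto
    obtain b' where b': "b' \<in> carrier B - Q" "\<And>x. x \<in> W n \<inter> V \<Longrightarrow> x \<otimes> \<phi> b' \<in> W (Suc n) \<inter> V"
      using m2[of n] n by auto
    obtain c where c: "c \<in> carrier B" "b \<otimes>\<^bsub>B\<^esub> c \<otimes>\<^bsub>B\<^esub> b' \<in> carrier B - Q"
      using Q'(5) b(1) b'(1) by blast
    have B: "b \<in> carrier B" "b' \<in> carrier B" using b b' by auto
    have "x \<otimes> \<phi> (b \<otimes>\<^bsub>B\<^esub> c \<otimes>\<^bsub>B\<^esub> b') \<in> W (Suc n) \<inter> extend V u" if x: "x \<in> W n \<inter> extend V u" for x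
    proof -
      obtain v k where vk: "v \<in> V" "k \<in> carrier B" "x = v \<oplus> u \<otimes> \<phi> k"
        using x unfolding extend_def by blast
      have R: "x \<in> carrier R" "v \<in> carrier R" "u \<otimes> \<phi> k \<in> carrier R"
        using x W''(1) vk V'(1) u by auto
      have "u \<otimes> \<phi> k = x \<oplus> (\<zero> \<ominus> v)"
        using R vk by (simp add: minus_eq a_ac r_neg1 r_neg2)
      then have "k \<in> K n"
        unfolding K_def transporter_def using x vk V'(2,5) by blast
      then have "k \<otimes>\<^bsub>B\<^esub> b \<in> K (Suc n)" by (rule b(2))
      then obtain w v' where w: "w \<in> W (Suc n)" "v' \<in> V" "u \<otimes> \<phi> (k \<otimes>\<^bsub>B\<^esub> b) = w \<oplus> v'"
        unfolding K_def transporter_def by blast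
      have wR: "w \<in> carrier R" "v' \<in> carrier R" using w W''(1) V'(1) by blast+
      have "x \<otimes> \<phi> b = v \<otimes> \<phi> b \<oplus> u \<otimes> \<phi> (k \<otimes>\<^bsub>B\<^esub> b)"
        using vk R(2) u B by (simp add: l_distr m_assoc)
      also have "\<dots> = w \<oplus> (v \<otimes> \<phi> b \<oplus> v')"
        unfolding w(3) using R(2) B wR by (simp add: a_ac)
      finally have xb: "x \<otimes> \<phi> b = w \<oplus> (v \<otimes> \<phi> b \<oplus> v')" .
      then have d: "x \<otimes> \<phi> b \<ominus> w = v \<otimes> \<phi> b \<oplus> v'"
        using R(2) B wR by (simp add: add_diff_cancel)
      \<comment> \<open>Up to this remainder, \<open>b\<close> carries \<open>x\<close> into
        \<open>W (Suc n)\<close>. The remainder lies in \<open>W n \<inter> V\<close>, where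
        \<open>c\<close> keeps it, and \<open>b'\<close> then carries it into
        \<open>W (Suc n)\<close>.\<close>
      have "x \<otimes> \<phi> b \<ominus> w \<in> W n"
        using x w(1) down B W''(4,5) by blast
      moreover have "x \<otimes> \<phi> b \<ominus> w \<in> V"
        unfolding d using vk w B V'(3,4) by blast
      ultimately have "(x \<otimes> \<phi> b \<ominus> w) \<otimes> \<phi> c \<in> W n \<inter> V"
        using c W''(4) V'(4) by blast
      then have "(x \<otimes> \<phi> b \<ominus> w) \<otimes> \<phi> c \<otimes> \<phi> b' \<in> W (Suc n)"
        using b'(2) by blast
      moreover have "w \<otimes> \<phi> c \<otimes> \<phi> b' \<in> W (Suc n)"
        using w(1) c B W''(4) by blast
      ultimately have "(x \<otimes> \<phi> b \<ominus> w) \<otimes> \<phi> c \<otimes> \<phi> b' \<oplus> w \<otimes> \<phi> c \<otimes> \<phi> b' \<in> W (Suc n)"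
        by (rule W''(3))
      moreover have "(x \<otimes> \<phi> b \<ominus> w) \<otimes> \<phi> c \<otimes> \<phi> b' \<oplus> w \<otimes> \<phi> c \<otimes> \<phi> b' = ((x \<otimes> \<phi> b \<ominus> w) \<oplus> w) \<otimes> \<phi> c \<otimes> \<phi> b'"
        using R wR B c by (simp add: l_distr)
      moreover have "\<dots> = x \<otimes> \<phi> (b \<otimes>\<^bsub>B\<^esub> c \<otimes>\<^bsub>B\<^esub> b')"
        using R wR B c by (simp add: add_diff_cancel m_assoc)
      moreover have "x \<otimes> \<phi> (b \<otimes>\<^bsub>B\<^esub> c \<otimes>\<^bsub>B\<^esub> b') \<in> extend V u"
        using submodD(4)[OF submod_extend[OF V u]] x c by blast
      ultimately show ?thesis by simp
    qed
    with c show ?thesis by blast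
  qed
  then show "\<exists>m. \<forall>n\<ge>m. \<exists>b\<in>carrier B - Q. \<forall>x\<in>W n \<inter> extend V u. x \<otimes> \<phi> b \<in> W (Suc n) \<inter> extend V u"
    by blast
qed

text \<open>An associated prime of the quotient module by \<open>V\<close>: a maximal one among the
  annihilators \<open>ann u\<close> of the cyclic submodules generated by elements u outside
  \<open>V\<close>. Each of them contains the kernel of \<open>\<phi>\<close>.\<close>

lemma associated_prime:
  assumes noeth: "right_noetherian B" and V: "submod V" "V \<noteq> carrier R"
  shows "\<exists>u\<in>carrier R - V. \<exists>P. two_sided_prime P B \<and> {b \<in> carrier B. \<phi> b = \<zero>} \<subseteq> P \<and>
           (\<forall>b\<in>P. u \<otimes> \<phi> b \<in> V)"
proof -
  note V' = submodD[OF V(1)]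
  define ann where "ann u = {b \<in> carrier B. \<forall>c\<in>carrier B. u \<otimes> \<phi> c \<otimes> \<phi> b \<in> V}" for u
  have ann_ideal: "ideal (ann u) B" if u: "u \<in> carrier R" for u
    unfolding B.ideal_iff B.right_ideal_iff
  proof (intro conjI ballI)
    show "ann u \<subseteq> carrier B" by (auto simp: ann_def)
    show "\<zero>\<^bsub>B\<^esub> \<in> ann u" using u V'(2) by (simp add: ann_def)
    show "x \<oplus>\<^bsub>B\<^esub> y \<in> ann u" if xy: "x \<in> ann u" "y \<in> ann u" for x y
      using xy u V'(3) by (auto simp: ann_def r_distr)
    show "x \<otimes>\<^bsub>B\<^esub> r \<in> ann u" if xr: "x \<in> ann u" "r \<in> carrier B" for x r
    proof -
      have "u \<otimes> \<phi> c \<otimes> \<phi> (x \<otimes>\<^bsub>B\<^esub> r) = u \<otimes> \<phi> c \<otimes> \<phi> x \<otimes> \<phi> r" if "c \<in> carrier B" for c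
        using that xr u by (simp add: ann_def m_assoc)
      then show ?thesis using xr V'(4) by (simp add: ann_def)
    qed
    show "r \<otimes>\<^bsub>B\<^esub> x \<in> ann u" if xr: "x \<in> ann u" "r \<in> carrier B" for x r
    proof -
      have "u \<otimes> \<phi> c \<otimes> \<phi> (r \<otimes>\<^bsub>B\<^esub> x) = u \<otimes> \<phi> (c \<otimes>\<^bsub>B\<^esub> r) \<otimes> \<phi> x" if "c \<in> carrier B" for c
        using that xr u by (simp add: ann_def m_assoc)
      moreover have "u \<otimes> \<phi> (c \<otimes>\<^bsub>B\<^esub> r) \<otimes> \<phi> x \<in> V" if "c \<in> carrier B" for c
        using that xr B.m_closed unfolding ann_def by blast
      ultimately show ?thesis using xr by (simp add: ann_def)
    qed
  qed
  obtain u0 where "u0 \<in> carrier R - V" using V V'(1) by blast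
  then have u0: "ann u0 \<in> ann ` (carrier R - V)" by blast
  have "right_ideal U B" if "U \<in> ann ` (carrier R - V)" for U
    using that ann_ideal B.ideal_iff by blast
  then obtain P where "P \<in> ann ` (carrier R - V)"
    and max: "\<And>Y. Y \<in> ann ` (carrier R - V) \<Longrightarrow> P \<subseteq> Y \<Longrightarrow> Y = P"
    using B.noetherian_maximal[OF noeth _ u0] by blast
  then obtain u where u: "u \<in> carrier R" "u \<notin> V" "P = ann u" by blast
  have "a \<in> P \<or> b \<in> P"
    if ab: "a \<in> carrier B" "b \<in> carrier B" "\<forall>c\<in>carrier B. a \<otimes>\<^bsub>B\<^esub> c \<otimes>\<^bsub>B\<^esub> b \<in> P" for a b
  proof (rule disjCI)
    assume "b \<notin> P"
    show "a \<in> P"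
    proof (rule ccontr)
      assume "a \<notin> P"
      then obtain c where c: "c \<in> carrier B" "u \<otimes> \<phi> c \<otimes> \<phi> a \<notin> V"
        using ab by (auto simp: u ann_def)
      \<comment> \<open>This element generates a submodule of the one generated by \<open>u\<close>,
        so its annihilator contains \<open>P\<close>, and equals it by maximality. But
        \<open>b\<close> annihilates it, because every a d b lies in \<open>P\<close>.\<close>
      let ?u = "u \<otimes> \<phi> c \<otimes> \<phi> a"
      have "P \<subseteq> ann ?u"
      proof
        fix p assume p: "p \<in> P"
        then have pB: "p \<in> carrier B" by (simp add: u ann_def)
        have "?u \<otimes> \<phi> d \<otimes> \<phi> p = u \<otimes> \<phi> (c \<otimes>\<^bsub>B\<^esub> a \<otimes>\<^bsub>B\<^esub> d) \<otimes> \<phi> p" if "d \<in> carrier B" for d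
          using that c ab u pB by (simp add: m_assoc)
        moreover have "u \<otimes> \<phi> (c \<otimes>\<^bsub>B\<^esub> a \<otimes>\<^bsub>B\<^esub> d) \<otimes> \<phi> p \<in> V" if "d \<in> carrier B" for d
          using that c ab p B.m_closed unfolding u ann_def by blast
        ultimately show "p \<in> ann ?u" using pB by (simp add: ann_def)
      qed
      moreover have "?u \<in> carrier R - V" using c ab u by simp
      ultimately have "ann ?u = P" using max by blast
      moreover have "?u \<otimes> \<phi> d \<otimes> \<phi> b = u \<otimes> \<phi> c \<otimes> \<phi> (a \<otimes>\<^bsub>B\<^esub> d \<otimes>\<^bsub>B\<^esub> b)" if "d \<in> carrier B" for d
        using that c ab u by (simp add: m_assoc)
      then have "b \<in> ann ?u"
        using ab c by (simp add: u ann_def)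
      ultimately show False using \<open>b \<notin> P\<close> by blast
    qed
  qed
  moreover have "\<one>\<^bsub>B\<^esub> \<notin> P"
  proof
    assume "\<one>\<^bsub>B\<^esub> \<in> P"
    then have "u \<otimes> \<phi> \<one>\<^bsub>B\<^esub> \<otimes> \<phi> \<one>\<^bsub>B\<^esub> \<in> V" unfolding u ann_def by blast
    with u show False by simp
  qed
  ultimately have "two_sided_prime P B"
    unfolding B.two_sided_prime_iff using ann_ideal[OF u(1)] u(3) by blast
  moreover have "{b \<in> carrier B. \<phi> b = \<zero>} \<subseteq> P"
    using u V'(2) by (auto simp: ann_def)
  moreover have "u \<otimes> \<phi> b \<in> V" if "b \<in> P" for b
  proof -
    have "u \<otimes> \<phi> \<one>\<^bsub>B\<^esub> \<otimes> \<phi> b \<in> V" using that unfolding u ann_def by blast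
    with u show ?thesis by simp
  qed
  ultimately show ?thesis using u by blast
qed

text \<open>A finite filtration by cyclic steps, each factor killed by a member of
  \<open>\<P>\<close>. The condition is recorded for the generator \<open>u\<close> only; for
  two-sided ideals in \<open>\<P>\<close> it extends to the whole cyclic factor.\<close>

inductive filtered :: "'a set set \<Rightarrow> 'c set \<Rightarrow> bool" for \<P> where
  zero: "filtered \<P> {\<zero>}"
| extend: "filtered \<P> V \<Longrightarrow> u \<in> carrier R \<Longrightarrow> P \<in> \<P> \<Longrightarrow> (\<forall>b\<in>P. u \<otimes> \<phi> b \<in> V) \<Longrightarrow>
    filtered \<P> (extend V u)"

lemma filtered_submod: "filtered \<P> V \<Longrightarrow> submod V"
  by (induction rule: filtered.induct) (auto intro: submod_zero submod_extend)

lemma filtered_mono: "filtered \<P> V \<Longrightarrow> \<P> \<subseteq> \<P>' \<Longrightarrow> filtered \<P>' V"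
  by (induction rule: filtered.induct) (auto intro: filtered.intros)

text \<open>A maximal submodule with such a filtration is all of \<open>R\<close>, since otherwise
  an associated prime of the quotient would add one more step.\<close>

lemma prime_filtration:
  assumes "right_noetherian B" "finitely_generated"
  shows "\<exists>\<P>. finite \<P> \<and> filtered \<P> (carrier R) \<and>
           (\<forall>P\<in>\<P>. two_sided_prime P B \<and> {b \<in> carrier B. \<phi> b = \<zero>} \<subseteq> P)"
proof -
  let ?ok = "\<lambda>\<P>. finite \<P> \<and> (\<forall>P\<in>\<P>. two_sided_prime P B \<and> {b \<in> carrier B. \<phi> b = \<zero>} \<subseteq> P)"
  let ?F = "{V. \<exists>\<P>. ?ok \<P> \<and> filtered \<P> V}"
  have 0: "{\<zero>} \<in> ?F" using filtered.zero[of "{}"] by blast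
  have "submod W" if "W \<in> ?F" for W using that filtered_submod by blast
  then obtain V where "V \<in> ?F" and max: "\<And>W. W \<in> ?F \<Longrightarrow> V \<subseteq> W \<Longrightarrow> W = V"
    using submod_maximal[OF assms _ 0] by blast
  then obtain \<P> where P: "?ok \<P>" "filtered \<P> V" by blast
  have V: "submod V" using P filtered_submod by blast
  have "V = carrier R"
  proof (rule ccontr)
    assume "V \<noteq> carrier R"
    then obtain u P where u: "u \<in> carrier R - V" and P': "two_sided_prime P B"
      "{b \<in> carrier B. \<phi> b = \<zero>} \<subseteq> P" "\<forall>b\<in>P. u \<otimes> \<phi> b \<in> V"
      using associated_prime[OF assms(1) V] by blast
    have "filtered (insert P \<P>) V" using P(2) by (rule filtered_mono) blast
    then have "filtered (insert P \<P>) (extend V u)"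
      by (rule filtered.extend) (use u P' in auto)
    moreover have "?ok (insert P \<P>)" using P P' by simp
    ultimately have "extend V u \<in> ?F" by blast
    moreover have "V \<subseteq> extend V u" "u \<in> extend V u"
      using subset_extend mem_extend V u by blast+
    ultimately show False using max u by blast
  qed
  with P show ?thesis by blast
qed

text \<open>Minimality of \<open>Q\<close> in \<open>\<P>\<close> leaves, at each cyclic step,
  exactly the two cases of \<open>fin_on_extend\<close>: the prime is \<open>Q\<close> or is not
  contained in \<open>Q\<close>.\<close>

lemma filtered_fin_on:
  assumes "right_noetherian B" "two_sided_prime Q B" "B.bounded_mod Q"
    and \<P>: "\<And>P. P \<in> \<P> \<Longrightarrow> two_sided_prime P B" "\<And>P. P \<in> \<P> \<Longrightarrow> P \<subseteq> Q \<Longrightarrow> P = Q"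
    and "filtered \<P> V"
  shows "fin_on Q V"
  using assms(6)
proof (induction rule: filtered.induct)
  case zero
  have "\<exists>b\<in>carrier B - Q. \<forall>x\<in>W n \<inter> {\<zero>}. x \<otimes> \<phi> b \<in> W (Suc n) \<inter> {\<zero>}"
    if "\<forall>n. submod (W n)" for W :: "nat \<Rightarrow> _" and n
    using that submodD(2) B.two_sided_primeD(3)[OF assms(2)]
    by (intro bexI[of _ "\<one>\<^bsub>B\<^esub>"]) auto
  then show ?case unfolding fin_on_def by blast
next
  case (extend V u P)
  note P = B.two_sided_primeD[OF \<P>(1)[OF extend(3)]]
  have V: "submod V" using extend(1) by (rule filtered_submod)
  show ?case
  proof (rule fin_on_extend[OF assms(1-3) V extend(2) extend(5)])
    show "P \<subseteq> carrier B" using P(2) B.right_idealD(1) by blast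
    show "P = Q \<or> \<not> P \<subseteq> Q" using \<P>(2) extend(3) by blast
  qed (use extend(4) P(4) in auto)
qed

text \<open>
  If an essential right ideal \<open>E\<close> contained no ideal, then for a left cancellable \<open>c \<in> E\<close> all
  factors of the chain \<open>R \<supseteq> c R \<supseteq> c\<^sup>2 R \<supseteq> \<dots>\<close>, being isomorphic to \<open>R / c R\<close>, would have annihilator
  \<open>ker \<phi>\<close> in \<open>B\<close>. This contradicts finiteness at a minimal prime of \<open>B\<close> over \<open>ker \<phi>\<close>.
\<close>

lemma prime_right_bounded:
  assumes FBN: "right_FBN B" and fg: "finitely_generated" and prime: "two_sided_prime {\<zero>} R"
  shows "right_bounded R"
  unfolding right_bounded_iff bounded_mod_def
proof (intro allI impI, elim conjE)
  fix E
  assume E: "right_ideal E R"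
    and ess: "\<forall>x\<in>carrier R - {\<zero>}. \<exists>r\<in>carrier R. x \<otimes> r \<in> E - {\<zero>}"
  have noeth: "right_noetherian B" using FBN by (simp add: right_FBN_def)
  have "\<exists>c\<in>E. \<forall>x\<in>carrier R. c \<otimes> x = \<zero> \<longrightarrow> x = \<zero>"
    using ess by (intro essential_contains_left_cancellable[OF right_noetherian_extension[OF noeth fg] prime E]) blast
  then obtain c where c: "c \<in> E" "\<And>x. x \<in> carrier R \<Longrightarrow> c \<otimes> x = \<zero> \<Longrightarrow> x = \<zero>"
    by blast
  note E' = right_idealD[OF E]
  have cR: "c \<in> carrier R" using c E' by blast
  have cancel: "x = y" if xy: "x \<in> carrier R" "y \<in> carrier R" "c [^] n \<otimes> x = c [^] n \<otimes> y" for x y and n :: nat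
    using xy
  proof (induction n arbitrary: x y)
    case 0
    then show ?case by simp
  next
    case (Suc n)
    then have "c [^] n \<otimes> (c \<otimes> x) = c [^] n \<otimes> (c \<otimes> y)"
      using cR by (simp add: m_assoc)
    then have "c \<otimes> x = c \<otimes> y" by (rule Suc.IH[rotated 2]) (use cR Suc(2,3) in simp_all)
    then have "c \<otimes> (x \<ominus> y) = \<zero>"
      using cR Suc(2,3) by (simp add: minus_eq r_distr r_minus r_neg)
    then have "x \<ominus> y = \<zero>" using c(2) Suc(2,3) by simp
    then show ?case using Suc(2,3) by simp
  qed
  show "\<exists>x\<in>carrier R - {\<zero>}. \<forall>r\<in>carrier R. r \<otimes> x \<in> E"
  proof (rule ccontr)
    assume neg: "\<not> ?thesis"
    obtain \<P> where P: "finite \<P>" "filtered \<P> (carrier R)"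
      "\<And>P. P \<in> \<P> \<Longrightarrow> two_sided_prime P B" "\<And>P. P \<in> \<P> \<Longrightarrow> {b \<in> carrier B. \<phi> b = \<zero>} \<subseteq> P"
      using prime_filtration[OF noeth fg] by blast
    \<comment> \<open>Without any step in the filtration \<open>R\<close> would be the zero ring,
      which is not prime.\<close>
    have "\<P> \<noteq> {}"
    proof
      assume "\<P> = {}"
      with P(2) have "carrier R = {\<zero>}" by (auto elim: filtered.cases)
      with two_sided_primeD(3)[OF prime] one_closed show False by blast
    qed
    then obtain Q where Q: "Q \<in> \<P>" "\<And>P. P \<in> \<P> \<Longrightarrow> P \<subseteq> Q \<Longrightarrow> P = Q"
      using finite_has_minimal[OF P(1)] by blast
    have "B.bounded_mod Q"
      using FBN P(3)[OF Q(1)] by (simp add: right_FBN_def B.right_fully_bounded_iff)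
    then have fin: "fin_on Q (carrier R)"
      using filtered_fin_on[OF noeth P(3)[OF Q(1)] _ P(3) Q(2) P(2)] by blast
    define W where "W n = (\<otimes>) (c [^] n) ` carrier R" for n :: nat
    have "submod (W n)" for n
      unfolding W_def using cR by (intro right_ideal_submod right_ideal_principal) simp
    moreover have "W (Suc n) \<subseteq> W n" for n
      using cR by (auto simp: W_def m_assoc)
    ultimately obtain m where m: "\<And>n. n \<ge> m \<Longrightarrow>
        \<exists>b\<in>carrier B - Q. \<forall>x\<in>W n \<inter> carrier R. x \<otimes> \<phi> b \<in> W (Suc n) \<inter> carrier R"
      using fin[unfolded fin_on_def, rule_format, of W] by blast
    then obtain b where b: "b \<in> carrier B" "b \<notin> Q" "\<And>x. x \<in> W m \<inter> carrier R \<Longrightarrow> x \<otimes> \<phi> b \<in> W (Suc m)"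
      by blast
    \<comment> \<open>Cancelling c^m transports the statement about the m-th factor to R / c R, so
      all left multiples of \<open>\<phi> b\<close> lie in c R, a part of \<open>E\<close>.\<close>
    have "r \<otimes> \<phi> b \<in> E" if r: "r \<in> carrier R" for r
    proof -
      have "c [^] m \<otimes> r \<in> W m \<inter> carrier R" using r cR by (simp add: W_def)
      then have "c [^] m \<otimes> r \<otimes> \<phi> b \<in> W (Suc m)" by (rule b(3))
      then obtain s where s: "s \<in> carrier R" "c [^] m \<otimes> r \<otimes> \<phi> b = c [^] Suc m \<otimes> s"
        unfolding W_def by blast
      then have "c [^] m \<otimes> (r \<otimes> \<phi> b) = c [^] m \<otimes> (c \<otimes> s)"
        using r cR b(1) by (simp add: m_assoc)
      then have "r \<otimes> \<phi> b = c \<otimes> s" using cancel r cR b(1) s(1) by simp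
      then show ?thesis using c(1) s(1) E'(4) by simp
    qed
    moreover have "\<phi> b \<in> carrier R" using b(1) by simp
    \<comment> \<open>By \<open>neg\<close> the core of \<open>E\<close> is zero. Thus b lies in the
      kernel of \<open>\<phi>\<close>, which every member of \<open>\<P>\<close> contains, in
      particular \<open>Q\<close>.\<close>
    ultimately have "\<phi> b = \<zero>" using neg by blast
    with P(4)[OF Q(1)] b show False by blast
  qed
qed

end

section \<open>Reduction of finite extensions to prime rings\<close>

context surjective_ring_hom
begin

lemma two_sided_prime_zero:
  assumes "two_sided_prime (a_kernel R S h) R"
  shows "two_sided_prime {\<zero>\<^bsub>S\<^esub>} S"
proof -
  have P: "x \<in> a_kernel R S h \<longleftrightarrow> x \<in> carrier R \<and> h x = \<zero>\<^bsub>S\<^esub>" for x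
    unfolding a_kernel_def' by simp
  have *: "\<one> \<notin> a_kernel R S h"
    "\<And>a b. a \<in> carrier R \<Longrightarrow> b \<in> carrier R \<Longrightarrow> \<forall>c\<in>carrier R. a \<otimes> c \<otimes> b \<in> a_kernel R S h \<Longrightarrow>
       a \<in> a_kernel R S h \<or> b \<in> a_kernel R S h"
    using assms unfolding R.two_sided_prime_iff by blast+
  have "x = \<zero>\<^bsub>S\<^esub> \<or> y = \<zero>\<^bsub>S\<^esub>"
    if xy: "x \<in> carrier S" "y \<in> carrier S" "\<forall>z\<in>carrier S. x \<otimes>\<^bsub>S\<^esub> z \<otimes>\<^bsub>S\<^esub> y = \<zero>\<^bsub>S\<^esub>" for x y
  proof -
    obtain a b where ab: "a \<in> carrier R" "b \<in> carrier R" "x = h a" "y = h b"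
      using xy(1,2) surj by blast
    then have "\<forall>c\<in>carrier R. a \<otimes> c \<otimes> b \<in> a_kernel R S h"
      using xy(3) by (simp add: P)
    with ab *(2) show ?thesis by (auto simp: P)
  qed
  moreover have "\<one>\<^bsub>S\<^esub> \<noteq> \<zero>\<^bsub>S\<^esub>" using *(1) by (simp add: P)
  ultimately show ?thesis
    using S.zeroideal by (auto simp: S.two_sided_prime_iff)
qed

end

context ring_map
begin

lemma finitely_generated_surjective:
  assumes "surjective_ring_hom R S h" "finitely_generated"
  shows "ring_map.finitely_generated B S (h \<circ> \<phi>)"
proof -
  interpret h: surjective_ring_hom R S h by fact
  interpret S: ring_map B S "h \<circ> \<phi>"
    by unfold_locales (use hom h.homh in \<open>auto simp: ring_hom_def\<close>)
  obtain F where F: "F \<subseteq> carrier R" "finite F" "\<And>W. submod W \<Longrightarrow> F \<subseteq> W \<Longrightarrow> W = carrier R"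
    using assms(2) unfolding finitely_generated_def by blast
  have "W = carrier S" if W: "S.submod W" "h ` F \<subseteq> W" for W
  proof -
    note W' = S.submodD[OF W(1)]
    have "submod {x \<in> carrier R. h x \<in> W}"
      using W'(2,3,4) by (auto simp: submod_def)
    then have "{x \<in> carrier R. h x \<in> W} = carrier R"
      by (rule F(3)) (use F(1) W(2) in auto)
    then have "h ` carrier R \<subseteq> W" by blast
    then show ?thesis using W'(1) h.surj by blast
  qed
  then show ?thesis
    unfolding S.finitely_generated_def using F(1,2) by (intro exI[of _ "h ` F"]) auto
qed

text \<open>Full boundedness concerns only the prime quotients of \<open>R\<close>. Each of them is
  again finitely generated over \<open>B\<close>, along the composed map, so the prime case
  suffices.\<close>

theorem right_FBN_extension:
  assumes FBN: "right_FBN B" and fg: "finitely_generated"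
  shows "right_FBN R"
proof -
  have "right_bounded (R Quot P)" if P: "two_sided_prime P R" for P
  proof -
    interpret P: ideal P R using two_sided_primeD(1)[OF P] .
    interpret h: surjective_ring_hom R "R Quot P" "(+>) P"
      by (rule P.surjective_ring_hom_rcos)
    interpret Q: ring_map B "R Quot P" "(+>) P \<circ> \<phi>"
      by unfold_locales (use hom h.homh in \<open>auto simp: ring_hom_def\<close>)
    show ?thesis
    proof (rule Q.prime_right_bounded[OF FBN])
      show "Q.finitely_generated"
        using finitely_generated_surjective[OF h.surjective_ring_hom_axioms fg] .
      show "two_sided_prime {\<zero>\<^bsub>R Quot P\<^esub>} (R Quot P)"
        using h.two_sided_prime_zero P by (simp add: P.a_kernel_rcos)
    qed
  qed
  moreover have "right_noetherian R"
    using right_noetherian_extension FBN fg by (simp add: right_FBN_def)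
  ultimately show ?thesis
    by (simp add: right_FBN_def right_fully_bounded_def)
qed

end

section \<open>Corners\<close>

text \<open>A ring \<open>B\<close> identified, through \<open>\<psi>\<close>, with the corner \<open>\<epsilon> T \<epsilon>\<close> for the idempotent \<open>\<epsilon> = \<psi> 1\<close>.\<close>

locale ring_corner = B: ring B + ring T for B and T (structure) +
  fixes \<psi>
  assumes closed [simp]: "b \<in> carrier B \<Longrightarrow> \<psi> b \<in> carrier T"
    and add [simp]: "b \<in> carrier B \<Longrightarrow> c \<in> carrier B \<Longrightarrow> \<psi> (b \<oplus>\<^bsub>B\<^esub> c) = \<psi> b \<oplus> \<psi> c"
    and mult: "b \<in> carrier B \<Longrightarrow> c \<in> carrier B \<Longrightarrow> \<psi> (b \<otimes>\<^bsub>B\<^esub> c) = \<psi> b \<otimes> \<psi> c"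
    and inj: "inj_on \<psi> (carrier B)"
    and full: "t \<in> carrier T \<Longrightarrow> \<psi> \<one>\<^bsub>B\<^esub> \<otimes> t \<otimes> \<psi> \<one>\<^bsub>B\<^esub> \<in> \<psi> ` carrier B"
begin

abbreviation \<epsilon> where "\<epsilon> \<equiv> \<psi> \<one>\<^bsub>B\<^esub>"

lemma unit_corner [simp]:
  assumes "b \<in> carrier B"
  shows "\<epsilon> \<otimes> \<psi> b = \<psi> b" "\<psi> b \<otimes> \<epsilon> = \<psi> b"
  using assms mult[of "\<one>\<^bsub>B\<^esub>" b] mult[of b "\<one>\<^bsub>B\<^esub>"] by simp_all

lemma corner_assoc:
  assumes "b \<in> carrier B" "t \<in> carrier T"
  shows "\<epsilon> \<otimes> (\<psi> b \<otimes> t) = \<psi> b \<otimes> t" "\<psi> b \<otimes> (\<epsilon> \<otimes> t) = \<psi> b \<otimes> t"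
  using assms by (simp_all flip: m_assoc)

text \<open>This retraction of \<open>T\<close> onto its corner is additive and linear over
  \<open>B\<close> on both sides, but in general not multiplicative.\<close>

definition compress :: "'c \<Rightarrow> 'a" where
  "compress t = inv_into (carrier B) \<psi> (\<epsilon> \<otimes> t \<otimes> \<epsilon>)"

lemma compress:
  assumes "t \<in> carrier T"
  shows "compress t \<in> carrier B" "\<psi> (compress t) = \<epsilon> \<otimes> t \<otimes> \<epsilon>"
  unfolding compress_def using full[OF assms] by (rule inv_into_into, rule f_inv_into_f)

lemma compressI:
  assumes "b \<in> carrier B" "t \<in> carrier T" "\<psi> b = \<epsilon> \<otimes> t \<otimes> \<epsilon>"
  shows "compress t = b"
  by (rule inj_onD[OF inj]) (use assms compress[OF assms(2)] in simp_all)

lemma compress_add: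
  assumes "s \<in> carrier T" "t \<in> carrier T"
  shows "compress (s \<oplus> t) = compress s \<oplus>\<^bsub>B\<^esub> compress t"
  using assms compress by (intro compressI) (simp_all add: r_distr l_distr)

lemma compress_psi: "b \<in> carrier B \<Longrightarrow> compress (\<psi> b) = b"
  by (intro compressI) simp_all

lemma compress_zero: "compress \<zero> = \<zero>\<^bsub>B\<^esub>"
proof -
  have "\<psi> \<zero>\<^bsub>B\<^esub> \<oplus> \<psi> \<zero>\<^bsub>B\<^esub> = \<psi> \<zero>\<^bsub>B\<^esub>"
    using add[of "\<zero>\<^bsub>B\<^esub>" "\<zero>\<^bsub>B\<^esub>"] by (simp del: add)
  then have "\<psi> \<zero>\<^bsub>B\<^esub> = \<zero>"
    by simp
  then show ?thesis by (intro compressI) simp_all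
qed

lemma compress_mult:
  assumes "b \<in> carrier B" "t \<in> carrier T"
  shows "compress (\<psi> b \<otimes> t) = b \<otimes>\<^bsub>B\<^esub> compress t" "compress (t \<otimes> \<psi> b) = compress t \<otimes>\<^bsub>B\<^esub> b"
  using assms compress by (intro compressI; simp add: mult m_assoc corner_assoc)+

text \<open>For a right ideal \<open>I\<close>, the largest right ideal of \<open>T\<close> that
  compresses into \<open>I\<close>.\<close>

definition lift :: "'a set \<Rightarrow> 'c set" where
  "lift I = {t \<in> carrier T. \<forall>s\<in>carrier T. compress (t \<otimes> s) \<in> I}"

lemma right_ideal_lift:
  assumes "right_ideal I B"
  shows "right_ideal (lift I) T"
  unfolding right_ideal_iff
proof (intro conjI ballI)
  note I = B.right_idealD[OF assms]
  show "lift I \<subseteq> carrier T" by (auto simp: lift_def)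
  show "\<zero> \<in> lift I" using I(2) by (simp add: lift_def compress_zero)
  show "x \<oplus> y \<in> lift I" if "x \<in> lift I" "y \<in> lift I" for x y
    using that I(3) by (auto simp: lift_def l_distr compress_add)
  show "x \<otimes> r \<in> lift I" if "x \<in> lift I" "r \<in> carrier T" for x r
    using that by (auto simp: lift_def m_assoc)
qed

lemma lift_mono: "I \<subseteq> J \<Longrightarrow> lift I \<subseteq> lift J"
  by (auto simp: lift_def)

lemma psi_lift_iff:
  assumes "right_ideal I B" "b \<in> carrier B"
  shows "\<psi> b \<in> lift I \<longleftrightarrow> b \<in> I"
proof
  assume "\<psi> b \<in> lift I"
  then have "compress (\<psi> b \<otimes> \<one>) \<in> I" unfolding lift_def by blast
  then show "b \<in> I" using assms by (simp add: compress_psi)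
next
  assume "b \<in> I"
  then show "\<psi> b \<in> lift I"
    using assms B.right_idealD(4)[OF assms(1)] compress by (simp add: lift_def compress_mult)
qed

text \<open>Lifting is monotone and \<open>I\<close> is recovered from \<open>lift I\<close> as its
  preimage under \<open>\<psi>\<close>, so a chain in \<open>B\<close> is stationary as soon as its
  lift is.\<close>

lemma right_noetherian_corner:
  assumes "right_noetherian T"
  shows "right_noetherian B"
  unfolding right_noetherian_def
proof (intro allI impI, elim conjE)
  fix I :: "nat \<Rightarrow> 'a set"
  assume I: "\<forall>n. right_ideal (I n) B" "\<forall>n. I n \<subseteq> I (Suc n)"
  have "\<forall>n. right_ideal (lift (I n)) T" "\<forall>n. lift (I n) \<subseteq> lift (I (Suc n))"
    using I right_ideal_lift lift_mono by simp_all
  then obtain N where N: "\<And>n. n \<ge> N \<Longrightarrow> lift (I n) = lift (I N)"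
    using assms[unfolded right_noetherian_def, rule_format, of "\<lambda>n. lift (I n)"] by blast
  have rec: "I n = {b \<in> carrier B. \<psi> b \<in> lift (I n)}" for n
    using psi_lift_iff I(1) B.right_idealD(1) by blast
  have "I n = I N" if "n \<ge> N" for n
    using N[OF that] rec[of n] rec[of N] by simp
  then show "\<exists>N. \<forall>n\<ge>N. I n = I N" by blast
qed

text \<open>For a prime \<open>Q\<close>, the largest two-sided ideal of \<open>T\<close> that
  compresses into \<open>Q\<close>. It is the prime of \<open>T\<close> matching \<open>Q\<close> in
  the usual correspondence between primes of a corner and primes not containing its
  idempotent.\<close>

definition prime_lift :: "'a set \<Rightarrow> 'c set" where
  "prime_lift Q = {t \<in> carrier T. \<forall>r\<in>carrier T. \<forall>s\<in>carrier T. compress (r \<otimes> t \<otimes> s) \<in> Q}"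

lemma two_sided_prime_lift:
  assumes Q: "two_sided_prime Q B"
  shows "two_sided_prime (prime_lift Q) T"
  unfolding two_sided_prime_iff
proof (intro conjI ballI impI)
  note Q' = B.two_sided_primeD[OF Q]
  note Q'' = B.right_idealD[OF Q'(2)]
  show "ideal (prime_lift Q) T"
    unfolding ideal_iff right_ideal_iff
  proof (intro conjI ballI)
    show "prime_lift Q \<subseteq> carrier T" by (auto simp: prime_lift_def)
    show "\<zero> \<in> prime_lift Q" using Q''(2) by (simp add: prime_lift_def compress_zero)
    show "x \<oplus> y \<in> prime_lift Q" if "x \<in> prime_lift Q" "y \<in> prime_lift Q" for x y
      using that Q''(3) by (auto simp: prime_lift_def r_distr l_distr compress_add)
    show "x \<otimes> r \<in> prime_lift Q" if xr: "x \<in> prime_lift Q" "r \<in> carrier T" for x r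
    proof -
      have "u \<otimes> (x \<otimes> r) \<otimes> s = u \<otimes> x \<otimes> (r \<otimes> s)" if "u \<in> carrier T" "s \<in> carrier T" for u s
        using that xr by (simp add: prime_lift_def m_assoc)
      then show ?thesis using xr by (simp add: prime_lift_def)
    qed
    show "r \<otimes> x \<in> prime_lift Q" if xr: "x \<in> prime_lift Q" "r \<in> carrier T" for x r
    proof -
      have "u \<otimes> (r \<otimes> x) \<otimes> s = (u \<otimes> r) \<otimes> x \<otimes> s" if "u \<in> carrier T" "s \<in> carrier T" for u s
        using that xr by (simp add: prime_lift_def m_assoc)
      then show ?thesis using xr by (simp add: prime_lift_def)
    qed
  qed
  show "\<one> \<notin> prime_lift Q"
  proof
    assume "\<one> \<in> prime_lift Q"
    then have "compress (\<epsilon> \<otimes> \<one> \<otimes> \<one>) \<in> Q"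
      using closed[OF B.one_closed] one_closed unfolding prime_lift_def by blast
    then show False using Q'(3) by (simp add: compress_psi)
  qed
  fix a b
  assume ab: "a \<in> carrier T" "b \<in> carrier T" "\<forall>c\<in>carrier T. a \<otimes> c \<otimes> b \<in> prime_lift Q"
  show "a \<in> prime_lift Q \<or> b \<in> prime_lift Q"
  proof (rule ccontr)
    assume "\<not> ?thesis"
    then obtain r s r' s' where rs: "r \<in> carrier T" "s \<in> carrier T" "r' \<in> carrier T" "s' \<in> carrier T"
      "compress (r \<otimes> a \<otimes> s) \<notin> Q" "compress (r' \<otimes> b \<otimes> s') \<notin> Q"
      using ab by (auto simp: prime_lift_def)
    let ?x = "compress (r \<otimes> a \<otimes> s)" and ?y = "compress (r' \<otimes> b \<otimes> s')"
    have x: "?x \<in> carrier B - Q" "\<psi> ?x = \<epsilon> \<otimes> (r \<otimes> a \<otimes> s) \<otimes> \<epsilon>"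
      and y: "?y \<in> carrier B - Q" "\<psi> ?y = \<epsilon> \<otimes> (r' \<otimes> b \<otimes> s') \<otimes> \<epsilon>"
      using rs ab compress by simp_all
    obtain z where z: "z \<in> carrier B" "?x \<otimes>\<^bsub>B\<^esub> z \<otimes>\<^bsub>B\<^esub> ?y \<notin> Q"
      using Q'(5)[OF x(1) y(1)] by blast
    \<comment> \<open>The factor inserted between \<open>a\<close> and \<open>b\<close> carries
      \<open>\<epsilon>\<close> on both sides of \<open>\<psi> z\<close>, so that the compressed
      product splits into three factors in \<open>B\<close>.\<close>
    have "compress (r \<otimes> (a \<otimes> (s \<otimes> \<epsilon> \<otimes> \<psi> z \<otimes> \<epsilon> \<otimes> r') \<otimes> b) \<otimes> s') = ?x \<otimes>\<^bsub>B\<^esub> z \<otimes>\<^bsub>B\<^esub> ?y"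
      using x y z rs ab(1,2) by (intro compressI) (simp_all add: mult m_assoc corner_assoc)
    moreover have "compress (r \<otimes> (a \<otimes> (s \<otimes> \<epsilon> \<otimes> \<psi> z \<otimes> \<epsilon> \<otimes> r') \<otimes> b) \<otimes> s') \<in> Q"
    proof -
      have "a \<otimes> (s \<otimes> \<epsilon> \<otimes> \<psi> z \<otimes> \<epsilon> \<otimes> r') \<otimes> b \<in> prime_lift Q"
        using ab(3) rs z by simp
      then show ?thesis using rs by (simp add: prime_lift_def)
    qed
    ultimately show False using z by simp
  qed
qed

text \<open>Essentiality of \<open>E\<close> modulo \<open>Q\<close> passes to \<open>lift E\<close>
  modulo \<open>prime_lift Q\<close>. Boundedness of \<open>T\<close> then gives t outside
  \<open>prime_lift Q\<close> with all left multiples in \<open>lift E\<close>; some compression of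
  r t s is outside \<open>Q\<close> and is the element wanted in \<open>B\<close>.\<close>

lemma bounded_mod_corner:
  assumes Q: "two_sided_prime Q B" and bounded: "bounded_mod (prime_lift Q)"
  shows "B.bounded_mod Q"
  unfolding B.bounded_mod_def
proof (intro allI impI, elim conjE)
  fix E
  assume E: "right_ideal E B" "Q \<subseteq> E"
    and ess: "\<forall>x\<in>carrier B - Q. \<exists>r\<in>carrier B. x \<otimes>\<^bsub>B\<^esub> r \<in> E - Q"
  note E' = B.right_idealD[OF E(1)]
  have "right_ideal (lift E) T" by (rule right_ideal_lift[OF E(1)])
  moreover have "prime_lift Q \<subseteq> lift Q"
  proof
    fix t assume t: "t \<in> prime_lift Q"
    then have "compress (\<one> \<otimes> t \<otimes> s) \<in> Q" if "s \<in> carrier T" for s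
      using that t one_closed unfolding prime_lift_def by blast
    with t show "t \<in> lift Q" by (simp add: lift_def prime_lift_def)
  qed
  then have "prime_lift Q \<subseteq> lift E" using lift_mono[OF E(2)] by blast
  moreover have "\<exists>s\<in>carrier T. g \<otimes> s \<in> lift E - prime_lift Q" if g: "g \<in> carrier T - prime_lift Q" for g
  \<comment> \<open>If \<open>g\<close> is in \<open>lift Q\<close>, it is already in
    \<open>lift E\<close> and s = 1 works. Otherwise some compression of a right multiple of
    \<open>g\<close> is outside \<open>Q\<close>, and essentiality of \<open>E\<close> can be used
    in \<open>B\<close>.\<close>
  proof (cases "g \<in> lift Q")
    case True
    then show ?thesis using g lift_mono[OF E(2)] by (intro bexI[of _ \<one>]) auto
  next
    case False
    then obtain s0 where s0: "s0 \<in> carrier T" "compress (g \<otimes> s0) \<notin> Q"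
      using g by (auto simp: lift_def)
    let ?x = "compress (g \<otimes> s0)"
    have x: "?x \<in> carrier B" using compress g s0 by simp
    then obtain b where b: "b \<in> carrier B" "?x \<otimes>\<^bsub>B\<^esub> b \<in> E - Q" using ess s0 by blast
    have "compress (g \<otimes> (s0 \<otimes> \<psi> b) \<otimes> s) = ?x \<otimes>\<^bsub>B\<^esub> b \<otimes>\<^bsub>B\<^esub> compress s" if s: "s \<in> carrier T" for s
    proof -
      have "compress (g \<otimes> s0 \<otimes> \<psi> (b \<otimes>\<^bsub>B\<^esub> compress s)) = ?x \<otimes>\<^bsub>B\<^esub> (b \<otimes>\<^bsub>B\<^esub> compress s)"
        using g s0 b compress s by (simp add: compress_mult)
      moreover have "compress (g \<otimes> (s0 \<otimes> \<psi> b) \<otimes> s) = compress (g \<otimes> s0 \<otimes> \<psi> (b \<otimes>\<^bsub>B\<^esub> compress s))"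
        using g s0 b s compress by (intro compressI) (simp_all add: mult m_assoc corner_assoc)
      ultimately show ?thesis using x b compress s by (simp add: B.m_assoc)
    qed
    note * = this
    have "g \<otimes> (s0 \<otimes> \<psi> b) \<in> lift E"
      using g s0 b * E'(4) compress by (simp add: lift_def)
    moreover have "g \<otimes> (s0 \<otimes> \<psi> b) \<notin> prime_lift Q"
    proof
      assume "g \<otimes> (s0 \<otimes> \<psi> b) \<in> prime_lift Q"
      \<comment> \<open>Multiplying by \<open>\<epsilon>\<close> on the right makes the compression
        return the element of \<open>E\<close> outside \<open>Q\<close> itself.\<close>
      then have "compress (\<one> \<otimes> (g \<otimes> (s0 \<otimes> \<psi> b)) \<otimes> \<epsilon>) \<in> Q"
        using closed[OF B.one_closed] one_closed unfolding prime_lift_def by blast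
      then have "?x \<otimes>\<^bsub>B\<^esub> b \<otimes>\<^bsub>B\<^esub> compress \<epsilon> \<in> Q"
        using *[of \<epsilon>] g s0 b by simp
      then show False using b x by (simp add: compress_psi)
    qed
    ultimately show ?thesis using s0 b by (intro bexI[of _ "s0 \<otimes> \<psi> b"]) auto
  qed
  ultimately have "\<exists>t\<in>carrier T - prime_lift Q. \<forall>r\<in>carrier T. r \<otimes> t \<in> lift E"
    using bounded[unfolded bounded_mod_def, rule_format, of "lift E"] by simp
  then obtain t where t: "t \<in> carrier T" "t \<notin> prime_lift Q" "\<And>r. r \<in> carrier T \<Longrightarrow> r \<otimes> t \<in> lift E"
    by blast
  then obtain r s where rs: "r \<in> carrier T" "s \<in> carrier T" "compress (r \<otimes> t \<otimes> s) \<notin> Q"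
    by (auto simp: prime_lift_def)
  have "b \<otimes>\<^bsub>B\<^esub> compress (r \<otimes> t \<otimes> s) \<in> E" if b: "b \<in> carrier B" for b
  proof -
    have "(\<psi> b \<otimes> r) \<otimes> t \<in> lift E" using t(3) b rs by simp
    then have "compress ((\<psi> b \<otimes> r) \<otimes> t \<otimes> s) \<in> E" using rs by (simp add: lift_def)
    moreover have "(\<psi> b \<otimes> r) \<otimes> t \<otimes> s = \<psi> b \<otimes> (r \<otimes> t \<otimes> s)"
      using b rs t by (simp add: m_assoc)
    ultimately show ?thesis using b rs t by (simp add: compress_mult)
  qed
  then show "\<exists>x\<in>carrier B - Q. \<forall>r\<in>carrier B. r \<otimes>\<^bsub>B\<^esub> x \<in> E"
    using rs t compress by (intro bexI[of _ "compress (r \<otimes> t \<otimes> s)"]) simp_all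
qed

theorem right_FBN_corner:
  assumes "right_FBN T"
  shows "right_FBN B"
  using assms right_noetherian_corner bounded_mod_corner two_sided_prime_lift
  by (simp add: right_FBN_def right_fully_bounded_iff B.right_fully_bounded_iff)

end

section \<open>Tensor products\<close>

definition frag_eval :: "('b, 'm) ring_scheme \<Rightarrow> ('s \<Rightarrow> 'a \<Rightarrow> 'b) \<Rightarrow> ('s \<times> 'a \<Rightarrow>\<^sub>0 int) \<Rightarrow> 'b" where
  "frag_eval G f c = finsum G (\<lambda>p. add_pow G (Poly_Mapping.lookup c p) (f (fst p) (snd p))) (Poly_Mapping.keys c)"

text \<open>Multiplicative form, to be instantiated at additive groups. Both sums are first extended
  to the union of the supports, because keys of c + d may cancel.\<close>

lemma (in comm_group) finprod_frag_add:
  fixes c d :: "'c \<Rightarrow>\<^sub>0 int"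
  assumes g: "\<And>p. p \<in> U \<Longrightarrow> g p \<in> carrier G" and cd: "Poly_Mapping.keys c \<subseteq> U" "Poly_Mapping.keys d \<subseteq> U"
  shows "finprod G (\<lambda>p. g p [^] Poly_Mapping.lookup (c + d) p) (Poly_Mapping.keys (c + d)) =
    finprod G (\<lambda>p. g p [^] Poly_Mapping.lookup c p) (Poly_Mapping.keys c) \<otimes>
    finprod G (\<lambda>p. g p [^] Poly_Mapping.lookup d p) (Poly_Mapping.keys d)"
proof -
  let ?A = "Poly_Mapping.keys c \<union> Poly_Mapping.keys d"
  have ext: "finprod G (\<lambda>p. g p [^] Poly_Mapping.lookup x p) (Poly_Mapping.keys x) =
      finprod G (\<lambda>p. g p [^] Poly_Mapping.lookup x p) ?A"
    if "Poly_Mapping.keys x \<subseteq> ?A" for x :: "'c \<Rightarrow>\<^sub>0 int"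
    using that g cd by (intro finprod_mono_neutral_cong_left) (auto simp: not_in_keys_iff_lookup_eq_zero)
  have gA: "g p \<in> carrier G" if "p \<in> ?A" for p
    using that g cd by blast
  have "finprod G (\<lambda>p. g p [^] Poly_Mapping.lookup (c + d) p) ?A =
      finprod G (\<lambda>p. g p [^] Poly_Mapping.lookup c p \<otimes> g p [^] Poly_Mapping.lookup d p) ?A"
    using gA by (intro finprod_cong') (auto simp: lookup_add int_pow_mult)
  also have "\<dots> = finprod G (\<lambda>p. g p [^] Poly_Mapping.lookup c p) ?A \<otimes>
      finprod G (\<lambda>p. g p [^] Poly_Mapping.lookup d p) ?A"
    using gA by (intro finprod_multf) auto
  finally show ?thesis
    by (simp add: ext[OF keys_add] ext[of c] ext[of d])
qed

context abelian_group
begin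

lemma frag_eval_cong:
  assumes "\<And>x y. (x, y) \<in> Poly_Mapping.keys c \<Longrightarrow> f x y \<in> carrier G"
    "\<And>x y. (x, y) \<in> Poly_Mapping.keys c \<Longrightarrow> f x y = g x y"
  shows "frag_eval G f c = frag_eval G g c"
  unfolding frag_eval_def using assms by (intro finsum_cong') auto

lemma frag_eval_closed [intro]:
  assumes "\<And>x y. (x, y) \<in> Poly_Mapping.keys c \<Longrightarrow> f x y \<in> carrier G"
  shows "frag_eval G f c \<in> carrier G"
  unfolding frag_eval_def using assms by (intro finsum_closed) auto

lemma frag_eval_zero [simp]: "frag_eval G f 0 = \<zero>"
  by (simp add: frag_eval_def)

lemma frag_eval_of [simp]: "f x y \<in> carrier G \<Longrightarrow> frag_eval G f (frag_of (x, y)) = f x y"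
  by (simp add: frag_eval_def)

lemma frag_eval_add:
  assumes "\<And>x y. (x, y) \<in> U \<Longrightarrow> f x y \<in> carrier G" "Poly_Mapping.keys c \<subseteq> U" "Poly_Mapping.keys d \<subseteq> U"
  shows "frag_eval G f (c + d) = frag_eval G f c \<oplus> frag_eval G f d"
  using add.finprod_frag_add[of U "\<lambda>p. f (fst p) (snd p)" c d] assms
  by (auto simp: frag_eval_def)

lemma frag_eval_diff:
  assumes "\<And>x y. (x, y) \<in> U \<Longrightarrow> f x y \<in> carrier G" "Poly_Mapping.keys c \<subseteq> U" "Poly_Mapping.keys d \<subseteq> U"
  shows "frag_eval G f (c - d) = frag_eval G f c \<ominus> frag_eval G f d"
proof -
  have cd: "Poly_Mapping.keys (c - d) \<subseteq> U"
    using keys_diff[of c d] assms by blast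
  have carr: "frag_eval G f x \<in> carrier G" if "Poly_Mapping.keys x \<subseteq> U" for x
    using that assms(1) by blast
  have "frag_eval G f (c - d) \<oplus> frag_eval G f d = frag_eval G f c"
    using frag_eval_add[OF assms(1) cd assms(3)] by simp
  then have "frag_eval G f c \<ominus> frag_eval G f d = (frag_eval G f (c - d) \<oplus> frag_eval G f d) \<ominus> frag_eval G f d"
    by simp
  also have "\<dots> = frag_eval G f (c - d)"
    using carr[OF cd] carr[OF assms(3)] by (simp add: minus_eq a_assoc r_neg)
  finally show ?thesis by simp
qed

lemma frag_eval_in:
  assumes "\<zero> \<in> W" "\<And>x y. x \<in> W \<Longrightarrow> y \<in> W \<Longrightarrow> x \<ominus> y \<in> W" "W \<subseteq> carrier G"
    and "\<And>x y. (x, y) \<in> Poly_Mapping.keys c \<Longrightarrow> f x y \<in> W"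
  shows "frag_eval G f c \<in> W"
proof -
  define U where "U = Poly_Mapping.keys c"
  have f: "f x y \<in> W" if "(x, y) \<in> U" for x y
    using assms(4) that by (simp add: U_def)
  have "Poly_Mapping.keys c \<subseteq> U" by (simp add: U_def)
  then show ?thesis
  proof (induction c rule: free_Abelian_group_induct[consumes 1, case_names zero diff one])
    case (diff a b)
    then show ?case
      using assms(2,3) f frag_eval_diff[of U f a b] by (simp add: subset_iff)
  next
    case (one p)
    then show ?case using assms(3) f by (cases p) (simp add: subset_iff)
  qed (use assms(1) in simp)
qed

lemma frag_eval_fun_add:
  assumes "\<And>x y. (x, y) \<in> Poly_Mapping.keys c \<Longrightarrow> f x y \<in> carrier G"
    "\<And>x y. (x, y) \<in> Poly_Mapping.keys c \<Longrightarrow> g x y \<in> carrier G"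
  shows "frag_eval G (\<lambda>x y. f x y \<oplus> g x y) c = frag_eval G f c \<oplus> frag_eval G g c"
proof -
  have *: "[k] \<cdot> (u \<oplus> v) = [k] \<cdot> u \<oplus> [k] \<cdot> v" if "u \<in> carrier G" "v \<in> carrier G" for u v and k :: int
    using add.int_pow_mult_distrib[OF a_comm[OF that] that] .
  have "frag_eval G (\<lambda>x y. f x y \<oplus> g x y) c =
      (\<Oplus>p\<in>Poly_Mapping.keys c. [Poly_Mapping.lookup c p] \<cdot> f (fst p) (snd p) \<oplus>
         [Poly_Mapping.lookup c p] \<cdot> g (fst p) (snd p))"
    unfolding frag_eval_def using assms by (intro finsum_cong') (auto simp: *)
  also have "\<dots> = frag_eval G f c \<oplus> frag_eval G g c"
    unfolding frag_eval_def using assms by (intro finsum_addf) auto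
  finally show ?thesis .
qed

end

lemma additive_diff:
  assumes "abelian_group G" "abelian_group H"
    and h: "\<And>x. x \<in> carrier G \<Longrightarrow> h x \<in> carrier H"
      "\<And>x y. x \<in> carrier G \<Longrightarrow> y \<in> carrier G \<Longrightarrow> h (x \<oplus>\<^bsub>G\<^esub> y) = h x \<oplus>\<^bsub>H\<^esub> h y"
  shows "h \<zero>\<^bsub>G\<^esub> = \<zero>\<^bsub>H\<^esub>"
    "\<And>x y. x \<in> carrier G \<Longrightarrow> y \<in> carrier G \<Longrightarrow> h (x \<ominus>\<^bsub>G\<^esub> y) = h x \<ominus>\<^bsub>H\<^esub> h y"
proof -
  interpret G: abelian_group G by fact
  interpret H: abelian_group H by fact
  have "h \<zero>\<^bsub>G\<^esub> \<oplus>\<^bsub>H\<^esub> h \<zero>\<^bsub>G\<^esub> = h \<zero>\<^bsub>G\<^esub>"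
    using h(2)[of "\<zero>\<^bsub>G\<^esub>" "\<zero>\<^bsub>G\<^esub>"] by simp
  then show "h \<zero>\<^bsub>G\<^esub> = \<zero>\<^bsub>H\<^esub>"
    using h(1) by simp
  fix x y assume xy: "x \<in> carrier G" "y \<in> carrier G"
  have "h (x \<ominus>\<^bsub>G\<^esub> y) \<oplus>\<^bsub>H\<^esub> h y = h (x \<ominus>\<^bsub>G\<^esub> y \<oplus>\<^bsub>G\<^esub> y)"
    using xy h(2) by simp
  also have "x \<ominus>\<^bsub>G\<^esub> y \<oplus>\<^bsub>G\<^esub> y = x"
    using xy by (simp add: G.minus_eq G.a_assoc G.l_neg)
  finally have "h x \<ominus>\<^bsub>H\<^esub> h y = (h (x \<ominus>\<^bsub>G\<^esub> y) \<oplus>\<^bsub>H\<^esub> h y) \<ominus>\<^bsub>H\<^esub> h y"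
    by simp
  also have "\<dots> = h (x \<ominus>\<^bsub>G\<^esub> y)"
    using xy h(1) by (simp add: H.minus_eq H.a_assoc H.r_neg)
  finally show "h (x \<ominus>\<^bsub>G\<^esub> y) = h x \<ominus>\<^bsub>H\<^esub> h y" by simp
qed

lemma frag_eval_hom:
  assumes G: "abelian_group G" and H: "abelian_group H"
    and h: "\<And>x. x \<in> carrier G \<Longrightarrow> h x \<in> carrier H"
      "\<And>x y. x \<in> carrier G \<Longrightarrow> y \<in> carrier G \<Longrightarrow> h (x \<oplus>\<^bsub>G\<^esub> y) = h x \<oplus>\<^bsub>H\<^esub> h y"
    and f: "\<And>x y. (x, y) \<in> Poly_Mapping.keys c \<Longrightarrow> f x y \<in> carrier G"
  shows "h (frag_eval G f c) = frag_eval H (\<lambda>x y. h (f x y)) c"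
proof -
  interpret G: abelian_group G by fact
  interpret H: abelian_group H by fact
  note d = additive_diff[OF G H h]
  define U where "U = Poly_Mapping.keys c"
  have fU: "f x y \<in> carrier G" if "(x, y) \<in> U" for x y
    using f that by (simp add: U_def)
  have "Poly_Mapping.keys c \<subseteq> U" by (simp add: U_def)
  then show ?thesis
  proof (induction c rule: free_Abelian_group_induct[consumes 1, case_names zero diff one])
    case (diff a b)
    have "frag_eval G f x \<in> carrier G" if "Poly_Mapping.keys x \<subseteq> U" for x
      using that fU by blast
    with diff show ?case
      using G.frag_eval_diff[of U f a b] fU h(1) d(2)
        H.frag_eval_diff[of U "\<lambda>x y. h (f x y)" a b] by simp
  next
    case (one p)
    then show ?case using fU h(1) by (cases p) simp
  qed (use d(1) in simp)
qed

text \<open>The last three clauses say that the induced map on formal sums kills the three families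
  of generators of \<open>tensor_relations\<close>.\<close>

definition balanced ::
  "('k, 'c) ring_scheme \<Rightarrow> ('k, 's, 'm) module_scheme \<Rightarrow> ('k, 'a, 'n) module_scheme
    \<Rightarrow> ('b, 'r) ring_scheme \<Rightarrow> ('s \<Rightarrow> 'a \<Rightarrow> 'b) \<Rightarrow> bool" where
  "balanced K S A G f \<longleftrightarrow>
     (\<forall>x\<in>carrier S. \<forall>y\<in>carrier A. f x y \<in> carrier G) \<and>
     (\<forall>x\<in>carrier S. \<forall>x'\<in>carrier S. \<forall>y\<in>carrier A. f (x \<oplus>\<^bsub>S\<^esub> x') y = f x y \<oplus>\<^bsub>G\<^esub> f x' y) \<and>
     (\<forall>x\<in>carrier S. \<forall>y\<in>carrier A. \<forall>y'\<in>carrier A. f x (y \<oplus>\<^bsub>A\<^esub> y') = f x y \<oplus>\<^bsub>G\<^esub> f x y') \<and>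
     (\<forall>c\<in>carrier K. \<forall>x\<in>carrier S. \<forall>y\<in>carrier A. f (c \<odot>\<^bsub>S\<^esub> x) y = f x (c \<odot>\<^bsub>A\<^esub> y))"

lemma balancedD:
  assumes "balanced K S A G f"
  shows "\<And>x y. x \<in> carrier S \<Longrightarrow> y \<in> carrier A \<Longrightarrow> f x y \<in> carrier G"
    "\<And>x x' y. x \<in> carrier S \<Longrightarrow> x' \<in> carrier S \<Longrightarrow> y \<in> carrier A \<Longrightarrow> f (x \<oplus>\<^bsub>S\<^esub> x') y = f x y \<oplus>\<^bsub>G\<^esub> f x' y"
    "\<And>x y y'. x \<in> carrier S \<Longrightarrow> y \<in> carrier A \<Longrightarrow> y' \<in> carrier A \<Longrightarrow> f x (y \<oplus>\<^bsub>A\<^esub> y') = f x y \<oplus>\<^bsub>G\<^esub> f x y'"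
    "\<And>c x y. c \<in> carrier K \<Longrightarrow> x \<in> carrier S \<Longrightarrow> y \<in> carrier A \<Longrightarrow> f (c \<odot>\<^bsub>S\<^esub> x) y = f x (c \<odot>\<^bsub>A\<^esub> y)"
  using assms unfolding balanced_def by blast+

lemma frag_cmul_diff_distrib2: "frag_cmul k (a - b) = frag_cmul k a - frag_cmul k b"
proof -
  have "frag_cmul k (a - b) + frag_cmul k b = frag_cmul k a"
    by (simp flip: frag_cmul_distrib2)
  then show ?thesis
    by (simp add: eq_diff_eq)
qed

lemma frag_extend_fun_diff:
  "frag_extend (\<lambda>x. f x - g x) c = frag_extend f c - frag_extend g c"
  by (simp add: frag_extend_def sum_subtractf frag_cmul_diff_distrib2)

lemma keys_frag_diff:
  "Poly_Mapping.keys (frag_of a - frag_of b) \<subseteq> {a, b}"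
  "Poly_Mapping.keys (frag_of a - frag_of b - frag_of c) \<subseteq> {a, b, c}"
proof -
  show *: "Poly_Mapping.keys (frag_of a - frag_of b) \<subseteq> {a, b}"
    using keys_diff[of "frag_of a" "frag_of b"] unfolding keys_frag_of by blast
  show "Poly_Mapping.keys (frag_of a - frag_of b - frag_of c) \<subseteq> {a, b, c}"
    using keys_diff[of "frag_of a - frag_of b" "frag_of c"] *
    unfolding keys_frag_of by blast
qed

section \<open>The tensor product ring and its universal property\<close>

locale tensor_product = S: assoc_algebra K S + A: assoc_algebra K A for K S A
begin

abbreviation pairs where "pairs \<equiv> carrier S \<times> carrier A"
abbreviation P where "P \<equiv> pair_ring S A"
abbreviation Rel where "Rel \<equiv> tensor_relations K S A"
abbreviation T where "T \<equiv> tensor_algebra K S A"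
abbreviation pure (infixl "\<otimes>\<otimes>" 75) where "x \<otimes>\<otimes> y \<equiv> pure_tensor K S A x y"

lemma carrier_pair_ring: "c \<in> carrier P \<longleftrightarrow> Poly_Mapping.keys c \<subseteq> pairs"
  by (simp add: pair_ring_def)

lemma pair_ring_simps [simp]:
  "c \<oplus>\<^bsub>P\<^esub> d = c + d" "\<zero>\<^bsub>P\<^esub> = 0" "\<one>\<^bsub>P\<^esub> = frag_of (\<one>\<^bsub>S\<^esub>, \<one>\<^bsub>A\<^esub>)"
  by (simp_all add: pair_ring_def)

lemma pair_mult_of [simp]:
  "frag_of (x, y) \<otimes>\<^bsub>P\<^esub> frag_of (x', y') = frag_of (x \<otimes>\<^bsub>S\<^esub> x', y \<otimes>\<^bsub>A\<^esub> y')"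
  by (simp add: pair_ring_def)

lemma pair_mult_diff [simp]:
  "(c - c') \<otimes>\<^bsub>P\<^esub> d = c \<otimes>\<^bsub>P\<^esub> d - c' \<otimes>\<^bsub>P\<^esub> d"
  "c \<otimes>\<^bsub>P\<^esub> (d - d') = c \<otimes>\<^bsub>P\<^esub> d - c \<otimes>\<^bsub>P\<^esub> d'"
  by (simp_all add: pair_ring_def frag_extend_diff frag_extend_fun_diff)

lemma pair_mult_zero [simp]: "0 \<otimes>\<^bsub>P\<^esub> d = 0" "c \<otimes>\<^bsub>P\<^esub> 0 = 0"
  using pair_mult_diff(1)[of 0 0 d] pair_mult_diff(2)[of c 0 0] by simp_all

lemma pair_mult_minus [simp]: "(- c) \<otimes>\<^bsub>P\<^esub> d = - (c \<otimes>\<^bsub>P\<^esub> d)" "c \<otimes>\<^bsub>P\<^esub> (- d) = - (c \<otimes>\<^bsub>P\<^esub> d)"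
  using pair_mult_diff(1)[of 0 c d] pair_mult_diff(2)[of c 0 d] by simp_all

lemma pair_mult_add [simp]:
  "(c + c') \<otimes>\<^bsub>P\<^esub> d = c \<otimes>\<^bsub>P\<^esub> d + c' \<otimes>\<^bsub>P\<^esub> d"
  "c \<otimes>\<^bsub>P\<^esub> (d + d') = c \<otimes>\<^bsub>P\<^esub> d + c \<otimes>\<^bsub>P\<^esub> d'"
  using pair_mult_diff(1)[of c "- c'" d] pair_mult_diff(2)[of c d "- d'"] by simp_all

lemma pair_mult_closed:
  assumes "c \<in> carrier P" "d \<in> carrier P"
  shows "c \<otimes>\<^bsub>P\<^esub> d \<in> carrier P"
proof -
  note cd = assms[unfolded carrier_pair_ring]
  have 1: "Poly_Mapping.keys (frag_extend (\<lambda>q. frag_of (fst p \<otimes>\<^bsub>S\<^esub> fst q, snd p \<otimes>\<^bsub>A\<^esub> snd q)) d) \<subseteq> pairs"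
    if "p \<in> pairs" for p
    by (rule order_trans[OF keys_frag_extend UN_least]) (use that cd(2) in auto)
  have "Poly_Mapping.keys (c \<otimes>\<^bsub>P\<^esub> d) \<subseteq> pairs"
    unfolding pair_ring_def monoid.simps
    by (rule order_trans[OF keys_frag_extend UN_least], rule 1) (use cd(1) in blast)
  then show ?thesis by (simp add: carrier_pair_ring)
qed

text \<open>\<open>P\<close> is the integral monoid ring of the product of the two multiplicative
  monoids; by trilinearity basis elements suffice.\<close>

lemma pair_mult_assoc:
  assumes "a \<in> carrier P" "b \<in> carrier P" "c \<in> carrier P"
  shows "a \<otimes>\<^bsub>P\<^esub> b \<otimes>\<^bsub>P\<^esub> c = a \<otimes>\<^bsub>P\<^esub> (b \<otimes>\<^bsub>P\<^esub> c)"
  using assms(1)[unfolded carrier_pair_ring]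
proof (induction a rule: frag_induction)
  case a: (one p)
  show ?case
    using assms(2)[unfolded carrier_pair_ring]
  proof (induction b rule: frag_induction)
    case b: (one q)
    show ?case
      using assms(3)[unfolded carrier_pair_ring]
    proof (induction c rule: frag_induction)
      case (one r)
      then show ?case
        using a b by (cases p; cases q; cases r) (simp add: S.m_assoc A.m_assoc)
    qed simp_all
  qed simp_all
qed simp_all

lemma pair_one:
  assumes "c \<in> carrier P"
  shows "\<one>\<^bsub>P\<^esub> \<otimes>\<^bsub>P\<^esub> c = c" "c \<otimes>\<^bsub>P\<^esub> \<one>\<^bsub>P\<^esub> = c"
proof -
  have "\<one>\<^bsub>P\<^esub> \<otimes>\<^bsub>P\<^esub> c = c \<and> c \<otimes>\<^bsub>P\<^esub> \<one>\<^bsub>P\<^esub> = c"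
    using assms[unfolded carrier_pair_ring]
    by (induction c rule: frag_induction) auto
  then show "\<one>\<^bsub>P\<^esub> \<otimes>\<^bsub>P\<^esub> c = c" "c \<otimes>\<^bsub>P\<^esub> \<one>\<^bsub>P\<^esub> = c" by blast+
qed

lemma ring_pair_ring: "ring P"
proof (rule ringI)
  show "abelian_group P"
  proof (rule abelian_groupI)
    show "\<exists>d\<in>carrier P. d \<oplus>\<^bsub>P\<^esub> c = \<zero>\<^bsub>P\<^esub>" if "c \<in> carrier P" for c
      using that by (intro bexI[of _ "- c"]) (simp_all add: carrier_pair_ring)
    show "c \<oplus>\<^bsub>P\<^esub> d \<in> carrier P" if "c \<in> carrier P" "d \<in> carrier P" for c d
      using that keys_add[of c d] unfolding carrier_pair_ring pair_ring_simps by blast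
  qed (simp_all add: carrier_pair_ring add_ac)
  show "Group.monoid P"
  proof (rule monoidI)
    show "\<one>\<^bsub>P\<^esub> \<in> carrier P"
      by (simp add: carrier_pair_ring)
  qed (use pair_mult_closed pair_mult_assoc pair_one in auto)
qed simp_all

sublocale P: ring P by (rule ring_pair_ring)

lemma Rel_gens:
  "x \<in> carrier S \<Longrightarrow> x' \<in> carrier S \<Longrightarrow> y \<in> carrier A \<Longrightarrow>
     frag_of (x \<oplus>\<^bsub>S\<^esub> x', y) - frag_of (x, y) - frag_of (x', y) \<in> Rel"
  "x \<in> carrier S \<Longrightarrow> y \<in> carrier A \<Longrightarrow> y' \<in> carrier A \<Longrightarrow>
     frag_of (x, y \<oplus>\<^bsub>A\<^esub> y') - frag_of (x, y) - frag_of (x, y') \<in> Rel"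
  "c \<in> carrier K \<Longrightarrow> x \<in> carrier S \<Longrightarrow> y \<in> carrier A \<Longrightarrow>
     frag_of (c \<odot>\<^bsub>S\<^esub> x, y) - frag_of (x, c \<odot>\<^bsub>A\<^esub> y) \<in> Rel"
  unfolding tensor_relations_def by (rule generate.incl; blast)+

lemma Rel_closed:
  "0 \<in> Rel" "c \<in> Rel \<Longrightarrow> d \<in> Rel \<Longrightarrow> c + d \<in> Rel"
  using generate.one[of "free_Abelian_group pairs"] generate.eng[of c "free_Abelian_group pairs" _ d]
  by (simp_all add: tensor_relations_def)

text \<open>Reduces statements about \<open>Rel\<close> to the three families of generators, both
  for the ideal property and for the well-definedness of \<open>tensor_eval\<close>.\<close>

lemma Rel_induct [consumes 1, case_names zero left right scalar add minus]:
  assumes "c \<in> Rel" "Pr 0"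
    and "\<And>x x' y. x \<in> carrier S \<Longrightarrow> x' \<in> carrier S \<Longrightarrow> y \<in> carrier A \<Longrightarrow>
       Pr (frag_of (x \<oplus>\<^bsub>S\<^esub> x', y) - frag_of (x, y) - frag_of (x', y))"
    and "\<And>x y y'. x \<in> carrier S \<Longrightarrow> y \<in> carrier A \<Longrightarrow> y' \<in> carrier A \<Longrightarrow>
       Pr (frag_of (x, y \<oplus>\<^bsub>A\<^esub> y') - frag_of (x, y) - frag_of (x, y'))"
    and "\<And>a x y. a \<in> carrier K \<Longrightarrow> x \<in> carrier S \<Longrightarrow> y \<in> carrier A \<Longrightarrow>
       Pr (frag_of (a \<odot>\<^bsub>S\<^esub> x, y) - frag_of (x, a \<odot>\<^bsub>A\<^esub> y))"
    and add: "\<And>c d. c \<in> Rel \<Longrightarrow> d \<in> Rel \<Longrightarrow> Pr c \<Longrightarrow> Pr d \<Longrightarrow> Pr (c + d)"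
    and minus: "\<And>c. c \<in> Rel \<Longrightarrow> c \<in> carrier P \<Longrightarrow> Pr c \<Longrightarrow> Pr (- c)"
  shows "Pr c"
proof -
  let ?gens = "{frag_of (x \<oplus>\<^bsub>S\<^esub> x', y) - frag_of (x, y) - frag_of (x', y) | x x' y.
         x \<in> carrier S \<and> x' \<in> carrier S \<and> y \<in> carrier A} \<union>
      {frag_of (x, y \<oplus>\<^bsub>A\<^esub> y') - frag_of (x, y) - frag_of (x, y') | x y y'.
         x \<in> carrier S \<and> y \<in> carrier A \<and> y' \<in> carrier A} \<union>
      {frag_of (c \<odot>\<^bsub>S\<^esub> x, y) - frag_of (x, c \<odot>\<^bsub>A\<^esub> y) | c x y.
         c \<in> carrier K \<and> x \<in> carrier S \<and> y \<in> carrier A}"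
  have Rel: "Rel = generate (free_Abelian_group pairs) ?gens"
    by (simp add: tensor_relations_def)
  have gens: "Pr g \<and> Poly_Mapping.keys g \<subseteq> pairs" if "g \<in> ?gens" for g
    using that assms(3-5) by (fastforce dest: subsetD[OF keys_frag_diff(1)] subsetD[OF keys_frag_diff(2)])
  show ?thesis
    using assms(1)[unfolded Rel]
  proof induction
    case one
    then show ?case using assms(2) by simp
  next
    case (incl g)
    then show ?case using gens by blast
  next
    case (inv g)
    have "g \<in> Rel" unfolding Rel using inv by (rule generate.incl)
    with inv gens[OF inv] show ?case
      using minus[of g] by (simp add: carrier_pair_ring)
  next
    case (eng a b)
    then show ?case using add[of a b] by (simp add: Rel)
  qed
qed

lemma Rel_carrier: "c \<in> Rel \<Longrightarrow> c \<in> carrier P"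
proof (induction rule: Rel_induct)
  case (add c d)
  then show ?case using P.a_closed[of c d] by simp
qed (use keys_frag_diff in \<open>fastforce simp: carrier_pair_ring\<close>)+

lemma Rel_minus: "c \<in> Rel \<Longrightarrow> - c \<in> Rel"
proof -
  assume c: "c \<in> Rel"
  interpret group "free_Abelian_group pairs" by simp
  have "inv\<^bsub>free_Abelian_group pairs\<^esub> c \<in> Rel"
    using c unfolding tensor_relations_def
    by (intro generate_m_inv_closed)
      (fastforce dest: subsetD[OF keys_frag_diff(1)] subsetD[OF keys_frag_diff(2)])
  then show ?thesis
    using Rel_carrier[OF c] by (simp add: carrier_pair_ring)
qed

lemma Rel_diff: "c \<in> Rel \<Longrightarrow> d \<in> Rel \<Longrightarrow> c - d \<in> Rel"
  using Rel_closed(2)[of c "- d"] Rel_minus by simp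

text \<open>A pair times a generator is a generator of the same family: distributivity serves the
  first two, compatibility of scalars with products the third.\<close>

lemma Rel_mult_of:
  assumes u: "u \<in> carrier S" "v \<in> carrier A" and g: "g \<in> Rel"
  shows "frag_of (u, v) \<otimes>\<^bsub>P\<^esub> g \<in> Rel \<and> g \<otimes>\<^bsub>P\<^esub> frag_of (u, v) \<in> Rel"
  using g
proof (induction rule: Rel_induct)
  case (left x x' y)
  then show ?case
    using u Rel_gens(1)[of "u \<otimes>\<^bsub>S\<^esub> x" "u \<otimes>\<^bsub>S\<^esub> x'" "v \<otimes>\<^bsub>A\<^esub> y"]
      Rel_gens(1)[of "x \<otimes>\<^bsub>S\<^esub> u" "x' \<otimes>\<^bsub>S\<^esub> u" "y \<otimes>\<^bsub>A\<^esub> v"]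
    by (simp add: S.r_distr S.l_distr)
next
  case (right x y y')
  then show ?case
    using u Rel_gens(2)[of "u \<otimes>\<^bsub>S\<^esub> x" "v \<otimes>\<^bsub>A\<^esub> y" "v \<otimes>\<^bsub>A\<^esub> y'"]
      Rel_gens(2)[of "x \<otimes>\<^bsub>S\<^esub> u" "y \<otimes>\<^bsub>A\<^esub> v" "y' \<otimes>\<^bsub>A\<^esub> v"]
    by (simp add: A.r_distr A.l_distr)
next
  case (scalar a x y)
  then show ?case
    using u Rel_gens(3)[of a "u \<otimes>\<^bsub>S\<^esub> x" "v \<otimes>\<^bsub>A\<^esub> y"] Rel_gens(3)[of a "x \<otimes>\<^bsub>S\<^esub> u" "y \<otimes>\<^bsub>A\<^esub> v"]
    by (simp add: S.smult_mult_right A.smult_mult_right S.smult_mult_left A.smult_mult_left)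
next
  case (add c d)
  then show ?case using Rel_closed(2) by simp
next
  case (minus c)
  then show ?case using Rel_minus by simp
qed (use Rel_closed(1) in simp)

lemma Rel_mult:
  assumes r: "r \<in> carrier P" and g: "g \<in> Rel"
  shows "r \<otimes>\<^bsub>P\<^esub> g \<in> Rel \<and> g \<otimes>\<^bsub>P\<^esub> r \<in> Rel"
  using r[unfolded carrier_pair_ring]
proof (induction r rule: frag_induction)
  case (one p)
  then show ?case using Rel_mult_of[OF _ _ g] by (cases p) blast
next
  case (diff a b)
  then show ?case using Rel_diff by simp
qed (use Rel_closed(1) in simp)

lemma ideal_Rel: "ideal Rel P"
  using Rel_carrier Rel_closed Rel_mult
  unfolding P.ideal_iff P.right_ideal_iff by (simp add: subset_iff)

sublocale Rel: ideal Rel P by (rule ideal_Rel)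

sublocale T: ring T
  unfolding tensor_algebra_def by (rule Rel.quotient_is_ring)

definition coset where "coset = (+>\<^bsub>P\<^esub>) Rel"

lemma coset_hom: "coset \<in> ring_hom P T"
  unfolding tensor_algebra_def coset_def by (rule Rel.rcos_ring_hom)

lemma coset_surj: "coset ` carrier P = carrier T"
  unfolding tensor_algebra_def coset_def FactRing_def A_RCOSETS_def' by auto

lemma cosetE:
  assumes "t \<in> carrier T"
  obtains c where "c \<in> carrier P" "t = coset c"
proof -
  have "t \<in> coset ` carrier P" using assms by (simp only: coset_surj)
  then show thesis using that by blast
qed

lemma coset [simp]:
  "c \<in> carrier P \<Longrightarrow> coset c \<in> carrier T"
  "c \<in> carrier P \<Longrightarrow> d \<in> carrier P \<Longrightarrow> coset (c \<otimes>\<^bsub>P\<^esub> d) = coset c \<otimes>\<^bsub>T\<^esub> coset d"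
  "coset \<one>\<^bsub>P\<^esub> = \<one>\<^bsub>T\<^esub>"
  using ring_hom_closed[OF coset_hom] ring_hom_mult[OF coset_hom] ring_hom_one[OF coset_hom] by blast+

lemma coset_add:
  "c \<in> carrier P \<Longrightarrow> d \<in> carrier P \<Longrightarrow> coset (c + d) = coset c \<oplus>\<^bsub>T\<^esub> coset d"
  using ring_hom_add[OF coset_hom, of c d] by simp

lemma coset_zero: "coset 0 = \<zero>\<^bsub>T\<^esub>"
  using ring_hom_zero[OF coset_hom P.ring_axioms T.ring_axioms] by simp

lemma coset_diff:
  assumes "c \<in> carrier P" "d \<in> carrier P"
  shows "coset (c - d) = coset c \<ominus>\<^bsub>T\<^esub> coset d"
proof -
  have "c - d \<in> carrier P"
    using assms keys_diff[of c d] unfolding carrier_pair_ring by blast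
  then have "coset c = coset (c - d) \<oplus>\<^bsub>T\<^esub> coset d"
    using assms coset_add[of "c - d" d] by simp
  then show ?thesis
    using \<open>c - d \<in> carrier P\<close> assms by (simp add: T.add_diff_cancel)
qed

lemma coset_Rel: "c \<in> Rel \<Longrightarrow> coset c = \<zero>\<^bsub>T\<^esub>"
  using Rel.a_rcos_const[of c] by (simp add: coset_def tensor_algebra_def FactRing_def)

lemma mem_coset: "c' \<in> coset c \<longleftrightarrow> (\<exists>r\<in>Rel. c' = r + c)"
  by (auto simp: coset_def a_r_coset_def')

lemma self_mem_coset: "c \<in> coset c"
  using Rel_closed(1) by (force simp: mem_coset)

lemma pure_coset: "x \<otimes>\<otimes> y = coset (frag_of (x, y))"
  by (simp add: pure_tensor_def coset_def)

lemma frag_of_carrier [simp]: "frag_of (x, y) \<in> carrier P \<longleftrightarrow> x \<in> carrier S \<and> y \<in> carrier A"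
  by (simp add: carrier_pair_ring)

lemma balanced_pure: "balanced K S A T (\<otimes>\<otimes>)"
proof -
  have 3: "coset a = coset b \<oplus>\<^bsub>T\<^esub> coset c"
    if "a - b - c \<in> Rel" "a \<in> carrier P" "b \<in> carrier P" "c \<in> carrier P" for a b c
  proof -
    have "coset a = coset ((a - b - c) + (b + c))" by simp
    also have "\<dots> = coset (a - b - c) \<oplus>\<^bsub>T\<^esub> coset (b + c)"
      using that Rel_carrier P.a_closed[of b c] by (intro coset_add) simp_all
    finally show ?thesis
      using that by (simp add: coset_Rel coset_add)
  qed
  have 2: "coset a = coset b"
    if "a - b \<in> Rel" "a \<in> carrier P" "b \<in> carrier P" for a b
    using 3[of a b 0] that by (simp add: carrier_pair_ring coset_zero)
  show ?thesis
    unfolding balanced_def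
    by (intro conjI ballI; unfold pure_coset; (intro 2 3 Rel_gens)?; simp)
qed

lemmas pure_simps = balancedD[OF balanced_pure]

lemma pure_closed [simp]: "x \<in> carrier S \<Longrightarrow> y \<in> carrier A \<Longrightarrow> x \<otimes>\<otimes> y \<in> carrier T"
  by (rule pure_simps)

lemma pure_mult [simp]:
  "x \<in> carrier S \<Longrightarrow> y \<in> carrier A \<Longrightarrow> x' \<in> carrier S \<Longrightarrow> y' \<in> carrier A \<Longrightarrow>
   (x \<otimes>\<otimes> y) \<otimes>\<^bsub>T\<^esub> (x' \<otimes>\<otimes> y') = (x \<otimes>\<^bsub>S\<^esub> x') \<otimes>\<otimes> (y \<otimes>\<^bsub>A\<^esub> y')"
  unfolding pure_coset by (simp flip: coset(2))

lemma pure_one: "\<one>\<^bsub>S\<^esub> \<otimes>\<otimes> \<one>\<^bsub>A\<^esub> = \<one>\<^bsub>T\<^esub>"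
  unfolding pure_coset using coset(3) by simp

lemma tensor_induct [consumes 1, case_names pure diff]:
  assumes "t \<in> carrier T"
    and "\<And>x y. x \<in> carrier S \<Longrightarrow> y \<in> carrier A \<Longrightarrow> Pr (x \<otimes>\<otimes> y)"
    and "\<And>t u. t \<in> carrier T \<Longrightarrow> u \<in> carrier T \<Longrightarrow> Pr t \<Longrightarrow> Pr u \<Longrightarrow> Pr (t \<ominus>\<^bsub>T\<^esub> u)"
  shows "Pr t"
proof -
  obtain c where c: "c \<in> carrier P" "t = coset c"
    using assms(1) by (rule cosetE)
  have "Pr (coset c)"
    using c(1)[unfolded carrier_pair_ring]
  proof (induction c rule: free_Abelian_group_induct[consumes 1, case_names zero diff one])
    case zero
    \<comment> \<open>Zero is a difference of pure tensors, which is why the induction rule has no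
      case for it.\<close>
    have "(\<zero>\<^bsub>S\<^esub> \<otimes>\<otimes> \<zero>\<^bsub>A\<^esub>) \<ominus>\<^bsub>T\<^esub> (\<zero>\<^bsub>S\<^esub> \<otimes>\<otimes> \<zero>\<^bsub>A\<^esub>) = coset 0"
      by (simp add: coset_zero)
    then show ?case
      using assms(2,3) by (metis S.zero_closed A.zero_closed pure_closed)
  next
    case (diff c d)
    then show ?case
      using assms(3) by (simp add: coset_diff carrier_pair_ring)
  next
    case (one p)
    then show ?case
      using assms(2) by (cases p) (simp add: pure_coset)
  qed
  with c show ?thesis by simp
qed

text \<open>\<open>frag_eval\<close> is additive and vanishes on \<open>Rel\<close>, so it is
  constant on the coset and \<open>the_elem\<close> is applied to a singleton.\<close>

lemma tensor_eval_coset: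
  assumes G: "abelian_group G" and f: "balanced K S A G f" and c: "c \<in> carrier P"
  shows "tensor_eval G f (coset c) = frag_eval G f c"
proof -
  interpret G: abelian_group G by fact
  note f' = balancedD[OF f]
  have fU: "f x y \<in> carrier G" if "(x, y) \<in> pairs" for x y
    using f'(1) that by simp
  have diff: "frag_eval G f (a - b) = frag_eval G f a \<ominus>\<^bsub>G\<^esub> frag_eval G f b"
    if "a \<in> carrier P" "b \<in> carrier P" for a b
    using that fU G.frag_eval_diff[of pairs f a b] by (simp add: carrier_pair_ring)
  have add: "frag_eval G f (a + b) = frag_eval G f a \<oplus>\<^bsub>G\<^esub> frag_eval G f b"
    if "a \<in> carrier P" "b \<in> carrier P" for a b
    using that fU G.frag_eval_add[of pairs f a b] by (simp add: carrier_pair_ring)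
  have closed: "frag_eval G f a \<in> carrier G" if "a \<in> carrier P" for a
    using that fU unfolding carrier_pair_ring by blast
  have Pdiff: "a - b \<in> carrier P" if "a \<in> carrier P" "b \<in> carrier P" for a b
    using that keys_diff[of a b] unfolding carrier_pair_ring by blast
  have zero: "frag_eval G f r = \<zero>\<^bsub>G\<^esub>" if "r \<in> Rel" for r
    using that
  proof (induction rule: Rel_induct)
    case (left x x' y)
    then show ?case
      using f'(1,2) by (simp add: diff Pdiff G.minus_eq G.a_assoc G.r_neg G.minus_add G.a_ac)
  next
    case (right x y y')
    then show ?case
      using f'(1,3) by (simp add: diff Pdiff G.minus_eq G.a_assoc G.r_neg G.minus_add G.a_ac)
  next
    case (scalar a x y)
    then show ?case
      using f'(1,4) by (simp add: diff G.minus_eq G.r_neg)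
  next
    case (add c d)
    then show ?case
      using \<open>\<And>b a. a \<in> carrier P \<Longrightarrow> b \<in> carrier P \<Longrightarrow> frag_eval G f (a + b) = frag_eval G f a \<oplus>\<^bsub>G\<^esub> frag_eval G f b\<close>
      by (simp add: Rel_carrier)
  next
    case (minus c)
    then show ?case
      using diff[of 0 c] by (simp add: carrier_pair_ring G.minus_eq)
  qed simp
  have "frag_eval G f c' = frag_eval G f c" if "c' \<in> coset c" for c'
  proof -
    obtain r where "r \<in> Rel" "c' = r + c"
      using \<open>c' \<in> coset c\<close> by (auto simp: mem_coset)
    then show ?thesis
      using c closed[OF c] by (simp add: add zero Rel_carrier)
  qed
  then have "frag_eval G f ` coset c = {frag_eval G f c}"
    using self_mem_coset by blast
  then show ?thesis
    by (simp add: tensor_eval_def frag_eval_def[abs_def])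
qed

lemma tensor_eval_closed:
  assumes "abelian_group G" "balanced K S A G f" "t \<in> carrier T"
  shows "tensor_eval G f t \<in> carrier G"
proof -
  obtain c where "c \<in> carrier P" "t = coset c"
    using assms(3) by (rule cosetE)
  then show ?thesis
    using assms(1,2) balancedD(1)[OF assms(2)] abelian_group.frag_eval_closed[OF assms(1), of c f]
    by (auto simp: tensor_eval_coset carrier_pair_ring)
qed

lemma tensor_eval_add:
  assumes "abelian_group G" "balanced K S A G f" "t \<in> carrier T" "u \<in> carrier T"
  shows "tensor_eval G f (t \<oplus>\<^bsub>T\<^esub> u) = tensor_eval G f t \<oplus>\<^bsub>G\<^esub> tensor_eval G f u"
proof -
  obtain c where c: "c \<in> carrier P" "t = coset c" using assms(3) by (rule cosetE)
  obtain d where d: "d \<in> carrier P" "u = coset d" using assms(4) by (rule cosetE)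
  note cd = c d
  have "c + d \<in> carrier P"
    using P.a_closed[of c d] cd by simp
  then show ?thesis
    using cd assms(1,2) balancedD(1)[OF assms(2)] abelian_group.frag_eval_add[OF assms(1), of pairs f c d]
    by (simp add: tensor_eval_coset carrier_pair_ring flip: coset_add)
qed

lemma tensor_eval_pure:
  assumes "abelian_group G" "balanced K S A G f" "x \<in> carrier S" "y \<in> carrier A"
  shows "tensor_eval G f (x \<otimes>\<otimes> y) = f x y"
  using assms balancedD(1)[OF assms(2)] abelian_group.frag_eval_of[OF assms(1), of f x y]
  by (simp add: pure_coset tensor_eval_coset)

end

section \<open>Opposite algebras and centralizers\<close>

lemma assoc_algebra_op:
  assumes "assoc_algebra K S"
  shows "assoc_algebra K (op_algebra S)"
proof -
  interpret S: assoc_algebra K S by fact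
  have ab: "abelian_group (op_algebra S)"
    by (rule abelian_groupI) (auto simp: op_algebra_def S.a_ac intro: S.add.l_inv_ex)
  show ?thesis
  proof (intro assoc_algebra.intro assoc_algebra_axioms.intro)
    show "module K (op_algebra S)"
      by (rule moduleI[OF S.R.is_cring ab])
        (simp_all add: op_algebra_def S.smult_l_distr S.smult_r_distr S.smult_assoc1)
    show "ring (op_algebra S)"
      by (rule ringI[OF ab monoidI]) (simp_all add: op_algebra_def S.m_assoc S.l_distr S.r_distr)
  qed (simp_all add: op_algebra_def S.smult_mult_left S.smult_mult_right)
qed

lemma op_algebra_simps [simp]:
  "carrier (op_algebra S) = carrier S" "x \<otimes>\<^bsub>op_algebra S\<^esub> y = y \<otimes>\<^bsub>S\<^esub> x"
  "x \<oplus>\<^bsub>op_algebra S\<^esub> y = x \<oplus>\<^bsub>S\<^esub> y" "\<one>\<^bsub>op_algebra S\<^esub> = \<one>\<^bsub>S\<^esub>" "\<zero>\<^bsub>op_algebra S\<^esub> = \<zero>\<^bsub>S\<^esub>"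
  "c \<odot>\<^bsub>op_algebra S\<^esub> x = c \<odot>\<^bsub>S\<^esub> x"
  by (simp_all add: op_algebra_def)

text \<open>Balancedness sees only the module structure, not the order of multiplication.\<close>

lemma balanced_op [simp]: "balanced K (op_algebra S) A G f \<longleftrightarrow> balanced K S A G f"
  by (simp add: balanced_def)

lemma ring_centralizer:
  assumes "ring A" "j \<in> carrier S \<rightarrow> carrier A"
  shows "ring (centralizer S A j)"
  unfolding centralizer_def
proof (rule ring.subring_is_ring[OF assms(1)])
  interpret ring A by fact
  have j: "j s \<in> carrier A" if "s \<in> carrier S" for s
    using assms(2) that by blast
  let ?C = "{b \<in> carrier A. \<forall>s\<in>carrier S. j s \<otimes>\<^bsub>A\<^esub> b = b \<otimes>\<^bsub>A\<^esub> j s}"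
  show "subring ?C A"
  proof (rule subringI)
    show "h \<otimes>\<^bsub>A\<^esub> h' \<in> ?C" if "h \<in> ?C" "h' \<in> ?C" for h h'
    proof -
      have "j s \<otimes>\<^bsub>A\<^esub> (h \<otimes>\<^bsub>A\<^esub> h') = h \<otimes>\<^bsub>A\<^esub> h' \<otimes>\<^bsub>A\<^esub> j s" if s: "s \<in> carrier S" for s
      proof -
        have h: "h \<in> carrier A" "h' \<in> carrier A" "j s \<otimes>\<^bsub>A\<^esub> h = h \<otimes>\<^bsub>A\<^esub> j s" "j s \<otimes>\<^bsub>A\<^esub> h' = h' \<otimes>\<^bsub>A\<^esub> j s"
          using \<open>h \<in> ?C\<close> \<open>h' \<in> ?C\<close> s by auto
        have "j s \<otimes>\<^bsub>A\<^esub> (h \<otimes>\<^bsub>A\<^esub> h') = (j s \<otimes>\<^bsub>A\<^esub> h) \<otimes>\<^bsub>A\<^esub> h'"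
          using h(1,2) j[OF s] by (simp add: m_assoc)
        also have "\<dots> = h \<otimes>\<^bsub>A\<^esub> (j s \<otimes>\<^bsub>A\<^esub> h')"
          unfolding h(3) using h(1,2) j[OF s] by (simp add: m_assoc)
        also have "\<dots> = h \<otimes>\<^bsub>A\<^esub> h' \<otimes>\<^bsub>A\<^esub> j s"
          unfolding h(4) using h(1,2) j[OF s] by (simp add: m_assoc)
        finally show ?thesis .
      qed
      then show ?thesis using that by simp
    qed
  qed (auto simp: j r_distr l_distr r_minus l_minus)
qed

section \<open>Frobenius systems with an element of trace one\<close>

locale trace_one = S: assoc_algebra K S + A: assoc_algebra K A for K S A +
  fixes e \<nu> j a
  assumes frob: "frobenius_system K S e \<nu>"
    and j: "j \<in> algebra_hom K S A"
    and a [simp]: "a \<in> carrier A"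
    and trace_one: "tensor_eval A (\<lambda>x y. j x \<otimes>\<^bsub>A\<^esub> a \<otimes>\<^bsub>A\<^esub> j y) e = \<one>\<^bsub>A\<^esub>"
begin

sublocale SS: tensor_product K S S ..

sublocale Op: assoc_algebra K "op_algebra S"
  by (rule assoc_algebra_op) (rule S.assoc_algebra_axioms)

sublocale SA: tensor_product K "op_algebra S" A ..

lemma j_simps [simp]:
  "s \<in> carrier S \<Longrightarrow> j s \<in> carrier A"
  "s \<in> carrier S \<Longrightarrow> t \<in> carrier S \<Longrightarrow> j (s \<otimes>\<^bsub>S\<^esub> t) = j s \<otimes>\<^bsub>A\<^esub> j t"
  "s \<in> carrier S \<Longrightarrow> t \<in> carrier S \<Longrightarrow> j (s \<oplus>\<^bsub>S\<^esub> t) = j s \<oplus>\<^bsub>A\<^esub> j t"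
  "j \<one>\<^bsub>S\<^esub> = \<one>\<^bsub>A\<^esub>"
  "k \<in> carrier K \<Longrightarrow> s \<in> carrier S \<Longrightarrow> j (k \<odot>\<^bsub>S\<^esub> s) = k \<odot>\<^bsub>A\<^esub> j s"
proof -
  have h: "j \<in> ring_hom S A" "\<forall>k\<in>carrier K. \<forall>s\<in>carrier S. j (k \<odot>\<^bsub>S\<^esub> s) = k \<odot>\<^bsub>A\<^esub> j s"
    using j unfolding algebra_hom_def by blast+
  note * = ring_hom_memE[OF h(1)]
  show "s \<in> carrier S \<Longrightarrow> j s \<in> carrier A"
    "s \<in> carrier S \<Longrightarrow> t \<in> carrier S \<Longrightarrow> j (s \<otimes>\<^bsub>S\<^esub> t) = j s \<otimes>\<^bsub>A\<^esub> j t"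
    "s \<in> carrier S \<Longrightarrow> t \<in> carrier S \<Longrightarrow> j (s \<oplus>\<^bsub>S\<^esub> t) = j s \<oplus>\<^bsub>A\<^esub> j t"
    "j \<one>\<^bsub>S\<^esub> = \<one>\<^bsub>A\<^esub>"
    by (rule *; assumption)+
  show "k \<in> carrier K \<Longrightarrow> s \<in> carrier S \<Longrightarrow> j (k \<odot>\<^bsub>S\<^esub> s) = k \<odot>\<^bsub>A\<^esub> j s"
    using h(2) by blast
qed

lemma nu_simps [simp]:
  "s \<in> carrier S \<Longrightarrow> \<nu> s \<in> carrier K"
  "s \<in> carrier S \<Longrightarrow> t \<in> carrier S \<Longrightarrow> \<nu> (s \<oplus>\<^bsub>S\<^esub> t) = \<nu> s \<oplus>\<^bsub>K\<^esub> \<nu> t"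
  "k \<in> carrier K \<Longrightarrow> s \<in> carrier S \<Longrightarrow> \<nu> (k \<odot>\<^bsub>S\<^esub> s) = k \<otimes>\<^bsub>K\<^esub> \<nu> s"
proof -
  have h: "\<nu> \<in> hom (add_monoid S) (add_monoid K)"
    "\<forall>k\<in>carrier K. \<forall>s\<in>carrier S. \<nu> (k \<odot>\<^bsub>S\<^esub> s) = k \<otimes>\<^bsub>K\<^esub> \<nu> s"
    using frob unfolding frobenius_system_def linear_forms_def by blast+
  show "s \<in> carrier S \<Longrightarrow> \<nu> s \<in> carrier K"
    using hom_in_carrier[OF h(1), of s] by simp
  show "s \<in> carrier S \<Longrightarrow> t \<in> carrier S \<Longrightarrow> \<nu> (s \<oplus>\<^bsub>S\<^esub> t) = \<nu> s \<oplus>\<^bsub>K\<^esub> \<nu> t"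
    using hom_mult[OF h(1), of s t] by simp
  show "k \<in> carrier K \<Longrightarrow> s \<in> carrier S \<Longrightarrow> \<nu> (k \<odot>\<^bsub>S\<^esub> s) = k \<otimes>\<^bsub>K\<^esub> \<nu> s"
    using h(2) by blast
qed

text \<open>A fixed representative of \<open>e\<close>. Rewriting under a sum over \<open>c\<close>
  requires no check of balancedness, and its finitely many keys supply the generators of
  \<open>T\<close> over \<open>A\<close>.\<close>

definition c where "c = (SOME c. c \<in> carrier SS.P \<and> e = SS.coset c)"

lemma c: "c \<in> carrier SS.P" "e = SS.coset c"
proof -
  have "e \<in> carrier SS.T" using frob by (simp add: frobenius_system_def)
  then have "\<exists>c. c \<in> carrier SS.P \<and> e = SS.coset c" by (metis SS.cosetE)
  from someI_ex[OF this] show "c \<in> carrier SS.P" "e = SS.coset c"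
    by (simp_all flip: c_def)
qed

lemma keys_c:
  assumes "(p, q) \<in> Poly_Mapping.keys c"
  shows "p \<in> carrier S" "q \<in> carrier S"
  using subsetD[OF c(1)[unfolded SS.carrier_pair_ring] assms] by simp_all

lemma eval_c:
  assumes "abelian_group G" "balanced K S S G f"
  shows "tensor_eval G f e = frag_eval G f c"
  using SS.tensor_eval_coset[OF assms c(1)] unfolding c(2)[symmetric] .

lemma sum_cong:
  assumes "abelian_group G"
    and "\<And>p q. p \<in> carrier S \<Longrightarrow> q \<in> carrier S \<Longrightarrow> f p q \<in> carrier G"
    and "\<And>p q. p \<in> carrier S \<Longrightarrow> q \<in> carrier S \<Longrightarrow> f p q = g p q"
  shows "frag_eval G f c = frag_eval G g c"
proof (rule abelian_group.frag_eval_cong[OF assms(1)])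
  fix p q assume "(p, q) \<in> Poly_Mapping.keys c"
  note pq = keys_c[OF this]
  show "f p q \<in> carrier G" "f p q = g p q" using assms(2,3)[OF pq] .
qed

lemma sum_closed:
  assumes "abelian_group G"
    and "\<And>p q. p \<in> carrier S \<Longrightarrow> q \<in> carrier S \<Longrightarrow> f p q \<in> carrier G"
  shows "frag_eval G f c \<in> carrier G"
  by (rule abelian_group.frag_eval_closed[OF assms(1)]) (simp only: assms(2) keys_c)

lemma sum_hom:
  assumes "abelian_group G" "abelian_group H"
    and "\<And>x. x \<in> carrier G \<Longrightarrow> h x \<in> carrier H"
    and "\<And>x y. x \<in> carrier G \<Longrightarrow> y \<in> carrier G \<Longrightarrow> h (x \<oplus>\<^bsub>G\<^esub> y) = h x \<oplus>\<^bsub>H\<^esub> h y"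
    and "\<And>p q. p \<in> carrier S \<Longrightarrow> q \<in> carrier S \<Longrightarrow> f p q \<in> carrier G"
    and "\<And>p q. p \<in> carrier S \<Longrightarrow> q \<in> carrier S \<Longrightarrow> h (f p q) = g p q"
  shows "h (frag_eval G f c) = frag_eval H g c"
proof -
  have "h (frag_eval G f c) = frag_eval H (\<lambda>p q. h (f p q)) c"
    by (rule frag_eval_hom[OF assms(1-4)]) (simp_all only: assms(5) keys_c)
  also have "\<dots> = frag_eval H g c"
    by (intro sum_cong assms(2,3,5,6))
  finally show ?thesis .
qed

text \<open>The defining identity of \<open>e\<close> holds in the tensor square of
  \<open>S\<close>; apply to it the additive map into \<open>G\<close> induced by
  \<open>g\<close>.\<close>

lemma casimir:
  assumes G: "abelian_group G" and g: "balanced K S S G g" and s: "s \<in> carrier S"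
  shows "frag_eval G (\<lambda>p q. g (s \<otimes>\<^bsub>S\<^esub> p) q) c = frag_eval G (\<lambda>p q. g p (q \<otimes>\<^bsub>S\<^esub> s)) c"
proof -
  let ?L = "\<lambda>p q. pure_tensor K S S (s \<otimes>\<^bsub>S\<^esub> p) q" and ?R = "\<lambda>p q. pure_tensor K S S p (q \<otimes>\<^bsub>S\<^esub> s)"
  note T = SS.T.abelian_group_axioms
  have bal: "balanced K S S SS.T ?L" "balanced K S S SS.T ?R"
    using s SS.balanced_pure
    by (auto simp: balanced_def S.r_distr S.l_distr S.smult_mult_right S.smult_mult_left)
  have LR: "frag_eval SS.T ?L c = frag_eval SS.T ?R c"
    unfolding eval_c[OF T bal(1), symmetric] eval_c[OF T bal(2), symmetric]
    using frob s unfolding frobenius_system_def by blast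
  have "frag_eval G (\<lambda>p q. g (s \<otimes>\<^bsub>S\<^esub> p) q) c = tensor_eval G g (frag_eval SS.T ?L c)"
    using s by (intro sum_hom[OF T G, symmetric])
      (auto intro: SS.tensor_eval_closed[OF G g] SS.tensor_eval_add[OF G g] SS.tensor_eval_pure[OF G g])
  also have "\<dots> = frag_eval G (\<lambda>p q. g p (q \<otimes>\<^bsub>S\<^esub> s)) c"
    unfolding LR using s by (intro sum_hom[OF T G])
      (auto intro: SS.tensor_eval_closed[OF G g] SS.tensor_eval_add[OF G g] SS.tensor_eval_pure[OF G g])
  finally show ?thesis .
qed

text \<open>Moving s across the tensor turns \<nu>(s e^1) e^2 into \<nu>(e^1) e^2 s, and \<nu>(e^1)
  e^2 = 1. Commutativity of \<open>K\<close> makes the summand balanced.\<close>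

lemma dual_basis:
  assumes s: "s \<in> carrier S"
  shows "frag_eval S (\<lambda>p q. \<nu> (s \<otimes>\<^bsub>S\<^esub> p) \<odot>\<^bsub>S\<^esub> q) c = s"
proof -
  have bal: "balanced K S S S (\<lambda>p q. \<nu> p \<odot>\<^bsub>S\<^esub> q)"
    unfolding balanced_def
  proof (intro conjI ballI)
    fix k x y assume *: "k \<in> carrier K" "x \<in> carrier S" "y \<in> carrier S"
    then have "\<nu> (k \<odot>\<^bsub>S\<^esub> x) \<odot>\<^bsub>S\<^esub> y = (\<nu> x \<otimes>\<^bsub>K\<^esub> k) \<odot>\<^bsub>S\<^esub> y"
      by (simp add: S.R.m_comm)
    with * show "\<nu> (k \<odot>\<^bsub>S\<^esub> x) \<odot>\<^bsub>S\<^esub> y = \<nu> x \<odot>\<^bsub>S\<^esub> (k \<odot>\<^bsub>S\<^esub> y)"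
      by (simp add: S.smult_assoc1)
  qed (auto simp: S.smult_l_distr S.smult_r_distr)
  have ab: "abelian_group S" by (rule S.M.abelian_group_axioms)
  have "frag_eval S (\<lambda>p q. \<nu> (s \<otimes>\<^bsub>S\<^esub> p) \<odot>\<^bsub>S\<^esub> q) c = frag_eval S (\<lambda>p q. \<nu> p \<odot>\<^bsub>S\<^esub> (q \<otimes>\<^bsub>S\<^esub> s)) c"
    by (rule casimir[OF ab bal s])
  also have "\<dots> = frag_eval S (\<lambda>p q. \<nu> p \<odot>\<^bsub>S\<^esub> q) c \<otimes>\<^bsub>S\<^esub> s"
    using s by (intro sum_hom[OF ab ab, symmetric]) (auto simp: S.l_distr S.smult_mult_left)
  also have "frag_eval S (\<lambda>p q. \<nu> p \<odot>\<^bsub>S\<^esub> q) c = \<one>\<^bsub>S\<^esub>"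
    using frob by (simp add: frobenius_system_def flip: eval_c[OF ab bal])
  finally show ?thesis using s by simp
qed

section \<open>The trace map, and the centralizer as a corner\<close>

abbreviation B where "B \<equiv> centralizer S A j"
abbreviation T where "T \<equiv> tensor_algebra K (op_algebra S) A"
abbreviation pure (infixl "\<otimes>\<otimes>" 75) where "x \<otimes>\<otimes> y \<equiv> pure_tensor K (op_algebra S) A x y"

lemma ab [simp]: "abelian_group A" "abelian_group T" "abelian_group S"
  by (rule A.M.abelian_group_axioms SA.T.abelian_group_axioms S.M.abelian_group_axioms)+

lemma B_iff: "b \<in> carrier B \<longleftrightarrow> b \<in> carrier A \<and> (\<forall>s\<in>carrier S. j s \<otimes>\<^bsub>A\<^esub> b = b \<otimes>\<^bsub>A\<^esub> j s)"
  by (simp add: centralizer_def)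

lemma B_simps [simp]:
  "x \<otimes>\<^bsub>B\<^esub> y = x \<otimes>\<^bsub>A\<^esub> y" "x \<oplus>\<^bsub>B\<^esub> y = x \<oplus>\<^bsub>A\<^esub> y" "\<one>\<^bsub>B\<^esub> = \<one>\<^bsub>A\<^esub>"
  by (simp_all add: centralizer_def)

sublocale B: ring B
  by (rule ring_centralizer[OF A.ring_axioms]) simp

text \<open>The relative trace from \<open>A\<close> to \<open>B\<close>. For the group algebra of a
  finite group with e the sum of all g \<otimes> g^-1, it is the sum of the conjugates of x.\<close>

definition tr where "tr x = frag_eval A (\<lambda>p q. j p \<otimes>\<^bsub>A\<^esub> x \<otimes>\<^bsub>A\<^esub> j q) c"

lemma balanced_tr:
  assumes "x \<in> carrier A"
  shows "balanced K S S A (\<lambda>p q. j p \<otimes>\<^bsub>A\<^esub> x \<otimes>\<^bsub>A\<^esub> j q)"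
  unfolding balanced_def
  by (intro conjI ballI; use assms in \<open>simp add: A.l_distr A.r_distr A.smult_mult_left A.smult_mult_right\<close>)

lemma tr_closed [simp]: "x \<in> carrier A \<Longrightarrow> tr x \<in> carrier A"
  unfolding tr_def by (intro sum_closed) simp_all

lemma tr_a: "tr a = \<one>\<^bsub>A\<^esub>"
  using trace_one eval_c[OF ab(1) balanced_tr[OF a]] by (simp add: tr_def)

text \<open>The Casimir identity moves s from the left end of the sum to the right end.\<close>

lemma tr_in_B:
  assumes x: "x \<in> carrier A"
  shows "tr x \<in> carrier B"
  unfolding B_iff
proof (intro conjI ballI)
  fix s assume s: "s \<in> carrier S"
  have "j s \<otimes>\<^bsub>A\<^esub> tr x = frag_eval A (\<lambda>p q. j (s \<otimes>\<^bsub>S\<^esub> p) \<otimes>\<^bsub>A\<^esub> x \<otimes>\<^bsub>A\<^esub> j q) c"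
    unfolding tr_def using s x by (intro sum_hom[OF ab(1) ab(1)]) (auto simp: A.r_distr A.m_assoc)
  also have "\<dots> = frag_eval A (\<lambda>p q. j p \<otimes>\<^bsub>A\<^esub> x \<otimes>\<^bsub>A\<^esub> j (q \<otimes>\<^bsub>S\<^esub> s)) c"
    by (rule casimir[OF ab(1) balanced_tr[OF x] s])
  also have "\<dots> = tr x \<otimes>\<^bsub>A\<^esub> j s"
    unfolding tr_def using s x by (intro sum_hom[OF ab(1) ab(1), symmetric]) (auto simp: A.l_distr A.m_assoc)
  finally show "j s \<otimes>\<^bsub>A\<^esub> tr x = tr x \<otimes>\<^bsub>A\<^esub> j s" .
qed (use x in simp)

text \<open>The Casimir identity makes this map linear over \<open>T\<close> for any
  \<open>a\<close>; trace one of \<open>a\<close> makes it a section of \<open>act\<close> at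
  \<open>\<one>\<close>.\<close>

definition \<sigma> where "\<sigma> x = frag_eval T (\<lambda>p q. p \<otimes>\<otimes> (a \<otimes>\<^bsub>A\<^esub> j q \<otimes>\<^bsub>A\<^esub> x)) c"

text \<open>The right \<open>T\<close>-module structure of \<open>A\<close>. The opposite algebra
  turns left multiplication through \<open>j\<close> into a right action.\<close>

definition act where "act x t = tensor_eval A (\<lambda>s y. j s \<otimes>\<^bsub>A\<^esub> x \<otimes>\<^bsub>A\<^esub> y) t"

lemma pure_simps [simp]:
  "s \<in> carrier S \<Longrightarrow> y \<in> carrier A \<Longrightarrow> s \<otimes>\<otimes> y \<in> carrier T"
  "s \<in> carrier S \<Longrightarrow> s' \<in> carrier S \<Longrightarrow> y \<in> carrier A \<Longrightarrow> (s \<oplus>\<^bsub>S\<^esub> s') \<otimes>\<otimes> y = s \<otimes>\<otimes> y \<oplus>\<^bsub>T\<^esub> s' \<otimes>\<otimes> y"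
  "s \<in> carrier S \<Longrightarrow> y \<in> carrier A \<Longrightarrow> y' \<in> carrier A \<Longrightarrow> s \<otimes>\<otimes> (y \<oplus>\<^bsub>A\<^esub> y') = s \<otimes>\<otimes> y \<oplus>\<^bsub>T\<^esub> s \<otimes>\<otimes> y'"
  "k \<in> carrier K \<Longrightarrow> s \<in> carrier S \<Longrightarrow> y \<in> carrier A \<Longrightarrow> (k \<odot>\<^bsub>S\<^esub> s) \<otimes>\<otimes> y = s \<otimes>\<otimes> (k \<odot>\<^bsub>A\<^esub> y)"
  using SA.pure_simps(1-3)[of s] SA.pure_simps(4)[of k] by simp_all

lemma pure_mult [simp]:
  "s \<in> carrier S \<Longrightarrow> y \<in> carrier A \<Longrightarrow> s' \<in> carrier S \<Longrightarrow> y' \<in> carrier A \<Longrightarrow>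
   (s \<otimes>\<otimes> y) \<otimes>\<^bsub>T\<^esub> (s' \<otimes>\<otimes> y') = (s' \<otimes>\<^bsub>S\<^esub> s) \<otimes>\<otimes> (y \<otimes>\<^bsub>A\<^esub> y')"
  using SA.pure_mult[of s y s' y'] by simp

lemma balanced_sigma:
  assumes x: "x \<in> carrier A"
  shows "balanced K S S T (\<lambda>p q. p \<otimes>\<otimes> (a \<otimes>\<^bsub>A\<^esub> j q \<otimes>\<^bsub>A\<^esub> x))"
  unfolding balanced_def
  by (intro conjI ballI; use x in \<open>simp add: A.l_distr A.r_distr A.smult_mult_left A.smult_mult_right\<close>)

lemma balanced_act:
  assumes "x \<in> carrier A"
  shows "balanced K (op_algebra S) A A (\<lambda>s y. j s \<otimes>\<^bsub>A\<^esub> x \<otimes>\<^bsub>A\<^esub> y)"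
  unfolding balanced_def
  by (intro conjI ballI; use assms in \<open>simp add: A.l_distr A.r_distr A.smult_mult_left A.smult_mult_right\<close>)

lemma act_closed [simp]: "x \<in> carrier A \<Longrightarrow> t \<in> carrier T \<Longrightarrow> act x t \<in> carrier A"
  unfolding act_def by (rule SA.tensor_eval_closed[OF ab(1) balanced_act])

lemma act_add: "x \<in> carrier A \<Longrightarrow> t \<in> carrier T \<Longrightarrow> u \<in> carrier T \<Longrightarrow>
    act x (t \<oplus>\<^bsub>T\<^esub> u) = act x t \<oplus>\<^bsub>A\<^esub> act x u"
  unfolding act_def by (rule SA.tensor_eval_add[OF ab(1) balanced_act])

lemma act_pure: "x \<in> carrier A \<Longrightarrow> s \<in> carrier S \<Longrightarrow> y \<in> carrier A \<Longrightarrow>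
    act x (s \<otimes>\<otimes> y) = j s \<otimes>\<^bsub>A\<^esub> x \<otimes>\<^bsub>A\<^esub> y"
  unfolding act_def using SA.tensor_eval_pure[OF ab(1) balanced_act] by simp

lemma sigma_closed [simp]: "x \<in> carrier A \<Longrightarrow> \<sigma> x \<in> carrier T"
  unfolding \<sigma>_def by (intro sum_closed) simp_all

lemma sigma_add:
  assumes "x \<in> carrier A" "y \<in> carrier A"
  shows "\<sigma> (x \<oplus>\<^bsub>A\<^esub> y) = \<sigma> x \<oplus>\<^bsub>T\<^esub> \<sigma> y"
proof -
  have "\<sigma> (x \<oplus>\<^bsub>A\<^esub> y) = frag_eval T (\<lambda>p q. p \<otimes>\<otimes> (a \<otimes>\<^bsub>A\<^esub> j q \<otimes>\<^bsub>A\<^esub> x) \<oplus>\<^bsub>T\<^esub> p \<otimes>\<otimes> (a \<otimes>\<^bsub>A\<^esub> j q \<otimes>\<^bsub>A\<^esub> y)) c"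
    unfolding \<sigma>_def using assms by (intro sum_cong) (auto simp: A.r_distr)
  also have "\<dots> = \<sigma> x \<oplus>\<^bsub>T\<^esub> \<sigma> y"
    unfolding \<sigma>_def using assms keys_c by (intro SA.T.frag_eval_fun_add) auto
  finally show ?thesis .
qed

lemma act_sigma:
  assumes "x \<in> carrier A" "y \<in> carrier A"
  shows "act x (\<sigma> y) = tr (x \<otimes>\<^bsub>A\<^esub> a) \<otimes>\<^bsub>A\<^esub> y"
proof -
  have "act x (\<sigma> y) = frag_eval A (\<lambda>p q. j p \<otimes>\<^bsub>A\<^esub> x \<otimes>\<^bsub>A\<^esub> (a \<otimes>\<^bsub>A\<^esub> j q \<otimes>\<^bsub>A\<^esub> y)) c"
    unfolding \<sigma>_def using assms by (intro sum_hom[OF ab(2) ab(1)]) (auto simp: act_add act_pure)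
  also have "\<dots> = tr (x \<otimes>\<^bsub>A\<^esub> a) \<otimes>\<^bsub>A\<^esub> y"
    unfolding tr_def using assms
    by (intro sum_hom[OF ab(1) ab(1), symmetric]) (auto simp: A.l_distr A.m_assoc)
  finally show ?thesis .
qed

text \<open>An element of the centralizer commutes with j(e^1) and leaves the sum on the left, where
  the trace of \<open>a\<close> remains.\<close>

lemma tr_B:
  assumes "b \<in> carrier B"
  shows "tr (b \<otimes>\<^bsub>A\<^esub> a) = b"
proof -
  have b: "b \<in> carrier A" "\<And>s. s \<in> carrier S \<Longrightarrow> j s \<otimes>\<^bsub>A\<^esub> b = b \<otimes>\<^bsub>A\<^esub> j s"
    using assms by (auto simp: B_iff)
  have "j p \<otimes>\<^bsub>A\<^esub> (b \<otimes>\<^bsub>A\<^esub> a) \<otimes>\<^bsub>A\<^esub> j q = b \<otimes>\<^bsub>A\<^esub> (j p \<otimes>\<^bsub>A\<^esub> a \<otimes>\<^bsub>A\<^esub> j q)"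
    if "p \<in> carrier S" "q \<in> carrier S" for p q
  proof -
    have "j p \<otimes>\<^bsub>A\<^esub> (b \<otimes>\<^bsub>A\<^esub> a) \<otimes>\<^bsub>A\<^esub> j q = (j p \<otimes>\<^bsub>A\<^esub> b) \<otimes>\<^bsub>A\<^esub> a \<otimes>\<^bsub>A\<^esub> j q"
      using that b(1) by (simp add: A.m_assoc)
    then show ?thesis
      using that b by (simp add: A.m_assoc)
  qed
  then have "b \<otimes>\<^bsub>A\<^esub> tr a = tr (b \<otimes>\<^bsub>A\<^esub> a)"
    unfolding tr_def using b(1) by (intro sum_hom[OF ab(1) ab(1)]) (auto simp: A.r_distr)
  then show ?thesis
    using b by (simp add: tr_a)
qed

text \<open>\<open>\<sigma>\<close> is a \<open>T\<close>-linear section of \<open>T \<rightarrow> A\<close>, so \<open>A \<cong> \<sigma>(1) T\<close> and \<open>B = End\<^sub>T(A)\<close> is a corner of \<open>T\<close>.\<close>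

lemma sigma_mult:
  assumes x: "x \<in> carrier A" and t: "t \<in> carrier T"
  shows "\<sigma> x \<otimes>\<^bsub>T\<^esub> t = \<sigma> (act x t)"
  using t
proof (induction t rule: SA.tensor_induct)
  case (pure s y)
  then have sy: "s \<in> carrier S" "y \<in> carrier A" by simp_all
  \<comment> \<open>In the opposite algebra p times s is s p, which is the side from which
    \<open>casimir\<close> can move s over to the other factor.\<close>
  have "\<sigma> x \<otimes>\<^bsub>T\<^esub> (s \<otimes>\<otimes> y) = frag_eval T (\<lambda>p q. (s \<otimes>\<^bsub>S\<^esub> p) \<otimes>\<otimes> (a \<otimes>\<^bsub>A\<^esub> j q \<otimes>\<^bsub>A\<^esub> (x \<otimes>\<^bsub>A\<^esub> y))) c"
    unfolding \<sigma>_def using x sy by (intro sum_hom[OF ab(2) ab(2)]) (auto simp: SA.T.l_distr A.m_assoc)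
  also have "\<dots> = frag_eval T (\<lambda>p q. p \<otimes>\<otimes> (a \<otimes>\<^bsub>A\<^esub> j (q \<otimes>\<^bsub>S\<^esub> s) \<otimes>\<^bsub>A\<^esub> (x \<otimes>\<^bsub>A\<^esub> y))) c"
    using x sy by (intro casimir balanced_sigma ab) simp_all
  also have "\<dots> = \<sigma> (j s \<otimes>\<^bsub>A\<^esub> x \<otimes>\<^bsub>A\<^esub> y)"
    unfolding \<sigma>_def using x sy by (intro sum_cong ab) (simp_all add: A.m_assoc)
  finally show ?case using x sy by (simp add: act_pure)
next
  case (diff t u)
  have "act x (t \<ominus>\<^bsub>T\<^esub> u) = act x t \<ominus>\<^bsub>A\<^esub> act x u"
    using x diff by (intro additive_diff(2)[OF ab(2) ab(1)]) (simp_all add: act_add)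
  moreover have "\<sigma> (act x t \<ominus>\<^bsub>A\<^esub> act x u) = \<sigma> (act x t) \<ominus>\<^bsub>T\<^esub> \<sigma> (act x u)"
    using x diff by (intro additive_diff(2)[OF ab(1) ab(2)]) (simp_all add: sigma_add)
  ultimately show ?case
    using x diff by (simp add: SA.T.minus_eq SA.T.r_distr SA.T.r_minus)
qed

sublocale corner: ring_corner B T \<sigma>
proof
  have BA: "b \<in> carrier A" if "b \<in> carrier B" for b
    using that by (simp add: B_iff)
  show "\<sigma> b \<in> carrier T" if "b \<in> carrier B" for b
    using that BA by simp
  show "\<sigma> (b \<oplus>\<^bsub>B\<^esub> d) = \<sigma> b \<oplus>\<^bsub>T\<^esub> \<sigma> d" if "b \<in> carrier B" "d \<in> carrier B" for b d
    using that BA by (simp add: sigma_add)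
  \<comment> \<open>By linearity the product is \<sigma> of \<open>act b (\<sigma> d)\<close>, which
    is tr(b a) d = b d.\<close>
  show "\<sigma> (b \<otimes>\<^bsub>B\<^esub> d) = \<sigma> b \<otimes>\<^bsub>T\<^esub> \<sigma> d" if "b \<in> carrier B" "d \<in> carrier B" for b d
    using that BA by (simp add: sigma_mult act_sigma tr_B)
  show "inj_on \<sigma> (carrier B)"
  proof (rule inj_on_inverseI)
    show "act \<one>\<^bsub>A\<^esub> (\<sigma> b) = b" if "b \<in> carrier B" for b
      using that BA by (simp add: act_sigma tr_a)
  qed
  \<comment> \<open>Here linearity gives \<sigma> of tr(x a) with x = \<open>act\<close> of
    \<open>\<one>\<close> by t, and traces lie in \<open>B\<close>.\<close>
  show "\<sigma> \<one>\<^bsub>B\<^esub> \<otimes>\<^bsub>T\<^esub> t \<otimes>\<^bsub>T\<^esub> \<sigma> \<one>\<^bsub>B\<^esub> \<in> \<sigma> ` carrier B" if "t \<in> carrier T" for t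
    using that tr_in_B[of "act \<one>\<^bsub>A\<^esub> t \<otimes>\<^bsub>A\<^esub> a"] by (simp add: sigma_mult act_sigma)
qed

lemma right_FBN_B: "right_FBN T \<Longrightarrow> right_FBN B"
  by (rule corner.right_FBN_corner)

section \<open>The tensor product as a finite module over A\<close>

sublocale AT: ring_map A T "\<lambda>y. \<one>\<^bsub>S\<^esub> \<otimes>\<otimes> y"
proof
  show "(\<lambda>y. \<one>\<^bsub>S\<^esub> \<otimes>\<otimes> y) \<in> ring_hom A T"
    using SA.pure_one
    by (intro ring_hom_memI) simp_all
qed

declare AT.phi(2,3) [simp del]

text \<open>By \<open>dual_basis\<close>, s \<otimes> y is the sum of \<nu>(s e^1) e^2 \<otimes> y.
  The scalar moves to the factor \<open>A\<close>, so the finitely many e^2 \<otimes> 1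
  generate.\<close>

lemma AT_finitely_generated: "AT.finitely_generated"
  unfolding AT.finitely_generated_def
proof (intro exI[of _ "(\<lambda>p. snd p \<otimes>\<otimes> \<one>\<^bsub>A\<^esub>) ` Poly_Mapping.keys c"] conjI allI impI)
  show "(\<lambda>p. snd p \<otimes>\<otimes> \<one>\<^bsub>A\<^esub>) ` Poly_Mapping.keys c \<subseteq> carrier T" using keys_c by auto
  fix W assume "AT.submod W \<and> (\<lambda>p. snd p \<otimes>\<otimes> \<one>\<^bsub>A\<^esub>) ` Poly_Mapping.keys c \<subseteq> W"
  then have W: "AT.submod W" "\<And>p q. (p, q) \<in> Poly_Mapping.keys c \<Longrightarrow> q \<otimes>\<otimes> \<one>\<^bsub>A\<^esub> \<in> W"
    by (auto simp: image_subset_iff)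
  note W' = AT.submodD[OF W(1)]
  have "t \<in> W" if "t \<in> carrier T" for t
    using that
  proof (induction t rule: SA.tensor_induct)
    case (pure s y)
    then have sy: "s \<in> carrier S" "y \<in> carrier A" by simp_all
    have "s \<otimes>\<otimes> y = frag_eval S (\<lambda>p q. \<nu> (s \<otimes>\<^bsub>S\<^esub> p) \<odot>\<^bsub>S\<^esub> q) c \<otimes>\<otimes> y"
      using sy by (simp add: dual_basis)
    also have "\<dots> = frag_eval T (\<lambda>p q. (q \<otimes>\<otimes> \<one>\<^bsub>A\<^esub>) \<otimes>\<^bsub>T\<^esub> (\<one>\<^bsub>S\<^esub> \<otimes>\<otimes> (\<nu> (s \<otimes>\<^bsub>S\<^esub> p) \<odot>\<^bsub>A\<^esub> y))) c"
      using sy by (intro sum_hom[OF ab(3) ab(2)]) simp_all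
    also have "\<dots> \<in> W"
    proof (rule SA.T.frag_eval_in[OF W'(2) W'(5) subsetI[OF W'(1)]])
      fix p q assume pq: "(p, q) \<in> Poly_Mapping.keys c"
      show "(q \<otimes>\<otimes> \<one>\<^bsub>A\<^esub>) \<otimes>\<^bsub>T\<^esub> (\<one>\<^bsub>S\<^esub> \<otimes>\<otimes> (\<nu> (s \<otimes>\<^bsub>S\<^esub> p) \<odot>\<^bsub>A\<^esub> y)) \<in> W"
        by (rule W'(4)[OF W(2)[OF pq]]) (use sy keys_c[OF pq] in simp)
    qed
    finally show ?case .
  next
    case (diff t u)
    show ?case by (rule W'(5)[OF diff(3,4)])
  qed
  with W'(1) show "W = carrier T" by blast
qed simp

lemma right_FBN_T: "right_FBN A \<Longrightarrow> right_FBN T"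
  by (rule AT.right_FBN_extension[OF _ AT_finitely_generated])

section \<open>Finite generation of A over the centralizer\<close>

sublocale BA: ring_map B A "\<lambda>b. b"
  by unfold_locales (auto simp: ring_hom_def B_iff)

definition w where "w x = frag_eval T (\<lambda>p q. p \<otimes>\<otimes> (x \<otimes>\<^bsub>A\<^esub> j q)) c"

text \<open>The pairing through \<open>\<nu>\<close> that reads an element t of \<open>T\<close> as
  a map from \<open>S\<close> to \<open>A\<close> in the variable s.\<close>

definition \<Phi> where "\<Phi> s t = tensor_eval A (\<lambda>s' y. \<nu> (s \<otimes>\<^bsub>S\<^esub> s') \<odot>\<^bsub>A\<^esub> y) t"

text \<open>Feeds e^1 into the map that \<open>\<Phi>\<close> attaches to t and closes up with a
  j(e^2), the shape of a trace.\<close>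

definition \<Psi> where "\<Psi> t = frag_eval A (\<lambda>p q. \<Phi> p t \<otimes>\<^bsub>A\<^esub> a \<otimes>\<^bsub>A\<^esub> j q) c"

lemma balanced_Phi:
  assumes s: "s \<in> carrier S"
  shows "balanced K (op_algebra S) A A (\<lambda>s' y. \<nu> (s \<otimes>\<^bsub>S\<^esub> s') \<odot>\<^bsub>A\<^esub> y)"
  unfolding balanced_def
proof (intro conjI ballI)
  fix k x y assume "k \<in> carrier K" "x \<in> carrier (op_algebra S)" "y \<in> carrier A"
  then have *: "k \<in> carrier K" "x \<in> carrier S" "y \<in> carrier A" by simp_all
  then have "\<nu> (s \<otimes>\<^bsub>S\<^esub> (k \<odot>\<^bsub>S\<^esub> x)) \<odot>\<^bsub>A\<^esub> y = (\<nu> (s \<otimes>\<^bsub>S\<^esub> x) \<otimes>\<^bsub>K\<^esub> k) \<odot>\<^bsub>A\<^esub> y"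
    using s by (simp add: S.R.m_comm S.smult_mult_right)
  with * s show "\<nu> (s \<otimes>\<^bsub>S\<^esub> (k \<odot>\<^bsub>op_algebra S\<^esub> x)) \<odot>\<^bsub>A\<^esub> y = \<nu> (s \<otimes>\<^bsub>S\<^esub> x) \<odot>\<^bsub>A\<^esub> (k \<odot>\<^bsub>A\<^esub> y)"
    by (simp add: A.smult_assoc1)
qed (use s in \<open>auto simp: A.smult_l_distr A.smult_r_distr S.r_distr\<close>)

lemma Phi:
  assumes "s \<in> carrier S"
  shows "t \<in> carrier T \<Longrightarrow> \<Phi> s t \<in> carrier A"
    "t \<in> carrier T \<Longrightarrow> u \<in> carrier T \<Longrightarrow> \<Phi> s (t \<oplus>\<^bsub>T\<^esub> u) = \<Phi> s t \<oplus>\<^bsub>A\<^esub> \<Phi> s u"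
    "s' \<in> carrier S \<Longrightarrow> y \<in> carrier A \<Longrightarrow> \<Phi> s (s' \<otimes>\<otimes> y) = \<nu> (s \<otimes>\<^bsub>S\<^esub> s') \<odot>\<^bsub>A\<^esub> y"
  unfolding \<Phi>_def
  using SA.tensor_eval_closed[OF ab(1) balanced_Phi[OF assms]]
    SA.tensor_eval_add[OF ab(1) balanced_Phi[OF assms]]
    SA.tensor_eval_pure[OF ab(1) balanced_Phi[OF assms]] by simp_all

lemma w_closed: "x \<in> carrier A \<Longrightarrow> w x \<in> carrier T"
  unfolding w_def by (intro sum_closed) simp_all

lemma Psi_closed: "t \<in> carrier T \<Longrightarrow> \<Psi> t \<in> carrier A"
  unfolding \<Psi>_def by (intro sum_closed) (simp_all add: Phi(1))

lemma Psi_add: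
  assumes "t \<in> carrier T" "u \<in> carrier T"
  shows "\<Psi> (t \<oplus>\<^bsub>T\<^esub> u) = \<Psi> t \<oplus>\<^bsub>A\<^esub> \<Psi> u"
proof -
  have "\<Psi> (t \<oplus>\<^bsub>T\<^esub> u) = frag_eval A (\<lambda>p q. \<Phi> p t \<otimes>\<^bsub>A\<^esub> a \<otimes>\<^bsub>A\<^esub> j q \<oplus>\<^bsub>A\<^esub> \<Phi> p u \<otimes>\<^bsub>A\<^esub> a \<otimes>\<^bsub>A\<^esub> j q) c"
    unfolding \<Psi>_def using assms by (intro sum_cong) (auto simp: Phi A.l_distr)
  also have "\<dots> = \<Psi> t \<oplus>\<^bsub>A\<^esub> \<Psi> u"
    unfolding \<Psi>_def using assms keys_c by (intro A.frag_eval_fun_add) (auto simp: Phi(1))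
  finally show ?thesis .
qed

text \<open>By \<open>dual_basis\<close>, \<open>\<Phi>\<close> reads the argument of
  \<open>\<Psi>\<close> as the map s -> x j(s) y. The factor x then leaves the sum on the left and
  what remains is a trace.\<close>

lemma Psi_w:
  assumes x: "x \<in> carrier A" and y: "y \<in> carrier A"
  shows "\<Psi> (w x \<otimes>\<^bsub>T\<^esub> (\<one>\<^bsub>S\<^esub> \<otimes>\<otimes> y)) = x \<otimes>\<^bsub>A\<^esub> tr (y \<otimes>\<^bsub>A\<^esub> a)"
proof -
  have wy: "w x \<otimes>\<^bsub>T\<^esub> (\<one>\<^bsub>S\<^esub> \<otimes>\<otimes> y) = frag_eval T (\<lambda>p q. p \<otimes>\<otimes> (x \<otimes>\<^bsub>A\<^esub> j q \<otimes>\<^bsub>A\<^esub> y)) c"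
    unfolding w_def using x y by (intro sum_hom[OF ab(2) ab(2)]) (simp_all add: SA.T.l_distr)
  have "\<Phi> s (w x \<otimes>\<^bsub>T\<^esub> (\<one>\<^bsub>S\<^esub> \<otimes>\<otimes> y)) = x \<otimes>\<^bsub>A\<^esub> j s \<otimes>\<^bsub>A\<^esub> y" if s: "s \<in> carrier S" for s
  proof -
    have "\<Phi> s (w x \<otimes>\<^bsub>T\<^esub> (\<one>\<^bsub>S\<^esub> \<otimes>\<otimes> y)) = frag_eval A (\<lambda>p q. \<nu> (s \<otimes>\<^bsub>S\<^esub> p) \<odot>\<^bsub>A\<^esub> (x \<otimes>\<^bsub>A\<^esub> j q \<otimes>\<^bsub>A\<^esub> y)) c"
      unfolding wy using x y s by (intro sum_hom[OF ab(2) ab(1)]) (simp_all add: Phi)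
    also have "\<dots> = x \<otimes>\<^bsub>A\<^esub> j (frag_eval S (\<lambda>p q. \<nu> (s \<otimes>\<^bsub>S\<^esub> p) \<odot>\<^bsub>S\<^esub> q) c) \<otimes>\<^bsub>A\<^esub> y"
      using x y s
      by (intro sum_hom[OF ab(3) ab(1), symmetric, where h = "\<lambda>u. x \<otimes>\<^bsub>A\<^esub> j u \<otimes>\<^bsub>A\<^esub> y"])
        (simp_all add: A.l_distr A.r_distr A.smult_mult_left A.smult_mult_right)
    finally show ?thesis using s by (simp add: dual_basis)
  qed
  note \<Phi> = this
  have "\<Psi> (w x \<otimes>\<^bsub>T\<^esub> (\<one>\<^bsub>S\<^esub> \<otimes>\<otimes> y)) = frag_eval A (\<lambda>p q. x \<otimes>\<^bsub>A\<^esub> (j p \<otimes>\<^bsub>A\<^esub> (y \<otimes>\<^bsub>A\<^esub> a) \<otimes>\<^bsub>A\<^esub> j q)) c"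
    unfolding \<Psi>_def using x y by (intro sum_cong) (simp_all add: \<Phi> A.m_assoc)
  also have "\<dots> = x \<otimes>\<^bsub>A\<^esub> tr (y \<otimes>\<^bsub>A\<^esub> a)"
    unfolding tr_def using x y by (intro sum_hom[OF ab(1) ab(1), symmetric]) (simp_all add: A.r_distr)
  finally show ?thesis .
qed

text \<open>
  Finitely many \<open>w(x)\<close> generate all of them over \<open>A\<close>, as \<open>T\<close> is a noetherian right \<open>A\<close>-module; by
  the previous lemma the corresponding \<open>x\<close> generate \<open>A\<close> over \<open>B\<close>.
\<close>

lemma BA_finitely_generated:
  assumes noeth: "right_noetherian A"
  shows "BA.finitely_generated"
proof -
  define span where "span F = {t \<in> carrier T. \<forall>W. AT.submod W \<and> w ` F \<subseteq> W \<longrightarrow> t \<in> W}" for F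
  have span: "AT.submod (span F)" for F
    unfolding AT.submod_def
  proof (intro conjI ballI)
    show "\<zero>\<^bsub>T\<^esub> \<in> span F" using AT.submodD(2) by (simp add: span_def)
    show "t \<oplus>\<^bsub>T\<^esub> u \<in> span F" if "t \<in> span F" "u \<in> span F" for t u
      using that AT.submodD(3) by (simp add: span_def)
    show "t \<otimes>\<^bsub>T\<^esub> (\<one>\<^bsub>S\<^esub> \<otimes>\<otimes> y) \<in> span F" if "t \<in> span F" "y \<in> carrier A" for t y
      using that AT.submodD(4) by (simp add: span_def)
  qed (auto simp: span_def)
  let ?\<F> = "span ` {F. finite F \<and> F \<subseteq> carrier A}"
  have ne: "span {} \<in> ?\<F>" by blast
  have sub: "AT.submod W" if "W \<in> ?\<F>" for W using that span by blast
  obtain M where "M \<in> ?\<F>" and max: "\<And>W. W \<in> ?\<F> \<Longrightarrow> M \<subseteq> W \<Longrightarrow> W = M"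
    using AT.submod_maximal[OF noeth AT_finitely_generated sub ne] by blast
  then obtain F where F: "finite F" "F \<subseteq> carrier A" "M = span F" by blast
  have wM: "w x \<in> span F" if x: "x \<in> carrier A" for x
  proof -
    have "span F \<subseteq> span (insert x F)" unfolding span_def by blast
    moreover have "span (insert x F) \<in> ?\<F>" using F x by blast
    ultimately have "span (insert x F) = span F" using max F(3) by blast
    moreover have "w x \<in> span (insert x F)" using x w_closed by (simp add: span_def)
    ultimately show ?thesis by simp
  qed
  have "N = carrier A" if N: "BA.submod N" "F \<subseteq> N" for N
  proof -
    note N' = BA.submodD[OF N(1)]
    \<comment> \<open>\<open>\<Psi>\<close> need not be linear over \<open>A\<close>, as
      \<open>a\<close> stands between its factors; quantifying over y makes \<open>U\<close> a
      submodule. For x in \<open>F\<close> the values x tr(y a) stay in \<open>N\<close> because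
      traces lie in \<open>B\<close>.\<close>
    define U where "U = {t \<in> carrier T. \<forall>y\<in>carrier A. \<Psi> (t \<otimes>\<^bsub>T\<^esub> (\<one>\<^bsub>S\<^esub> \<otimes>\<otimes> y)) \<in> N}"
    have Psi0: "\<Psi> \<zero>\<^bsub>T\<^esub> = \<zero>\<^bsub>A\<^esub>"
      by (rule additive_diff(1)[OF ab(2) ab(1)]) (simp_all add: Psi_closed Psi_add)
    have "AT.submod U"
      unfolding AT.submod_def
    proof (intro conjI ballI)
      show "\<zero>\<^bsub>T\<^esub> \<in> U" using N'(2) by (simp add: U_def Psi0)
      show "t \<oplus>\<^bsub>T\<^esub> u \<in> U" if "t \<in> U" "u \<in> U" for t u
        using that N'(3) by (simp add: U_def SA.T.l_distr Psi_add)
      show "t \<otimes>\<^bsub>T\<^esub> (\<one>\<^bsub>S\<^esub> \<otimes>\<otimes> y) \<in> U" if ty: "t \<in> U" "y \<in> carrier A" for t y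
      proof -
        have t: "t \<in> carrier T" using ty(1) unfolding U_def by blast
        have "\<Psi> (t \<otimes>\<^bsub>T\<^esub> (\<one>\<^bsub>S\<^esub> \<otimes>\<otimes> y) \<otimes>\<^bsub>T\<^esub> (\<one>\<^bsub>S\<^esub> \<otimes>\<otimes> y')) \<in> N" if y': "y' \<in> carrier A" for y'
        proof -
          have "t \<otimes>\<^bsub>T\<^esub> (\<one>\<^bsub>S\<^esub> \<otimes>\<otimes> y) \<otimes>\<^bsub>T\<^esub> (\<one>\<^bsub>S\<^esub> \<otimes>\<otimes> y') = t \<otimes>\<^bsub>T\<^esub> (\<one>\<^bsub>S\<^esub> \<otimes>\<otimes> (y \<otimes>\<^bsub>A\<^esub> y'))"
            using t ty(2) y' by (simp add: SA.T.m_assoc)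
          moreover have "\<Psi> (t \<otimes>\<^bsub>T\<^esub> (\<one>\<^bsub>S\<^esub> \<otimes>\<otimes> (y \<otimes>\<^bsub>A\<^esub> y'))) \<in> N"
            using ty(1) A.m_closed[OF ty(2) y'] unfolding U_def by blast
          ultimately show ?thesis by simp
        qed
        with t ty(2) show ?thesis by (simp add: U_def)
      qed
    qed (auto simp: U_def)
    moreover have "w ` F \<subseteq> U"
    proof
      fix t assume "t \<in> w ` F"
      then obtain x where x: "x \<in> F" "t = w x" by blast
      have xN: "x \<in> carrier A" "x \<in> N" using x(1) F(2) N(2) by blast+
      have "\<Psi> (t \<otimes>\<^bsub>T\<^esub> (\<one>\<^bsub>S\<^esub> \<otimes>\<otimes> y)) \<in> N" if y: "y \<in> carrier A" for y
        unfolding x(2) Psi_w[OF xN(1) y] by (intro N'(4) xN(2) tr_in_B) (use y in simp)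
      with x(2) w_closed[OF xN(1)] show "t \<in> U" by (simp add: U_def)
    qed
    ultimately have U: "w x \<in> U" if "x \<in> carrier A" for x
      using wM[OF that] by (simp add: span_def)
    have "x \<in> N" if x: "x \<in> carrier A" for x
    proof -
      \<comment> \<open>At y = 1 the value is x tr(a), that is x itself.\<close>
      have "\<Psi> (w x \<otimes>\<^bsub>T\<^esub> (\<one>\<^bsub>S\<^esub> \<otimes>\<otimes> \<one>\<^bsub>A\<^esub>)) \<in> N"
        using U[OF x] unfolding U_def by blast
      then show ?thesis using Psi_w[OF x A.one_closed] x by (simp add: tr_a)
    qed
    then show ?thesis using N'(1) by blast
  qed
  then show ?thesis
    unfolding BA.finitely_generated_def using F(1,2) by blast
qed

lemma right_FBN_A: "right_FBN B \<Longrightarrow> right_noetherian A \<Longrightarrow> right_FBN A"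
  by (rule BA.right_FBN_extension[OF _ BA_finitely_generated])

end

theorem corollary5p1:
  fixes K :: "('k, 'c) ring_scheme"
    and S :: "('k, 's, 'm) module_scheme"
    and A :: "('k, 'a, 'n) module_scheme"
    and e :: "('s \<times> 's \<Rightarrow>\<^sub>0 int) set"
    and \<nu> :: "'s \<Rightarrow> 'k"
    and j :: "'s \<Rightarrow> 'a"
  assumes "cring K"
    and "assoc_algebra K S"
    and "frobenius_system K S e \<nu>"
    and "assoc_algebra K A"
    and "j \<in> algebra_hom K S A"
    and "\<exists>a\<in>carrier A. tensor_eval A (\<lambda>x y. j x \<otimes>\<^bsub>A\<^esub> a \<otimes>\<^bsub>A\<^esub> j y) e = \<one>\<^bsub>A\<^esub>"
  shows "(right_FBN A \<longleftrightarrow>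
            right_FBN (tensor_algebra K (op_algebra S) A) \<and> right_noetherian A) \<and>
         (right_FBN A \<longleftrightarrow>
            right_FBN (centralizer S A j) \<and> right_noetherian A)"
proof -
  obtain a where "a \<in> carrier A" "tensor_eval A (\<lambda>x y. j x \<otimes>\<^bsub>A\<^esub> a \<otimes>\<^bsub>A\<^esub> j y) e = \<one>\<^bsub>A\<^esub>"
    using assms(6) by blast
  then interpret trace_one K S A e \<nu> j a
    using assms by (simp add: trace_one_def trace_one_axioms_def)
  have "right_FBN A \<Longrightarrow> right_noetherian A"
    by (simp add: right_FBN_def)
  with right_FBN_T right_FBN_B right_FBN_A show ?thesis by blast
qed

end
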